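(* Let $\alpha,\alpha',\beta,\beta',\gamma,\rho,a\in\mathbb{C}$ with $a\ne0$, and let $\mu$ be a real number, such that $\operatorname{Re}(\gamma)>0$, $\mu>0$ and $\operatorname{Re}(\rho)>\max\{\operatorname{Re}(\beta),\operatorname{Re}(-\alpha-\alpha'+\gamma),\operatorname{Re}(-\alpha-\beta'+\gamma)\}$. Then for every $x>0$, $$\left(\mathcal{I}_{-}^{\alpha,\alpha',\beta,\beta',\gamma}\left(t^{-\rho}I^{m,n}_{p,q}\left[at^{-\mu}\,\middle|\begin{matrix}(a_i,A_i,\alpha_i)_{1,p}\\(b_j,B_j,\beta_j)_{1,q}\end{matrix}\right]\right)\right)(x)=x^{-\alpha-\alpha'+\gamma-\rho}\,I^{m,n+3}_{p+3,q+3}\left[ax^{-\mu}\,\middle|\begin{matrix}U\\L\end{matrix}\right],$$ where the list of upper triples is $$U=(1+\beta-\rho,\mu,1),\ (1-\alpha-\alpha'+\gamma-\rho,\mu,1),\ (1-\alpha-\beta'+\gamma-\rho,\mu,1),\ (a_i,A_i,\alpha_i)_{1,p}$$ and the list of lower triples is $$L=(b_j,B_j,\beta_j)_{1,q},\ (1-\rho,\mu,1),\ (1-\alpha+\beta-\rho,\mu,1),\ (1-\alpha-\alpha'-\beta'+\gamma-\rho,\mu,1).$$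
   Context: **$I$-function.** Let $m,n,p,q$ be integers with $0\le m\le q$, $0\le n\le p$; let $a_i\in\mathbb{C}$, $A_i,\alpha_i>0$ $(1\le i\le p)$ and $b_j\in\mathbb{C}$, $B_j,\beta_j>0$ $(1\le j\le q)$. For $z\neq0$ (with a chosen value of $\arg z$; $z^{-s}=e^{-s(\log|z|+i\arg z)}$), $$I^{m,n}_{p,q}\left[z\,\middle|\begin{matrix}(a_i,A_i,\alpha_i)_{1,p}\\(b_j,B_j,\beta_j)_{1,q}\end{matrix}\right]=\frac{1}{2\pi i}\int_{C}\chi(s)z^{-s}\,ds,\qquad \chi(s)=\frac{\prod_{j=1}^{m}\Gamma^{\beta_j}(b_j+B_js)\prod_{i=1}^{n}\Gamma^{\alpha_i}(1-a_i-A_is)}{\prod_{j=m+1}^{q}\Gamma^{\beta_j}(1-b_j-B_js)\prod_{i=n+1}^{p}\Gamma^{\alpha_i}(a_i+A_is)}.$$ Here $(a_i,A_i,\alpha_i)_{1,p}$ is the ordered list of triples for $i=1,\dots,p$ (the first $n$ upper triples and the first $m$ lower triples enter the numerator), $\Gamma^{\kappa}(w)=(\Gamma(w))^{\kappa}$, with the branch of non-integer powers fixed along $C$ and the same for the same triple in all $I$-functions considered; empty products equal $1$. The singularities of $\Gamma^{\beta_j}(b_j+B_js)$, $j\le m$, lie to the left of $C$ and those of $\Gamma^{\alpha_i}(1-a_i-A_is)$, $i\le n$, to the right. **Standing assumptions.** The contour $C$ is the imaginary axis $\operatorname{Re}(s)=0$, traversed upwards, and for each $I$-function occurring the following conditions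 for absolute convergence hold: with (computed from the parameters of that $I$-function) $\mu^*=\sum_{j=1}^q\beta_jB_j-\sum_{i=1}^p\alpha_iA_i$, $\Omega=\sum_{i=1}^p(\frac12-\operatorname{Re}(a_i))\alpha_i-\sum_{j=1}^q(\frac12-\operatorname{Re}(b_j))\beta_j$, $\Delta=\sum_{j=1}^m\beta_jB_j-\sum_{j=m+1}^q\beta_jB_j+\sum_{i=1}^n\alpha_iA_i-\sum_{i=n+1}^p\alpha_iA_i$, either $\Delta>0$ and $|\arg z|<\frac{\pi}{2}\Delta$, or $\Delta\ge0$, $|\arg z|=\frac{\pi}{2}\Delta$ and one of: $\mu^*=0$ and $\Omega<-1$; or $\mu^*\ne0$ and $\Omega+\sigma\mu^*<-1$ where $\sigma=\operatorname{Re}(s)$ on $C$ (so $\sigma=0$). For $t>0$, $\arg(at^{\pm\mu})=\arg a$. **Operator.** For $\operatorname{Re}(\gamma)>0$, $x>0$, the right-sided Marichev–Saigo–Maeda (MSM) fractional integral is $$\left(\mathcal{I}_{-}^{\alpha,\alpha',\beta,\beta',\gamma}f\right)(x)=\frac{x^{-\alpha'}}{\Gamma(\gamma)}\int_x^{\infty}(t-x)^{\gamma-1}t^{-\alpha}F_3\left(\alpha,\alpha',\beta,\beta';\gamma;1-\tfrac{x}{t},1-\tfrac{t}{x}\right)f(t)\,dt .$$ $F_3(\alpha,\alpha',\beta,\beta';\gamma;u,v)=\sum_{k,l\ge0}\frac{(\alpha)_k(\alpha')_l(\beta)_k(\beta')_l}{(\gamma)_{k+l}}\frac{u^kv^l}{k!\,l!}$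 for $\max\{|u|,|v|\}<1$ (third Appell function, $(\cdot)_k$ the Pochhammer symbol), and for $u\in[0,1)$, $v\le0$ it denotes the analytic continuation $\sum_{k\ge0}\frac{(\alpha)_k(\beta)_k}{(\gamma)_k}\frac{u^k}{k!}\,{}_2F_1(\alpha',\beta';\gamma+k;v)$. *)

theory Defs
  imports "HOL-Analysis.Analysis"
begin

(* The multivalued power z^kappa = exp (kappa * log z), for z = Gamma (w s): a branch along the
   imaginary axis is a continuous choice of values. Where w s is a pole of Gamma the branch is
   given the value 0 (the library's convention for Gamma itself), so that 1 / Gamma^kappa is 0
   there, as it should be. *)
definition is_Gamma_power_branch ::
    "real \<Rightarrow> (complex \<Rightarrow> complex) \<Rightarrow> (complex \<Rightarrow> complex) \<Rightarrow> bool" where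
  "is_Gamma_power_branch \<kappa> w P \<longleftrightarrow>
     continuous_on {s. Re s = 0 \<and> w s \<notin> \<int>\<^sub>\<le>\<^sub>0} P \<and>
     (\<forall>s. Re s = 0 \<longrightarrow>
        (if w s \<in> \<int>\<^sub>\<le>\<^sub>0 then P s = 0
         else \<exists>l. exp l = Gamma (w s) \<and> P s = exp (of_real \<kappa> * l)))"

(* A simultaneous choice of branches: br \<kappa> c d is the chosen branch of Gamma^\<kappa> (c + d s).
   A triple (a, A, \<alpha>) occurs through c + d s = a + A s or c + d s = 1 - a - A s; as br takes only
   \<kappa>, c, d, equal triples get equal branches in all I-functions. *)
type_synonym Gamma_branches = "real \<Rightarrow> complex \<Rightarrow> real \<Rightarrow> complex \<Rightarrow> complex"

definition Gamma_branch_choice :: "Gamma_branches \<Rightarrow> bool" where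
  "Gamma_branch_choice br \<longleftrightarrow>
     (\<forall>\<kappa> c d. \<kappa> > 0 \<and> d \<noteq> 0 \<longrightarrow>
        is_Gamma_power_branch \<kappa> (\<lambda>s. c + of_real d * s) (br \<kappa> c d))"

(* (a, A, \<alpha>) with a complex, A and \<alpha> positive real; p and q are the lengths of the lists
   us (upper triples) and ls (lower triples). *)
type_synonym triple = "complex \<times> real \<times> real"

definition I_chi ::
    "Gamma_branches \<Rightarrow> nat \<Rightarrow> nat \<Rightarrow> triple list \<Rightarrow> triple list \<Rightarrow> complex \<Rightarrow> complex" where
  "I_chi br m n us ls s =
     ((\<Prod>(b, B, \<beta>)\<leftarrow>take m ls. br \<beta> b B s) *
      (\<Prod>(a, A, \<alpha>)\<leftarrow>take n us. br \<alpha> (1 - a) (- A) s)) /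
     ((\<Prod>(b, B, \<beta>)\<leftarrow>drop m ls. br \<beta> (1 - b) (- B) s) *
      (\<Prod>(a, A, \<alpha>)\<leftarrow>drop n us. br \<alpha> a A s))"

(* \<theta> is the chosen value of arg z; the contour is s = \<i> y, ds = \<i> dy. *)
definition I_fun ::
    "Gamma_branches \<Rightarrow> nat \<Rightarrow> nat \<Rightarrow> triple list \<Rightarrow> triple list \<Rightarrow> real \<Rightarrow> complex \<Rightarrow> complex" where
  "I_fun br m n us ls \<theta> z =
     1 / (2 * of_real pi * \<i>) *
     (LINT y|lborel.
        I_chi br m n us ls (\<i> * of_real y) *
        exp (- (\<i> * of_real y) * (of_real (ln (cmod z)) + \<i> * of_real \<theta>)) * \<i>)"

definition I_parameters :: "nat \<Rightarrow> nat \<Rightarrow> triple list \<Rightarrow> triple list \<Rightarrow> bool" where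
  "I_parameters m n us ls \<longleftrightarrow>
     m \<le> length ls \<and> n \<le> length us \<and>
     (\<forall>(a, A, \<alpha>)\<in>set us. A > 0 \<and> \<alpha> > 0) \<and>
     (\<forall>(b, B, \<beta>)\<in>set ls. B > 0 \<and> \<beta> > 0)"

definition I_contour_separates :: "nat \<Rightarrow> nat \<Rightarrow> triple list \<Rightarrow> triple list \<Rightarrow> bool" where
  "I_contour_separates m n us ls \<longleftrightarrow>
     (\<forall>(b, B, \<beta>)\<in>set (take m ls). \<forall>s. b + of_real B * s \<in> \<int>\<^sub>\<le>\<^sub>0 \<longrightarrow> Re s < 0) \<and>
     (\<forall>(a, A, \<alpha>)\<in>set (take n us). \<forall>s. 1 - a - of_real A * s \<in> \<int>\<^sub>\<le>\<^sub>0 \<longrightarrow> Re s > 0)"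

definition I_mu :: "triple list \<Rightarrow> triple list \<Rightarrow> real" where
  "I_mu us ls = (\<Sum>(b, B, \<beta>)\<leftarrow>ls. \<beta> * B) - (\<Sum>(a, A, \<alpha>)\<leftarrow>us. \<alpha> * A)"

definition I_Omega :: "triple list \<Rightarrow> triple list \<Rightarrow> real" where
  "I_Omega us ls =
     (\<Sum>(a, A, \<alpha>)\<leftarrow>us. (1/2 - Re a) * \<alpha>) - (\<Sum>(b, B, \<beta>)\<leftarrow>ls. (1/2 - Re b) * \<beta>)"

definition I_Delta :: "nat \<Rightarrow> nat \<Rightarrow> triple list \<Rightarrow> triple list \<Rightarrow> real" where
  "I_Delta m n us ls =
     (\<Sum>(b, B, \<beta>)\<leftarrow>take m ls. \<beta> * B) - (\<Sum>(b, B, \<beta>)\<leftarrow>drop m ls. \<beta> * B) +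
     (\<Sum>(a, A, \<alpha>)\<leftarrow>take n us. \<alpha> * A) - (\<Sum>(a, A, \<alpha>)\<leftarrow>drop n us. \<alpha> * A)"

(* \<sigma> is the abscissa of the vertical contour; the imaginary axis is \<sigma> = 0. *)
definition I_convergence ::
    "real \<Rightarrow> nat \<Rightarrow> nat \<Rightarrow> triple list \<Rightarrow> triple list \<Rightarrow> real \<Rightarrow> bool" where
  "I_convergence \<sigma> m n us ls \<theta> \<longleftrightarrow>
     (I_Delta m n us ls > 0 \<and> \<bar>\<theta>\<bar> < pi / 2 * I_Delta m n us ls) \<or>
     (I_Delta m n us ls \<ge> 0 \<and> \<bar>\<theta>\<bar> = pi / 2 * I_Delta m n us ls \<and>
       ((I_mu us ls = 0 \<and> I_Omega us ls < -1) \<or>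
        (I_mu us ls \<noteq> 0 \<and> I_Omega us ls + \<sigma> * I_mu us ls < -1)))"

definition I_admissible ::
    "nat \<Rightarrow> nat \<Rightarrow> triple list \<Rightarrow> triple list \<Rightarrow> real \<Rightarrow> bool" where
  "I_admissible m n us ls \<theta> \<longleftrightarrow>
     I_parameters m n us ls \<and> I_contour_separates m n us ls \<and> I_convergence 0 m n us ls \<theta>"

(* The Gauss function: the analytic continuation of the hypergeometric series from 0 to v along
   the straight segment. For v outside [1, \<infinity>) this is the usual principal branch. By the
   identity theorem the value does not depend on S and f. *)
definition Gauss_2F1 :: "complex \<Rightarrow> complex \<Rightarrow> complex \<Rightarrow> complex \<Rightarrow> complex" where
  "Gauss_2F1 a b c v =
     (THE w. \<exists>S f. open S \<and> closed_segment 0 v \<subseteq> S \<and> f holomorphic_on S \<and>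
        f has_fps_expansion fps_hypergeo [a, b] [c] 1 \<and> f v = w)"

(* Used for u in [0, 1) and v \<le> 0 only, where it is the continuation of the double series. *)
definition Appell_F3 ::
    "complex \<Rightarrow> complex \<Rightarrow> complex \<Rightarrow> complex \<Rightarrow> complex \<Rightarrow> complex \<Rightarrow> complex \<Rightarrow> complex" where
  "Appell_F3 \<alpha> \<alpha>' \<beta> \<beta>' \<gamma> u v =
     (\<Sum>k. pochhammer \<alpha> k * pochhammer \<beta> k / pochhammer \<gamma> k * (u ^ k / fact k) *
          Gauss_2F1 \<alpha>' \<beta>' (\<gamma> + of_nat k) v)"

definition MSM_right_integrand ::
    "complex \<Rightarrow> complex \<Rightarrow> complex \<Rightarrow> complex \<Rightarrow> complex \<Rightarrow> (real \<Rightarrow> complex) \<Rightarrow> real \<Rightarrow> real \<Rightarrow> complex"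
  where
  "MSM_right_integrand \<alpha> \<alpha>' \<beta> \<beta>' \<gamma> f x t =
     of_real (t - x) powr (\<gamma> - 1) * of_real t powr (- \<alpha>) *
     Appell_F3 \<alpha> \<alpha>' \<beta> \<beta>' \<gamma> (of_real (1 - x / t)) (of_real (1 - t / x)) * f t"

definition MSM_right ::
    "complex \<Rightarrow> complex \<Rightarrow> complex \<Rightarrow> complex \<Rightarrow> complex \<Rightarrow> (real \<Rightarrow> complex) \<Rightarrow> real \<Rightarrow> complex" where
  "MSM_right \<alpha> \<alpha>' \<beta> \<beta>' \<gamma> f x =
     of_real x powr (- \<alpha>') / Gamma \<gamma> *
     (LINT t:{x<..}|lborel. MSM_right_integrand \<alpha> \<alpha>' \<beta> \<beta>' \<gamma> f x t)"

end

theory Submission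
  imports Defs "HOL-Complex_Analysis.Complex_Analysis"
begin

text \<open>
  On the contour \<open>Re s = 0\<close> the function \<open>I[a t^(-\<mu>)]\<close> is a superposition of the powers
  \<open>t^(\<mu> s)\<close> with weight \<open>\<chi>(s) a^(-s)\<close>, so the operator acts on a superposition of the powers
  \<open>t^(-(\<rho> - \<mu> s))\<close>. The operator maps a single power \<open>t^(-\<rho>)\<close> to \<open>x^(-\<alpha>-\<alpha>'+\<gamma>-\<rho>)\<close> times a quotient of
  six gamma functions (\<open>MSM_right_power\<close>), and this quotient, taken at \<open>\<rho> - \<mu> s\<close>, is the factor by
  which the six additional triples change \<open>\<chi>(s)\<close>. The two integrations may be interchanged because
  \<open>\<bar>t^(\<mu> s)\<bar> = 1\<close> on the contour: the absolute value of the double integrand is a product of a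
  function of \<open>t\<close> and a function of \<open>s\<close>, and it suffices that each of them is integrable.

  Integrability in \<open>s\<close> (\<open>I_fun_integrand_integrable\<close>). Up to a constant factor
  \<open>\<bar>\<Gamma>(\<sigma> + i t)\<bar>\<close> is at most \<open>\<bar>t\<bar>^(\<sigma> - 1/2) exp (- \<pi> \<bar>t\<bar> / 2)\<close> away from the real axis, and
  its reciprocal obeys the reciprocal bound. Hence \<open>\<chi>\<close> grows at most like
  \<open>(1 + \<bar>s\<bar>)^\<Omega> exp (- \<pi> \<Delta> \<bar>s\<bar> / 2)\<close>, and the convergence conditions make this integrable against \<open>z^(-s)\<close>.
  The boundary case \<open>\<bar>\<theta>\<bar> = \<pi> \<Delta> / 2\<close> calls for the sharp exponent \<open>\<sigma> - 1/2\<close>. For \<open>\<sigma> = 1/2\<close>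
  the bound follows from the reflection formula; it is carried to the strip
  \<open>1/2 \<le> \<sigma> \<le> 3/2\<close> by interpolating factor by factor in Gauss's product
  (\<open>norm_Gamma_interpolation_le\<close>) and then to all \<open>\<sigma>\<close> by the functional equation.

  The integral of a power. The Appell function is a series over \<open>k\<close> of Gauss functions with
  parameters \<open>\<alpha>', \<beta>'; \<gamma> + k\<close> at \<open>1 - t/x\<close>. Pfaff's transformation (\<open>Gauss_2F1_Pfaff\<close>) expands each of
  them in powers of \<open>1 - x/t\<close>, which lies in \<open>(0,1)\<close>; the terms are beta integrals, and Gauss's
  theorem sums them (\<open>Gauss_kernel_integral\<close>). Gauss's theorem applied once more sums over \<open>k\<close>.
  The sum over \<open>k\<close> and the integral may be interchanged because, with \<open>\<lambda> = \<alpha> + \<rho> - \<gamma>\<close>, the \<open>k\<close>-th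
  Gauss function has an integral norm of order at most \<open>k^(- Re \<lambda>)\<close> (\<open>Gauss_kernel_norm_le\<close>). Term-wise
  estimates prove this for \<open>Re \<alpha>' \<ge> 1\<close>. For negative \<open>Re \<alpha>'\<close> they lose the cancellation in
  Pfaff's series; the contiguous relation that raises \<open>\<alpha>'\<close> by one reduces all other cases to this one.
\<close>

section \<open>Ratios of Pochhammer symbols\<close>

lemma Re_pos_not_nonpos_Int: "Re z > 0 \<Longrightarrow> z \<notin> \<int>\<^sub>\<le>\<^sub>0" for z :: complex
  by (auto elim!: nonpos_Ints_cases)

lemma norm_one_plus_le_exp: "norm (1 + z :: complex) \<le> exp (Re z + (norm z)\<^sup>2 / 2)"
proof (rule power2_le_imp_le)
  have "(norm (1 + z))\<^sup>2 = 1 + (2 * Re z + (norm z)\<^sup>2)"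
    unfolding cmod_power2 by (simp add: power2_eq_square algebra_simps)
  also have "\<dots> \<le> exp (2 * Re z + (norm z)\<^sup>2)"
    by (rule exp_ge_add_one_self)
  also have "\<dots> = (exp (Re z + (norm z)\<^sup>2 / 2))\<^sup>2"
    by (simp add: exp_double [symmetric] algebra_simps)
  finally show "(norm (1 + z))\<^sup>2 \<le> (exp (Re z + (norm z)\<^sup>2 / 2))\<^sup>2" .
qed simp

text \<open>
  The quotient is \<open>1 + (p - q)/(q + n)\<close>, hence \<open>1 + (p - q)/(n + 1)\<close> up to order \<open>n^(-2)\<close>. The error
  is written as a difference of consecutive reciprocals, so that it telescopes in products.
\<close>

lemma norm_shifted_ratio_le:
  fixes p q :: complex
  assumes "Re q > 0"
  obtains M where "M \<ge> 0"
    "\<And>n. norm ((p + of_nat n) / (q + of_nat n)) \<le>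
       ((real n + 2) / (real n + 1)) powr Re (p - q) * exp (M * (1 / (real n + 1) - 1 / (real n + 2)))"
proof
  define m where "m = min 1 (Re q)"
  define d where "d = Re (p - q)"
  define K where "K = norm (p - q) * norm (1 - q) / m + (norm (p - q))\<^sup>2 / (2 * m\<^sup>2) + \<bar>d\<bar>"
  have m: "m > 0" using assms by (simp add: m_def)
  have K: "K \<ge> 0" using m by (simp add: K_def)
  then show "2 * K \<ge> 0" by simp
  fix n
  define N where "N = real n + 1"
  have N: "N \<ge> 1" by (simp add: N_def)
  \<comment> \<open>For Re q < 1 the modulus of q + n may be smaller than n + 1; the factor m allows for that.\<close>
  have qn: "norm (q + of_nat n) \<ge> m * N"
  proof -
    have "m * N = m * real n + m" by (simp add: N_def algebra_simps)
    also have "m * real n \<le> 1 * real n" by (intro mult_right_mono) (auto simp: m_def)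
    also have "1 * real n + m \<le> Re (q + of_nat n)" by (simp add: m_def)
    also have "\<dots> \<le> norm (q + of_nat n)" by (rule complex_Re_le_cmod)
    finally show ?thesis by simp
  qed
  have mN: "m * N > 0" using m N by simp
  have qn0: "q + of_nat n \<noteq> 0" using qn mN by (metis norm_zero not_less)
  define z where "z = (p - q) / (q + of_nat n)"
  have "(p + of_nat n) / (q + of_nat n) = 1 + z"
    using qn0 by (simp add: z_def field_simps)
  then have "norm ((p + of_nat n) / (q + of_nat n)) \<le> exp (Re z + (norm z)\<^sup>2 / 2)"
    using norm_one_plus_le_exp[of z] by simp
  also have "Re z + (norm z)\<^sup>2 / 2 \<le> d * ln ((real n + 2) / (real n + 1)) + 2 * K * (1 / (real n + 1) - 1 / (real n + 2))"
  proof -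
    have nz: "norm z \<le> norm (p - q) / (m * N)"
      unfolding z_def norm_divide
      using qn mN m N qn0 by (intro divide_left_mono mult_pos_pos) auto
    then have "(norm z)\<^sup>2 \<le> (norm (p - q) / (m * N))\<^sup>2" by (intro power_mono) auto
    then have 1: "(norm z)\<^sup>2 / 2 \<le> (norm (p - q))\<^sup>2 / (2 * m\<^sup>2) * (1 / N\<^sup>2)"
      by (simp add: power_mult_distrib power_divide)
    have "z - (p - q) / of_real N = z * (1 - q) / of_real N"
    proof -
      have "1 + of_nat n \<noteq> (0 :: complex)"
        by (metis of_nat_Suc of_nat_eq_0_iff nat.distinct(1))
      then show ?thesis
        using qn0 by (simp add: z_def N_def divide_simps add_ac) (simp add: algebra_simps)
    qed
    then have "Re z - d / N = Re (z * (1 - q) / of_real N)"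
      by (metis Re_divide_of_real d_def minus_complex.simps(1))
    also have "\<dots> \<le> norm (z * (1 - q) / of_real N)" by (rule complex_Re_le_cmod)
    also have "\<dots> = norm z * (norm (1 - q) / N)" using N by (simp add: norm_mult norm_divide)
    also have "\<dots> \<le> norm (p - q) / (m * N) * (norm (1 - q) / N)"
      using nz N by (intro mult_right_mono) auto
    also have "\<dots> = norm (p - q) * norm (1 - q) / m * (1 / N\<^sup>2)"
      by (simp add: power2_eq_square)
    finally have 2: "Re z \<le> d / N + norm (p - q) * norm (1 - q) / m * (1 / N\<^sup>2)" by simp
    have lnN: "ln ((real n + 2) / (real n + 1)) = ln (1 + 1 / N)"
      by (simp add: N_def field_simps)
    have "1 / N - (1 / N)\<^sup>2 \<le> ln (1 + 1 / N)"
      using N by (intro ln_one_plus_pos_lower_bound) auto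
    moreover have "ln (1 + 1 / N) \<le> 1 / N"
      using N by (intro ln_add_one_self_le_self) auto
    ultimately have "\<bar>1 / N - ln (1 + 1 / N)\<bar> \<le> 1 / N\<^sup>2"
      by (simp add: power_divide)
    then have "\<bar>d\<bar> * \<bar>1 / N - ln (1 + 1 / N)\<bar> \<le> \<bar>d\<bar> * (1 / N\<^sup>2)"
      by (intro mult_left_mono) auto
    moreover have "d * (1 / N - ln (1 + 1 / N)) \<le> \<bar>d\<bar> * \<bar>1 / N - ln (1 + 1 / N)\<bar>"
      by (metis abs_ge_self abs_mult)
    ultimately have 3: "d / N \<le> d * ln (1 + 1 / N) + \<bar>d\<bar> * (1 / N\<^sup>2)"
      by (simp add: algebra_simps)
    have "1 / N\<^sup>2 \<le> 2 * (1 / (real n + 1) - 1 / (real n + 2))"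
      by (simp add: N_def divide_simps power2_eq_square)
    then have 4: "K * (1 / N\<^sup>2) \<le> K * (2 * (1 / (real n + 1) - 1 / (real n + 2)))"
      using K by (intro mult_left_mono)
    have "Re z + (norm z)\<^sup>2 / 2 \<le> d * ln (1 + 1 / N) + K * (1 / N\<^sup>2)"
      using 1 2 3 unfolding K_def by (simp add: algebra_simps)
    also have "\<dots> \<le> d * ln (1 + 1 / N) + K * (2 * (1 / (real n + 1) - 1 / (real n + 2)))"
      using 4 by simp
    finally show ?thesis unfolding lnN by (simp add: mult_ac)
  qed
  finally show "norm ((p + of_nat n) / (q + of_nat n)) \<le>
       ((real n + 2) / (real n + 1)) powr Re (p - q) * exp (2 * K * (1 / (real n + 1) - 1 / (real n + 2)))"
    by (simp add: powr_def exp_add d_def mult_ac)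
qed

text \<open>
  The estimates of the single factors are multiplied. In contrast to a quotient of gamma asymptotics
  this is uniform in \<open>k\<close> also when Pochhammer symbols of \<open>p\<close> vanish.
\<close>

lemma norm_pochhammer_ratio_le:
  fixes p q :: complex
  assumes "Re q > 0"
  obtains C where "C > 0"
    "\<And>k l. norm (pochhammer (p + of_nat k) l / pochhammer (q + of_nat k) l) \<le>
       C * (real (k + l + 1) / real (k + 1)) powr Re (p - q)"
proof -
  obtain M where M: "M \<ge> 0" and step: "\<And>n. norm ((p + of_nat n) / (q + of_nat n)) \<le>
       ((real n + 2) / (real n + 1)) powr Re (p - q) * exp (M * (1 / (real n + 1) - 1 / (real n + 2)))"
    using norm_shifted_ratio_le[OF assms] by blast
  have *: "norm (pochhammer (p + of_nat k) l / pochhammer (q + of_nat k) l) \<le>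
       (real (k + l + 1) / real (k + 1)) powr Re (p - q) * exp (M * (1 / (real k + 1) - 1 / (real (k + l) + 1)))"
    for k l
  proof (induction l)
    case 0
    then show ?case by simp
  next
    case (Suc l)
    have "norm (pochhammer (p + of_nat k) (Suc l) / pochhammer (q + of_nat k) (Suc l)) =
      norm (pochhammer (p + of_nat k) l / pochhammer (q + of_nat k) l) *
      norm ((p + of_nat (k + l)) / (q + of_nat (k + l)))"
      by (simp add: pochhammer_Suc norm_mult norm_divide add_ac)
    also have "\<dots> \<le> ((real (k + l + 1) / real (k + 1)) powr Re (p - q) *
          exp (M * (1 / (real k + 1) - 1 / (real (k + l) + 1)))) *
        (((real (k + l) + 2) / (real (k + l) + 1)) powr Re (p - q) *
          exp (M * (1 / (real (k + l) + 1) - 1 / (real (k + l) + 2))))"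
      by (intro mult_mono Suc.IH step) auto
    also have "\<dots> = ((real (k + l + 1) / real (k + 1)) * ((real (k + l) + 2) / (real (k + l) + 1))) powr Re (p - q) *
       exp (M * (1 / (real k + 1) - 1 / (real (k + l) + 1)) + M * (1 / (real (k + l) + 1) - 1 / (real (k + l) + 2)))"
      by (subst powr_mult) (auto simp: exp_add)
    also have "(real (k + l + 1) / real (k + 1)) * ((real (k + l) + 2) / (real (k + l) + 1)) = real (k + Suc l + 1) / real (k + 1)"
      by (simp add: divide_simps) (simp add: algebra_simps)
    also have "M * (1 / (real k + 1) - 1 / (real (k + l) + 1)) + M * (1 / (real (k + l) + 1) - 1 / (real (k + l) + 2))
       = M * (1 / (real k + 1) - 1 / (real (k + Suc l) + 1))"
      by (simp add: algebra_simps)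
    finally show ?case .
  qed
  show thesis
  proof (rule that)
    fix k l
    have "1 / (real k + 1) - 1 / (real (k + l) + 1) \<le> 1 / (real k + 1)"
      by simp
    also have "\<dots> \<le> 1" by simp
    finally have "M * (1 / (real k + 1) - 1 / (real (k + l) + 1)) \<le> M"
      using M mult_left_mono[of _ 1 M] by simp
    then have "exp (M * (1 / (real k + 1) - 1 / (real (k + l) + 1))) \<le> exp M" by simp
    then show "norm (pochhammer (p + of_nat k) l / pochhammer (q + of_nat k) l) \<le>
       exp M * (real (k + l + 1) / real (k + 1)) powr Re (p - q)"
      using *[of k l] mult_right_mono[of _ "exp M" "(real (k + l + 1) / real (k + 1)) powr Re (p - q)"]
      by (smt (verit) mult.commute powr_ge_zero)
  qed simp
qed

text \<open>
  The terms beyond the first are bounded by differences of consecutive values of \<open>m^(-d) / d\<close>.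
\<close>

lemma powr_tail_sum_le:
  fixes d :: real
  assumes "d > 0"
  shows "summable (\<lambda>l. real (k + l + 1) powr (- 1 - d))"
    and "(\<Sum>l. real (k + l + 1) powr (- 1 - d)) \<le> (1 + 1 / d) * real (k + 1) powr (- d)"
proof -
  have step: "(m + 1) powr (- 1 - d) \<le> 1 / d * (m powr (- d) - (m + 1) powr (- d))" if "m > 0" for m :: real
  proof -
    have "ln (m / (m + 1)) \<le> m / (m + 1) - 1" using that by (intro ln_le_minus_one) auto
    also have "\<dots> = - (1 / (m + 1))" using that by (simp add: field_simps)
    finally have l: "ln (m + 1) - ln m \<ge> 1 / (m + 1)" using that by (simp add: ln_div)
    have "1 + d * (1 / (m + 1)) \<le> 1 + d * (ln (m + 1) - ln m)"
      using l assms by (intro add_left_mono mult_left_mono) auto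
    also have "\<dots> \<le> exp (d * (ln (m + 1) - ln m))" by (rule exp_ge_add_one_self)
    finally have "(m + 1) powr (- d) * (1 + d * (1 / (m + 1))) \<le> (m + 1) powr (- d) * exp (d * (ln (m + 1) - ln m))"
      by (intro mult_left_mono) auto
    also have "\<dots> = m powr (- d)"
      using that by (simp add: powr_def exp_add [symmetric] algebra_simps)
    also have "(m + 1) powr (- d) * (1 + d * (1 / (m + 1))) = (m + 1) powr (- d) + d * (m + 1) powr (- 1 - d)"
    proof -
      have "(m + 1) powr (- d) = (m + 1) * (m + 1) powr (- 1 - d)"
        using that powr_add[of "m + 1" 1 "- 1 - d"] by simp
      then show ?thesis using that by (simp add: field_simps)
    qed
    finally show ?thesis using assms by (simp add: field_simps)
  qed
  have fin: "(\<Sum>l<n. real (k + l + 1) powr (- 1 - d)) \<le> (1 + 1 / d) * real (k + 1) powr (- d)" for n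
  proof -
    have "(\<Sum>l<n. real (k + l + 2) powr (- 1 - d)) \<le> 1 / d * (real (k + 1) powr (- d) - real (k + n + 1) powr (- d))"
    proof (induction n)
      case (Suc n)
      have "(\<Sum>l<Suc n. real (k + l + 2) powr (- 1 - d)) \<le>
         1 / d * (real (k + 1) powr (- d) - real (k + n + 1) powr (- d)) +
         1 / d * (real (k + n + 1) powr (- d) - (real (k + n + 1) + 1) powr (- d))"
        using Suc.IH step[of "real (k + n + 1)"] by (simp add: add_ac)
      also have "\<dots> = 1 / d * (real (k + 1) powr (- d) - real (k + Suc n + 1) powr (- d))"
        by (simp add: algebra_simps)
      finally show ?case .
    qed simp
    also have "\<dots> \<le> 1 / d * real (k + 1) powr (- d)" using assms by (intro mult_left_mono) auto
    finally have A: "(\<Sum>l<n. real (k + l + 2) powr (- 1 - d)) \<le> 1 / d * real (k + 1) powr (- d)" .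
    have "(\<Sum>l<n. real (k + l + 1) powr (- 1 - d)) \<le> (\<Sum>l<Suc n. real (k + l + 1) powr (- 1 - d))" by simp
    also have "\<dots> = real (k + 1) powr (- 1 - d) + (\<Sum>l<n. real (k + l + 2) powr (- 1 - d))"
      by (subst sum.lessThan_Suc_shift) (simp add: add_ac)
    also have "real (k + 1) powr (- 1 - d) \<le> real (k + 1) powr (- d)" by (intro powr_mono) auto
    finally show ?thesis using A by (simp add: algebra_simps)
  qed
  show s: "summable (\<lambda>l. real (k + l + 1) powr (- 1 - d))"
    by (rule summableI_nonneg_bounded[OF _ fin]) simp
  show "(\<Sum>l. real (k + l + 1) powr (- 1 - d)) \<le> (1 + 1 / d) * real (k + 1) powr (- d)"
    by (rule suminf_le_const[OF s fin])
qed

section \<open>Gauss's summation theorem\<close>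

abbreviation Gauss_term :: "complex \<Rightarrow> complex \<Rightarrow> complex \<Rightarrow> nat \<Rightarrow> complex" where
  "Gauss_term a b c n \<equiv> pochhammer a n * pochhammer b n / fact n * rGamma (c + of_nat n)"

lemma norm_pochhammer_fact_le:
  fixes a :: complex
  obtains C where "C > 0" "\<And>n. norm (pochhammer a n / fact n) \<le> C * real (n + 1) powr (Re a - 1)"
proof -
  obtain C where C: "C > 0" "\<And>k l. norm (pochhammer (a + of_nat k) l / pochhammer (1 + of_nat k) l) \<le>
       C * (real (k + l + 1) / real (k + 1)) powr Re (a - 1)"
    using norm_pochhammer_ratio_le[of 1 a] by auto
  show thesis
  proof (rule that)
    show "norm (pochhammer a n / fact n) \<le> C * real (n + 1) powr (Re a - 1)" for n
      using C(2)[of 0 n] by (simp add: pochhammer_fact)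
  qed fact
qed

text \<open>
  For \<open>Re c > 0\<close> the left-hand side is a quotient of Pochhammer symbols; the functional equation of
  the reciprocal gamma function then moves \<open>c\<close> to the left, one unit at a time.
\<close>

lemma norm_fact_rGamma_le:
  fixes c :: complex
  shows "\<exists>C>0. \<forall>n. norm (fact n * rGamma (c + of_nat n)) \<le> C * real (n + 1) powr (1 - Re c)"
proof -
  define Q where "Q = (\<lambda>c. \<exists>C>0. \<forall>n. norm (fact n * rGamma (c + of_nat n)) \<le> C * real (n + 1) powr (1 - Re c))"
  have base: "Q c" if "Re c > 0" for c :: complex
  proof -
    obtain C where C: "C > 0" "\<And>k l. norm (pochhammer (1 + of_nat k) l / pochhammer (c + of_nat k) l) \<le>
         C * (real (k + l + 1) / real (k + 1)) powr Re (1 - c)"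
      using norm_pochhammer_ratio_le[of c 1] \<open>Re c > 0\<close> by auto
    show ?thesis unfolding Q_def
    proof (intro exI[of _ "C * (norm (rGamma c) + 1)"] conjI allI)
      show "C * (norm (rGamma c) + 1) > 0" using C(1) by (simp add: add_nonneg_pos)
      fix n
      have "pochhammer c n \<noteq> 0" using that by (auto simp: pochhammer_eq_0_iff)
      then have "fact n * rGamma (c + of_nat n) = (pochhammer 1 n / pochhammer c n) * rGamma c"
        by (simp add: pochhammer_rGamma[of c n] pochhammer_fact)
      then have "norm (fact n * rGamma (c + of_nat n)) = norm (pochhammer 1 n / pochhammer c n) * norm (rGamma c)"
        by (simp add: norm_mult norm_divide)
      also have "\<dots> \<le> (C * real (n + 1) powr (1 - Re c)) * (norm (rGamma c) + 1)"
        using C(2)[of 0 n] C(1) by (intro mult_mono) auto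
      finally show "norm (fact n * rGamma (c + of_nat n)) \<le> C * (norm (rGamma c) + 1) * real (n + 1) powr (1 - Re c)"
        by (simp add: mult_ac)
    qed
  qed
  have step: "Q c" if "Q (c + 1)" for c
  proof -
    obtain C where C: "C > 0" "\<forall>n. norm (fact n * rGamma (c + 1 + of_nat n)) \<le> C * real (n + 1) powr (1 - Re (c + 1))"
      using \<open>Q (c + 1)\<close> unfolding Q_def by auto
    show ?thesis unfolding Q_def
    proof (intro exI[of _ "(norm c + 1) * C"] conjI allI)
      show "(norm c + 1) * C > 0" using C(1) by (simp add: add_nonneg_pos)
      fix n
      have "rGamma (c + of_nat n) = (c + of_nat n) * rGamma (c + 1 + of_nat n)"
        using rGamma_plus1[of "c + of_nat n"] by (simp add: add_ac)
      then have "norm (fact n * rGamma (c + of_nat n)) =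
          norm (c + of_nat n) * norm (fact n * rGamma (c + 1 + of_nat n))"
        by (simp add: norm_mult)
      also have "\<dots> \<le> ((norm c + 1) * real (n + 1)) * (C * real (n + 1) powr (1 - Re (c + 1)))"
      proof (intro mult_mono)
        have "norm (c + of_nat n) \<le> norm c + real n" by (metis norm_of_nat norm_triangle_ineq)
        also have "\<dots> \<le> (norm c + 1) * real (n + 1)" by (simp add: algebra_simps)
        finally show "norm (c + of_nat n) \<le> (norm c + 1) * real (n + 1)" .
      qed (use C in auto)
      also have "\<dots> = (norm c + 1) * C * (real (n + 1) powr 1 * real (n + 1) powr (- Re c))"
        by simp
      also have "real (n + 1) powr 1 * real (n + 1) powr (- Re c) = real (n + 1) powr (1 - Re c)"
        by (simp only: powr_add [symmetric]) simp
      finally show "norm (fact n * rGamma (c + of_nat n)) \<le> (norm c + 1) * C * real (n + 1) powr (1 - Re c)" .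
    qed
  qed
  have ind: "Re c + real M > 0 \<Longrightarrow> Q c" for M c
  proof (induction M arbitrary: c)
    case 0
    then show ?case using base by simp
  next
    case (Suc M)
    then have "Q (c + 1)" by (intro Suc.IH) simp
    then show ?case by (rule step)
  qed
  obtain M where "real M > - Re c" using reals_Archimedean2 by blast
  then have "Q c" by (intro ind[of c M]) simp
  then show ?thesis unfolding Q_def .
qed

lemma norm_Gauss_term_le:
  fixes a b c :: complex
  obtains C where "C > 0" "\<And>n. norm (Gauss_term a b c n) \<le>
    C * real (n + 1) powr (- 1 - Re (c - a - b))"
proof -
  obtain A where A: "A > 0" "\<And>n. norm (pochhammer a n / fact n) \<le> A * real (n + 1) powr (Re a - 1)"
    using norm_pochhammer_fact_le by blast
  obtain B where B: "B > 0" "\<And>n. norm (pochhammer b n / fact n) \<le> B * real (n + 1) powr (Re b - 1)"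
    using norm_pochhammer_fact_le by blast
  obtain C where C: "C > 0" "\<forall>n. norm (fact n * rGamma (c + of_nat n)) \<le> C * real (n + 1) powr (1 - Re c)"
    using norm_fact_rGamma_le[of c] by blast
  show thesis
  proof (rule that)
    show "A * B * C > 0" using A B C by simp
    fix n
    have "norm (Gauss_term a b c n) =
       norm (pochhammer a n / fact n) * norm (pochhammer b n / fact n) * norm (fact n * rGamma (c + of_nat n))"
      by (simp add: norm_mult norm_divide)
    also have "\<dots> \<le> (A * real (n + 1) powr (Re a - 1)) * (B * real (n + 1) powr (Re b - 1)) * (C * real (n + 1) powr (1 - Re c))"
      by (intro mult_mono A(2) B(2) C(2)[rule_format] mult_nonneg_nonneg) (use A B C in auto)
    also have "\<dots> = A * B * C * (real (n + 1) powr (Re a - 1) * real (n + 1) powr (Re b - 1) * real (n + 1) powr (1 - Re c))"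
      by simp
    also have "real (n + 1) powr (Re a - 1) * real (n + 1) powr (Re b - 1) * real (n + 1) powr (1 - Re c) =
       real (n + 1) powr (- 1 - Re (c - a - b))"
      by (simp only: powr_add [symmetric]) (simp add: algebra_simps)
    finally show "norm (Gauss_term a b c n) \<le>
      A * B * C * real (n + 1) powr (- 1 - Re (c - a - b))" .
  qed
qed

lemma summable_Gauss_term:
  fixes a b c :: complex
  assumes "Re (c - a - b) > 0"
  shows "summable (\<lambda>n. norm (Gauss_term a b c n))"
proof -
  obtain C where C: "C > 0" "\<And>n. norm (Gauss_term a b c n) \<le>
    C * real (n + 1) powr (- 1 - Re (c - a - b))"
    using norm_Gauss_term_le by blast
  have "summable (\<lambda>n. C * real (n + 1) powr (- 1 - Re (c - a - b)))"
    using powr_tail_sum_le(1)[OF assms, of 0] by (intro summable_mult) simp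
  then show ?thesis
    by (rule summable_comparison_test') (use C in auto)
qed

text \<open>
  The right-hand side minus the left-hand side telescopes: with \<open>t(n)\<close> the terms of the series on the
  left, its \<open>n\<close>-th term is \<open>(n + 1) t(n + 1) - n t(n)\<close>, and \<open>n t(n)\<close> tends to 0.
\<close>

lemma Gauss_sum_contiguous:
  fixes a b c :: complex
  assumes z: "Re (c - a - b) > 0"
  shows "(c - a - b) * (\<Sum>n. Gauss_term a b c n) =
    (c - a) * (c - b) * (\<Sum>n. Gauss_term a b (c + 1) n)"
proof -
  define t where "t = (\<lambda>c n. Gauss_term a b c n)"
  have s: "summable (t c)" "summable (t (c + 1))"
    using summable_Gauss_term[of c a b] summable_Gauss_term[of "c + 1" a b] z
    by (auto simp: t_def intro: summable_norm_cancel)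
  define D where "D = (\<lambda>n. of_nat n * t c n)"
  have D: "(c - a) * (c - b) * t (c + 1) n - (c - a - b) * t c n = D (Suc n) - D n" for n
  proof -
    define u where "u = pochhammer a n * pochhammer b n / fact n * rGamma (c + of_nat n + 1)"
    have r: "rGamma (c + of_nat n) = (c + of_nat n) * rGamma (c + of_nat n + 1)"
      by (simp add: rGamma_plus1)
    have "t (c + 1) n = u" by (simp add: t_def u_def add_ac)
    moreover have "t c n = (c + of_nat n) * u" unfolding t_def u_def r by simp
    moreover have "D (Suc n) = (a + of_nat n) * (b + of_nat n) * u"
    proof -
      have "D (Suc n) = of_nat (Suc n) / fact (Suc n) * (pochhammer a (Suc n) * pochhammer b (Suc n)) * rGamma (c + of_nat (Suc n))"
        by (simp add: D_def t_def)
      also have "of_nat (Suc n) / fact (Suc n) = (1 / fact n :: complex)"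
        using of_nat_neq_0[of n, where 'a = complex] by (simp add: field_simps del: of_nat_Suc)
      also have "1 / fact n * (pochhammer a (Suc n) * pochhammer b (Suc n)) * rGamma (c + of_nat (Suc n)) =
        (a + of_nat n) * (b + of_nat n) * u"
        by (simp add: u_def pochhammer_Suc add_ac mult_ac)
      finally show ?thesis .
    qed
    moreover have "D n = of_nat n * t c n" by (simp add: D_def)
    ultimately show ?thesis by (simp add: algebra_simps)
  qed
  have 1: "(\<lambda>n. (c - a) * (c - b) * t (c + 1) n - (c - a - b) * t c n) sums
     ((c - a) * (c - b) * suminf (t (c + 1)) - (c - a - b) * suminf (t c))"
    by (intro sums_diff sums_mult summable_sums s)
  have 2: "(\<lambda>n. D (Suc n) - D n) sums (0 - D 0)"
  proof (rule telescope_sums)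
    obtain C where C: "C > 0" "\<And>n. norm (t c n) \<le> C * real (n + 1) powr (- 1 - Re (c - a - b))"
      unfolding t_def using norm_Gauss_term_le[of a b c] by blast
    show "D \<longlonglongrightarrow> 0"
    proof (rule Lim_null_comparison)
      show "\<forall>\<^sub>F n in sequentially. norm (D n) \<le> C * real (n + 1) powr (- Re (c - a - b))"
      proof (intro always_eventually allI)
        fix n
        have "norm (D n) \<le> real (n + 1) * (C * real (n + 1) powr (- 1 - Re (c - a - b)))"
          unfolding D_def norm_mult by (intro mult_mono C(2)) auto
        also have "\<dots> = C * (real (n + 1) powr 1 * real (n + 1) powr (- 1 - Re (c - a - b)))"
          by simp
        also have "real (n + 1) powr 1 * real (n + 1) powr (- 1 - Re (c - a - b)) = real (n + 1) powr (- Re (c - a - b))"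
          by (simp only: powr_add [symmetric]) (simp add: algebra_simps)
        finally show "norm (D n) \<le> C * real (n + 1) powr (- Re (c - a - b))" .
      qed
      have "(\<lambda>n. real (n + 1) powr (- Re (c - a - b))) \<longlonglongrightarrow> 0"
      proof (rule tendsto_neg_powr)
        show "filterlim (\<lambda>n. real (n + 1)) at_top sequentially"
          by (rule filterlim_compose[OF filterlim_real_sequentially filterlim_add_const_nat_at_top])
      qed (use z in simp)
      then show "(\<lambda>n. C * real (n + 1) powr (- Re (c - a - b))) \<longlonglongrightarrow> 0"
        by (rule tendsto_mult_right_zero)
    qed
  qed
  have "(c - a) * (c - b) * suminf (t (c + 1)) - (c - a - b) * suminf (t c) = 0"
    using sums_unique2[OF 1[unfolded D] 2] by (simp add: D_def)
  then show ?thesis unfolding t_def by simp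
qed

lemma norm_pochhammer_shift_ge:
  fixes c :: complex
  assumes "Re c > 0"
  shows "pochhammer (Re c) k \<le> norm (pochhammer (c + of_nat N) k)"
proof (induction k)
  case (Suc k)
  have "Re c + real k \<le> Re (c + of_nat N + of_nat k)" by simp
  also have "\<dots> \<le> norm (c + of_nat N + of_nat k)" by (rule complex_Re_le_cmod)
  finally show ?case
    using Suc assms unfolding pochhammer_Suc norm_mult
    by (intro mult_mono) (auto intro: less_imp_le[OF pochhammer_pos])
qed simp

abbreviation hypergeo_term :: "complex \<Rightarrow> complex \<Rightarrow> complex \<Rightarrow> nat \<Rightarrow> complex" where
  "hypergeo_term a b c k \<equiv> pochhammer a k * pochhammer b k / (fact k * pochhammer c k)"

text \<open>
  Every term but the first carries a factor \<open>1 / (c + N)\<close>, and what remains is dominated by a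
  multiple of the series with denominator parameter \<open>Re c\<close>.
\<close>

lemma hypergeo_unit_argument_tendsto_1:
  fixes a b c :: complex
  assumes c: "Re c > 0" and z: "Re (c - a - b) > 0"
  shows "(\<lambda>N. \<Sum>k. hypergeo_term a b (c + of_nat N) k) \<longlonglongrightarrow> 1"
proof -
  define M where "M = (\<lambda>k. norm (pochhammer a k * pochhammer b k) / (fact k * pochhammer (Re c) k))"
  have pos: "pochhammer (Re c) k > 0" for k using c by (rule pochhammer_pos)
  have sM: "summable M"
  proof -
    have "summable (\<lambda>n. norm (Gauss_term a b (of_real (Re c)) n))"
      using z by (intro summable_Gauss_term) auto
    then have "summable (\<lambda>n. norm (Gauss_term a b (of_real (Re c)) n) * Gamma (Re c))"
      by (rule summable_mult2)
    also have "(\<lambda>n. norm (Gauss_term a b (of_real (Re c)) n) * Gamma (Re c)) = M"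
    proof
      fix n
      have "rGamma (Re c + real n) = rGamma (Re c) / pochhammer (Re c) n"
        using pochhammer_rGamma[of "Re c" n] pos[of n] by simp
      then have "rGamma (of_real (Re c) + of_nat n :: complex) = of_real (rGamma (Re c) / pochhammer (Re c) n)"
        by (metis of_real_add of_real_of_nat_eq rGamma_complex_of_real)
      moreover have "rGamma (Re c) > 0" using c by (simp add: rGamma_inverse_Gamma)
      ultimately show "norm (Gauss_term a b (of_real (Re c)) n) * Gamma (Re c) = M n"
        using pos[of n] Gamma_real_pos[OF c]
        by (simp add: M_def norm_mult norm_divide rGamma_inverse_Gamma field_simps)
    qed
    finally show ?thesis .
  qed
  have M0: "M k \<ge> 0" for k using pos[of k] by (simp add: M_def)
  have bd: "norm (hypergeo_term a b (c + of_nat N) k) \<le> (if k = 0 then 1 else Re c / (Re c + real N) * M k)" for k N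
  proof (cases k)
    case (Suc j)
    have "Re c + real N = Re (c + of_nat N)" by simp
    also have "\<dots> \<le> norm (c + of_nat N)" by (rule complex_Re_le_cmod)
    finally have 1: "Re c + real N \<le> norm (c + of_nat N)" .
    have "(Re c + real N) / Re c * pochhammer (Re c) k = (Re c + real N) * pochhammer (Re c + 1) j"
      using c by (simp add: Suc pochhammer_rec)
    also have "\<dots> \<le> norm (c + of_nat N) * norm (pochhammer (c + 1 + of_nat N) j)"
      using norm_pochhammer_shift_ge[of "c + 1" j N] c 1
      by (intro mult_mono) (auto intro: less_imp_le[OF pochhammer_pos])
    also have "\<dots> = norm (pochhammer (c + of_nat N) k)"
      by (simp add: Suc pochhammer_rec norm_mult add_ac)
    finally have 2: "(Re c + real N) / Re c * pochhammer (Re c) k \<le> norm (pochhammer (c + of_nat N) k)" .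
    have 3: "(Re c + real N) / Re c * pochhammer (Re c) k > 0" using c pos[of k] by simp
    have "norm (hypergeo_term a b (c + of_nat N) k) =
       norm (pochhammer a k * pochhammer b k) / fact k / norm (pochhammer (c + of_nat N) k)"
      by (simp add: norm_mult norm_divide)
    also have "\<dots> \<le> norm (pochhammer a k * pochhammer b k) / fact k / ((Re c + real N) / Re c * pochhammer (Re c) k)"
      using less_le_trans[OF 3 2] by (intro divide_left_mono mult_pos_pos 2 3) auto
    also have "\<dots> = Re c / (Re c + real N) * M k"
      using c by (simp add: M_def field_simps)
    finally show ?thesis by (simp add: Suc)
  qed simp
  define F where "F = (\<lambda>N k. hypergeo_term a b (c + of_nat N) k)"
  have 1: "norm (suminf (F N) - 1) \<le> Re c / (Re c + real N) * suminf M" for N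
  proof -
    have sF: "summable (\<lambda>k. norm (F N (Suc k)))"
    proof (rule summable_comparison_test')
      show "summable (\<lambda>k. Re c / (Re c + real N) * M (Suc k))"
        using sM by (intro summable_mult) (simp add: summable_Suc_iff)
      show "norm (norm (F N (Suc k))) \<le> Re c / (Re c + real N) * M (Suc k)" for k
        using bd[of "Suc k" N] by (simp add: F_def)
    qed
    then have "summable (F N)" by (subst summable_Suc_iff [symmetric]) (rule summable_norm_cancel)
    then have "suminf (F N) - 1 = (\<Sum>k. F N (Suc k))"
      by (subst suminf_split_head) (simp_all add: F_def)
    also have "norm \<dots> \<le> (\<Sum>k. norm (F N (Suc k)))" by (rule summable_norm[OF sF])
    also have "\<dots> \<le> (\<Sum>k. Re c / (Re c + real N) * M (Suc k))"
    proof (rule suminf_le[OF _ sF])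
      show "summable (\<lambda>k. Re c / (Re c + real N) * M (Suc k))"
        using sM by (intro summable_mult) (simp add: summable_Suc_iff)
      show "norm (F N (Suc k)) \<le> Re c / (Re c + real N) * M (Suc k)" for k
        using bd[of "Suc k" N] by (simp add: F_def)
    qed
    also have "\<dots> = Re c / (Re c + real N) * (\<Sum>k. M (Suc k))"
      using sM by (intro suminf_mult) (simp add: summable_Suc_iff)
    also have "(\<Sum>k. M (Suc k)) = suminf M - M 0" using sM by (rule suminf_split_head)
    also have "\<dots> \<le> suminf M" using M0[of 0] by simp
    finally show ?thesis using c by (simp add: mult_left_mono divide_right_mono)
  qed
  have 2: "(\<lambda>N. Re c / (Re c + real N) * suminf M) \<longlonglongrightarrow> 0"
    by (intro tendsto_mult_left_zero tendsto_divide_0[OF tendsto_const] filterlim_at_top_imp_at_infinity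
          filterlim_tendsto_add_at_top[OF tendsto_const filterlim_real_sequentially])
  have "(\<lambda>N. suminf (F N) - 1) \<longlonglongrightarrow> 0"
    by (rule Lim_null_comparison[OF _ 2]) (rule always_eventually, rule allI, rule 1)
  then show ?thesis unfolding F_def by (rule LIM_zero_cancel)
qed

text \<open>
  Gauss's theorem, divided by \<open>\<Gamma>(c)\<close>: in this form it holds for all \<open>c\<close>, also at the poles of \<open>\<Gamma>\<close>.
  Both sides satisfy the same relation between \<open>c\<close> and \<open>c + 1\<close>. For \<open>Re c > 0\<close> it is iterated to
  infinity, where the series tends to 1 and the Pochhammer quotients to gamma functions; the
  remaining \<open>c\<close> are reached by descending from the right half-plane.
\<close>

theorem Gauss_sum_regularised:
  fixes a b c :: complex
  assumes z: "Re (c - a - b) > 0"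
  shows "(\<Sum>n. Gauss_term a b c n) =
    Gamma (c - a - b) * rGamma (c - a) * rGamma (c - b)"
proof -
  define S where "S = (\<lambda>c. \<Sum>n. Gauss_term a b c n)"
  define R where "R = (\<lambda>c. Gamma (c - a - b) * rGamma (c - a) * rGamma (c - b))"
  have S_step: "(c - a - b) * S c = (c - a) * (c - b) * S (c + 1)" if "Re (c - a - b) > 0" for c
    using Gauss_sum_contiguous[OF that] by (simp add: S_def)
  \<comment> \<open>Iterating the relation N times leaves the Pochhammer quotients and the series at c + N.\<close>
  have right_half: "S c = R c" if c: "Re c > 0" and z: "Re (c - a - b) > 0" for c
  proof -
    have iter: "pochhammer (c - a - b) N * S c = pochhammer (c - a) N * pochhammer (c - b) N * S (c + of_nat N)" for N
    proof (induction N)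
      case (Suc N)
      have "pochhammer (c - a - b) (Suc N) * S c = (c - a - b + of_nat N) * (pochhammer (c - a) N * pochhammer (c - b) N * S (c + of_nat N))"
        by (simp add: pochhammer_Suc Suc [symmetric])
      also have "\<dots> = pochhammer (c - a) N * pochhammer (c - b) N * ((c + of_nat N - a - b) * S (c + of_nat N))"
        by (simp add: algebra_simps)
      also have "(c + of_nat N - a - b) * S (c + of_nat N) = (c + of_nat N - a) * (c + of_nat N - b) * S (c + of_nat N + 1)"
        using z by (intro S_step) simp
      finally show ?case by (simp add: pochhammer_Suc algebra_simps)
    qed simp
    define F where "F = (\<lambda>N. \<Sum>k. hypergeo_term a b (c + of_nat N) k)"
    have pn: "pochhammer c N \<noteq> 0" "pochhammer (c - a - b) N \<noteq> 0" for N
      using c z by (auto simp: pochhammer_eq_0_iff simp del: minus_complex.simps dest!: arg_cong[of _ _ Re])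
    have SF: "S (c + of_nat N) = rGamma (c + of_nat N) * F N" for N
    proof -
      have tm: "Gauss_term a b (c + of_nat N) k =
         rGamma (c + of_nat N) * (hypergeo_term a b (c + of_nat N) k)" for k
      proof -
        have "pochhammer (c + of_nat N) k \<noteq> 0"
          using c by (auto simp: pochhammer_eq_0_iff dest!: arg_cong[of _ _ Re])
        then show ?thesis by (simp add: pochhammer_rGamma[of "c + of_nat N" k])
      qed
      then have "S (c + of_nat N) = (\<Sum>k. rGamma (c + of_nat N) * (hypergeo_term a b (c + of_nat N) k))"
        by (simp only: S_def tm)
      also have "\<dots> = rGamma (c + of_nat N) * F N"
      proof (cases "rGamma (c + of_nat N) = 0")
        case False
        have "summable (\<lambda>k. rGamma (c + of_nat N) * (hypergeo_term a b (c + of_nat N) k))"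
          using summable_norm_cancel[OF summable_Gauss_term[of "c + of_nat N" a b]] z
          unfolding tm by simp
        with False show ?thesis unfolding F_def by (intro suminf_mult) (simp only: summable_cmult_iff simp_thms)
      qed simp
      finally show ?thesis .
    qed
    let ?q = "\<lambda>N. rGamma_series (c - a) N * rGamma_series (c - b) N / (rGamma_series (c - a - b) N * rGamma_series c N)"
    let ?r = "\<lambda>N. pochhammer (c - a) (N + 1) * pochhammer (c - b) (N + 1) / (pochhammer (c - a - b) (N + 1) * pochhammer c (N + 1))"
    have "S c = ?q N * rGamma c * F (N + 1)" for N
    proof -
      define e where "e = (\<lambda>w :: complex. exp (w * of_real (ln (of_nat N))))"
      have e0: "e w \<noteq> 0" for w by (simp add: e_def)
      have ee: "e (c - a) * e (c - b) = e (c - a - b) * e c"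
        by (simp add: e_def exp_add [symmetric] algebra_simps)
      have "S c = pochhammer (c - a) (N + 1) * pochhammer (c - b) (N + 1) * S (c + of_nat (N + 1)) / pochhammer (c - a - b) (N + 1)"
        unfolding iter [symmetric] using pn(2)[of "N + 1"] by simp
      also have "S (c + of_nat (N + 1)) = rGamma c / pochhammer c (N + 1) * F (N + 1)"
        unfolding SF using pochhammer_rGamma[of c "N + 1"] pn(1)[of "N + 1"] by simp
      also have "pochhammer (c - a) (N + 1) * pochhammer (c - b) (N + 1) * (rGamma c / pochhammer c (N + 1) * F (N + 1)) / pochhammer (c - a - b) (N + 1)
        = ?r N * rGamma c * F (N + 1)"
        by (simp add: mult_ac)
      also have "?r N =
         ?q N"
      proof -
        have rs: "rGamma_series w N = pochhammer w (N + 1) / (fact N * e w)" for w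
          by (simp add: rGamma_series_def e_def)
        have "?q N =
          ?r N *
          ((e (c - a - b) * e c) / (e (c - a) * e (c - b)))"
          unfolding rs using e0 by (simp add: field_simps)
        then show ?thesis unfolding ee using e0 by simp
      qed
      finally show ?thesis .
    qed
    moreover have "(\<lambda>N. ?q N * rGamma c * F (N + 1)) \<longlonglongrightarrow>
      rGamma (c - a) * rGamma (c - b) / (rGamma (c - a - b) * rGamma c) * rGamma c * 1"
    proof (intro tendsto_intros)
      have "c \<notin> \<int>\<^sub>\<le>\<^sub>0" "c - a - b \<notin> \<int>\<^sub>\<le>\<^sub>0" using c z by (auto elim!: nonpos_Ints_cases simp del: minus_complex.simps)
      then show "rGamma (c - a - b) * rGamma c \<noteq> 0" by (simp add: rGamma_eq_zero_iff)
      show "(\<lambda>N. F (N + 1)) \<longlonglongrightarrow> 1"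
        using hypergeo_unit_argument_tendsto_1[OF c z] unfolding F_def by (rule LIMSEQ_ignore_initial_segment)
    qed
    ultimately have "(\<lambda>N :: nat. S c) \<longlonglongrightarrow> rGamma (c - a) * rGamma (c - b) / (rGamma (c - a - b) * rGamma c) * rGamma c * 1"
      by simp
    then have "S c = rGamma (c - a) * rGamma (c - b) / (rGamma (c - a - b) * rGamma c) * rGamma c * 1"
      using LIMSEQ_unique tendsto_const by blast
    moreover have "rGamma c \<noteq> 0" using c by (auto simp: rGamma_eq_zero_iff elim!: nonpos_Ints_cases)
    ultimately show ?thesis by (simp add: R_def Gamma_def divide_inverse mult_ac)
  qed
  have descent: "Re c + real M > 0 \<Longrightarrow> Re (c - a - b) > 0 \<Longrightarrow> S c = R c" for M c
  proof (induction M arbitrary: c)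
    case 0
    then show ?case by (intro right_half) auto
  next
    case (Suc M)
    have z0: "c - a - b \<noteq> 0" using Suc.prems by (auto simp del: minus_complex.simps)
    have "c - a - b \<notin> \<int>\<^sub>\<le>\<^sub>0" using Suc.prems by (auto elim!: nonpos_Ints_cases simp del: minus_complex.simps)
    then have "Gamma (c + 1 - a - b) = (c - a - b) * Gamma (c - a - b)"
      using Gamma_plus1[of "c - a - b"] by (simp add: algebra_simps)
    moreover have "rGamma (c - a) = (c - a) * rGamma (c + 1 - a)" "rGamma (c - b) = (c - b) * rGamma (c + 1 - b)"
      using rGamma_plus1[of "c - a"] rGamma_plus1[of "c - b"] by (simp_all add: algebra_simps)
    ultimately have "(c - a - b) * R c = (c - a) * (c - b) * R (c + 1)"
      by (simp add: R_def)
    moreover have "S (c + 1) = R (c + 1)" using Suc.prems by (intro Suc.IH) auto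
    ultimately have "(c - a - b) * S c = (c - a - b) * R c" using S_step Suc.prems by simp
    then show ?case using z0 by simp
  qed
  obtain M where "real M > - Re c" using reals_Archimedean2 by blast
  then have "S c = R c" by (intro descent[of c M] z) simp
  then show ?thesis by (simp add: S_def R_def)
qed

section \<open>The beta integral on a half-line\<close>

lemma norm_of_real_powr: "t > 0 \<Longrightarrow> norm (of_real t powr z :: complex) = t powr Re z"
  by (simp add: norm_powr_real_powr)

text \<open>
  Substitution \<open>s \<mapsto> r s\<close> in Euler's integral.
\<close>

lemma Gamma_integral_scaled:
  fixes z :: complex and r :: real
  assumes z: "Re z > 0" and r: "r > 0"
  shows "set_integrable lborel {0<..} (\<lambda>s. of_real s powr (z - 1) * of_real (exp (- r * s)))" (is ?int)
    and "(LINT s:{0<..}|lborel. of_real s powr (z - 1) * of_real (exp (- r * s))) = Gamma z * of_real r powr (- z)" (is "?J = ?V")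
proof -
  define g where "g = (\<lambda>s. indicat_real {0<..} s *\<^sub>R (of_real s powr (z - 1) * of_real (exp (- s)) :: complex))"
  have g_eq: "g = (\<lambda>s. indicat_real {0<..} s *\<^sub>R (of_real s powr (z - 1) / of_real (exp s)))"
    by (auto simp: g_def exp_minus field_simps)
  have meas: "g \<in> borel_measurable borel"
    unfolding g_def by measurable
  have abs: "(\<lambda>s. of_real s powr (z - 1) / of_real (exp s) :: complex) absolutely_integrable_on {0<..}"
    by (rule absolutely_integrable_Gamma_integral'[OF z])
  then have il: "integrable lebesgue g" unfolding g_eq set_integrable_def .
  then have ib: "integrable lborel g"
    using integrable_completion[of g lborel] meas by simp
  have "(g has_integral integral\<^sup>L lborel g) UNIV"
    by (rule has_integral_integral_lborel[OF ib])
  moreover have "(g has_integral Gamma z) UNIV"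
    using Gamma_integral_complex'[OF z] unfolding g_eq
    by (subst (asm) has_integral_restrict_UNIV [symmetric])
       (auto elim!: has_integral_eq [rotated] simp: indicator_def)
  ultimately have val: "integral\<^sup>L lborel g = Gamma z"
    by (rule has_integral_unique)
  \<comment> \<open>The integrand is a constant multiple of g at r s, in the affine form of the substitution lemma.\<close>
  have scaled: "indicat_real {0<..} s *\<^sub>R (of_real s powr (z - 1) * of_real (exp (- r * s))) =
       of_real r powr (1 - z) * g (0 + r * s)" for s
  proof (cases "s > 0")
    case True
    have "of_real r powr (1 - z) * (of_real (r * s) powr (z - 1)) = (of_real r powr (1 - z) * of_real r powr (z - 1)) * (of_real s powr (z - 1) :: complex)"
      using True r by (simp add: powr_times_real)
    also have "of_real r powr (1 - z) * of_real r powr (z - 1) = (1 :: complex)"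
      using r by (simp add: powr_add [symmetric])
    finally show ?thesis using True r by (simp add: g_def zero_less_mult_iff mult.assoc [symmetric])
  next
    case False
    then show ?thesis using r by (simp add: g_def zero_less_mult_iff)
  qed
  show ?int
    unfolding set_integrable_def scaled
    using r ib by (intro integrable_mult_right lborel_integrable_real_affine) auto
  have "?J =
      of_real r powr (1 - z) * (LINT s|lborel. g (0 + r * s))"
    unfolding set_lebesgue_integral_def scaled by simp
  also have "(LINT s|lborel. g (0 + r * s)) = Gamma z / of_real r"
    using lborel_integral_real_affine[of r g 0] r val by (simp add: scaleR_conv_of_real field_simps)
  also have "of_real r powr (1 - z) * (Gamma z / of_real r) = Gamma z * of_real r powr (- z)"
    using r by (simp add: powr_diff powr_minus field_simps)
  finally show "?J = ?V" .
qed

lemma Gamma_integral_scaled_norm: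
  fixes z :: complex and r :: real
  assumes z: "Re z > 0" and r: "r > 0"
  shows "(LINT s|lborel. norm (indicat_real {0<..} s *\<^sub>R (of_real s powr (z - 1) * of_real (exp (- r * s)) :: complex)))
       = Gamma (Re z) * r powr (- Re z)"
proof -
  define f where "f = (\<lambda>s. norm (indicat_real {0<..} s *\<^sub>R (of_real s powr (z - 1) * of_real (exp (- r * s)) :: complex)))"
  have "of_real (LINT s|lborel. f s) = (LINT s|lborel. (of_real (f s) :: complex))"
    by simp
  also have "\<dots> = (LINT s:{0<..}|lborel. of_real s powr (of_real (Re z) - 1) * of_real (exp (- r * s)))"
    unfolding set_lebesgue_integral_def
  proof (rule Bochner_Integration.integral_cong)
    show "of_real (f s) = indicat_real {0<..} s *\<^sub>R (of_real s powr (of_real (Re z) - 1) * of_real (exp (- r * s)) :: complex)" for s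
    proof (cases "s > 0")
      case True
      have "of_real s powr (of_real (Re z) - 1) = (of_real (s powr (Re z - 1)) :: complex)"
        using True by (simp add: powr_of_real [symmetric])
      then show ?thesis using True by (simp add: f_def norm_mult norm_of_real_powr)
    qed (simp add: f_def)
  qed simp
  also have "\<dots> = Gamma (of_real (Re z)) * of_real r powr (- of_real (Re z))"
    using Gamma_integral_scaled(2)[of "of_real (Re z)" r] assms by simp
  also have "\<dots> = of_real (Gamma (Re z) * r powr (- Re z))"
    using r by (simp add: Gamma_complex_of_real powr_of_real [symmetric])
  finally show ?thesis unfolding f_def of_real_eq_iff .
qed

text \<open>
  The factor \<open>(x + s)^(-P-Q)\<close> is itself a gamma integral over \<open>r\<close> of \<open>r^(P+Q-1) exp (- r (x + s))\<close>.
  In the double integral over \<open>r\<close> and \<open>s\<close>, integrating over \<open>s\<close> first leaves \<open>\<Gamma>(P)\<close> times a gamma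
  integral in \<open>r\<close>.
\<close>

lemma Beta_integral_half_line_aux:
  fixes P Q :: complex and x :: real
  assumes P: "Re P > 0" and Q: "Re Q > 0" and x: "x > 0"
  shows "set_integrable lborel {0<..} (\<lambda>s. of_real s powr (P - 1) * of_real (x + s) powr (- P - Q))" (is ?int)
    and "(LINT s:{0<..}|lborel. of_real s powr (P - 1) * of_real (x + s) powr (- P - Q)) =
           Gamma P * Gamma Q * rGamma (P + Q) * of_real x powr (- Q)" (is "?J = ?V")
proof -
  define A where "A = (\<lambda>r. indicat_real {0<..} r *\<^sub>R (of_real r powr (P + Q - 1) * of_real (exp (- x * r)) :: complex))"
  define B where "B = (\<lambda>r s. indicat_real {0<..} s *\<^sub>R (of_real s powr (P - 1) * of_real (exp (- r * s)) :: complex))"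
  define h where "h = (\<lambda>(r, s). A r * B r s)"
  have Am: "A \<in> borel_measurable lborel" unfolding A_def by measurable
  have Bm: "(\<lambda>(r, s). B r s) \<in> borel_measurable (lborel \<Otimes>\<^sub>M lborel)"
    unfolding B_def by measurable
  have hm [measurable]: "h \<in> borel_measurable (lborel \<Otimes>\<^sub>M lborel)"
    unfolding h_def using Am Bm by measurable
  have Bi: "integrable lborel (B r)" if "r > 0" for r
    using Gamma_integral_scaled(1)[OF P that] unfolding B_def set_integrable_def .
  have Bv: "integral\<^sup>L lborel (B r) = Gamma P * of_real r powr (- P)" if "r > 0" for r
    using Gamma_integral_scaled(2)[OF P that] unfolding B_def set_lebesgue_integral_def .
  have Bn: "(LINT s|lborel. norm (B r s)) = Gamma (Re P) * r powr (- Re P)" if "r > 0" for r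
    using Gamma_integral_scaled_norm[OF P that] unfolding B_def .
  define q where "q = (\<lambda>r. indicat_real {0<..} r *\<^sub>R (of_real r powr (Q - 1) * of_real (exp (- x * r)) :: complex))"
  have qi: "integrable lborel q"
    using Gamma_integral_scaled(1)[OF Q x] unfolding q_def set_integrable_def .
  have int: "integrable (lborel \<Otimes>\<^sub>M lborel) h"
  proof (rule lborel_pair.Fubini_integrable[OF hm])
    have "(LINT s|lborel. norm (h (r, s))) = Gamma (Re P) * norm (q r)" for r
    proof (cases "r > 0")
      case True
      have "(LINT s|lborel. norm (h (r, s))) = norm (A r) * (LINT s|lborel. norm (B r s))"
        by (simp add: h_def norm_mult)
      also have "\<dots> = r powr (Re P + Re Q - 1) * r powr (- Re P) * exp (- x * r) * Gamma (Re P)"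
        using True by (simp add: Bn A_def norm_mult norm_of_real_powr)
      also have "r powr (Re P + Re Q - 1) * r powr (- Re P) = r powr (Re Q - 1)"
        by (simp add: powr_add [symmetric])
      also have "r powr (Re Q - 1) * exp (- x * r) * Gamma (Re P) = Gamma (Re P) * norm (q r)"
        using True by (simp add: q_def norm_mult norm_of_real_powr)
      finally show ?thesis .
    qed (simp add: h_def A_def q_def)
    then show "integrable lborel (\<lambda>r. LINT s|lborel. norm (h (r, s)))"
      using qi by simp
    show "AE r in lborel. integrable lborel (\<lambda>s. h (r, s))"
    proof (rule AE_I2)
      fix r
      show "integrable lborel (\<lambda>s. h (r, s))"
      proof (cases "r > 0")
        case True
        then show ?thesis using Bi by (simp add: h_def)
      qed (simp add: h_def A_def)
    qed
  qed
  have np: "P + Q \<notin> \<int>\<^sub>\<le>\<^sub>0" using P Q by (auto elim!: nonpos_Ints_cases simp: complex_eq_iff)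
  have inner: "(LINT r|lborel. h (r, s)) =
      Gamma (P + Q) * (indicat_real {0<..} s *\<^sub>R (of_real s powr (P - 1) * of_real (x + s) powr (- P - Q)))" for s
  proof (cases "s > 0")
    case True
    have "(LINT r|lborel. h (r, s)) = (LINT r|lborel. of_real s powr (P - 1) *
       (indicat_real {0<..} r *\<^sub>R (of_real r powr (P + Q - 1) * of_real (exp (- (x + s) * r)))))"
    proof (rule Bochner_Integration.integral_cong)
      fix r
      have "exp (- (x + s) * r) = exp (- x * r) * exp (- r * s)"
        by (simp add: exp_add [symmetric] algebra_simps)
      then show "h (r, s) = of_real s powr (P - 1) *
        (indicat_real {0<..} r *\<^sub>R (of_real r powr (P + Q - 1) * of_real (exp (- (x + s) * r))))"
        using True by (simp add: h_def A_def B_def scaleR_conv_of_real mult_ac)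
    qed simp
    also have "\<dots> = of_real s powr (P - 1) * (Gamma (P + Q) * of_real (x + s) powr (- (P + Q)))"
    proof -
      have "(LINT r|lborel. indicat_real {0<..} r *\<^sub>R (of_real r powr (P + Q - 1) * of_real (exp (- (x + s) * r)) :: complex)) =
          Gamma (P + Q) * of_real (x + s) powr (- (P + Q))"
        using Gamma_integral_scaled(2)[of "P + Q" "x + s"] P Q x True
        unfolding set_lebesgue_integral_def by simp
      then show ?thesis by (simp only: integral_mult_right_zero)
    qed
    finally show ?thesis using True by (simp add: mult_ac)
  qed (simp add: h_def B_def)
  have 1: "integrable lborel (\<lambda>s. LINT r|lborel. h (r, s))"
    using lborel_pair.integrable_snd[of "\<lambda>r s. h (r, s)"] int by simp
  have nz: "Gamma (P + Q) \<noteq> 0" using np by (simp add: Gamma_eq_zero_iff)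
  have "integrable lborel (\<lambda>s. indicat_real {0<..} s *\<^sub>R (of_real s powr (P - 1) * of_real (x + s) powr (- P - Q) :: complex))"
    using integrable_mult_right[OF 1[unfolded inner], of "inverse (Gamma (P + Q))"]
    by (simp only: mult.assoc [symmetric] left_inverse[OF nz] mult_1_left)
  then show ?int
    unfolding set_integrable_def .
  have "(LINT s|lborel. LINT r|lborel. h (r, s)) = (LINT r|lborel. LINT s|lborel. h (r, s))"
    using lborel_pair.Fubini_integral[of "\<lambda>r s. h (r, s)"] int by simp
  also have "\<dots> = (LINT r|lborel. Gamma P * q r)"
  proof (rule Bochner_Integration.integral_cong)
    fix r
    show "(LINT s|lborel. h (r, s)) = Gamma P * q r"
    proof (cases "r > 0")
      case True
      have "(LINT s|lborel. h (r, s)) = A r * (Gamma P * of_real r powr (- P))"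
        using True by (simp add: h_def Bv)
      also have "\<dots> = (of_real r powr (P + Q - 1) * of_real r powr (- P)) * of_real (exp (- x * r)) * Gamma P"
        using True by (simp add: A_def mult_ac)
      also have "of_real r powr (P + Q - 1) * of_real r powr (- P) = (of_real r powr (Q - 1) :: complex)"
        by (simp add: powr_add [symmetric])
      finally show ?thesis using True by (simp add: q_def mult_ac)
    qed (simp add: h_def A_def q_def)
  qed simp
  also have "\<dots> = Gamma P * (Gamma Q * of_real x powr (- Q))"
  proof -
    have "integral\<^sup>L lborel q = Gamma Q * of_real x powr (- Q)"
      using Gamma_integral_scaled(2)[OF Q x] unfolding q_def set_lebesgue_integral_def .
    then show ?thesis by (simp only: integral_mult_right_zero)
  qed
  finally have "Gamma (P + Q) * ?J =
     Gamma P * (Gamma Q * of_real x powr (- Q))"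
    unfolding inner set_lebesgue_integral_def by (simp only: integral_mult_right_zero)
  then show "?J = ?V"
    using nz by (simp add: rGamma_inverse_Gamma field_simps)
qed

theorem Beta_integral_half_line:
  fixes P Q :: complex and x :: real
  assumes P: "Re P > 0" and Q: "Re Q > 0" and x: "x > 0"
  shows "set_integrable lborel {x<..} (\<lambda>t. of_real (t - x) powr (P - 1) * of_real t powr (- P - Q))" (is ?int)
    and "(LINT t:{x<..}|lborel. of_real (t - x) powr (P - 1) * of_real t powr (- P - Q)) =
           Gamma P * Gamma Q * rGamma (P + Q) * of_real x powr (- Q)" (is "?J = ?V")
proof -
  define k :: "real \<Rightarrow> complex"
    where "k = (\<lambda>s. indicat_real {0<..} s *\<^sub>R (of_real s powr (P - 1) * of_real (x + s) powr (- P - Q)))"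
  have k: "indicat_real {x<..} t *\<^sub>R (of_real (t - x) powr (P - 1) * of_real t powr (- P - Q)) = k (- x + 1 * t)" for t
    by (simp add: k_def indicator_def)
  show ?int
    using Beta_integral_half_line_aux(1)[OF assms] unfolding set_integrable_def k
    by (intro lborel_integrable_real_affine) (simp_all add: k_def)
  have "?J = integral\<^sup>L lborel k"
    using lborel_integral_real_affine[of 1 k "- x"] unfolding set_lebesgue_integral_def k by simp
  then show "?J = ?V"
    using Beta_integral_half_line_aux(2)[OF assms] by (simp add: k_def set_lebesgue_integral_def)
qed

text \<open>
  The absolute value of the integrand is the integrand with real parameters.
\<close>

lemma Beta_integral_half_line_norm:
  fixes P Q :: complex and x :: real
  assumes P: "Re P > 0" and Q: "Re Q > 0" and x: "x > 0"
  shows "(LINT t|lborel. norm (indicat_real {x<..} t *\<^sub>R (of_real (t - x) powr (P - 1) * of_real t powr (- P - Q) :: complex))) =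
           Beta (Re P) (Re Q) * x powr (- Re Q)"
proof -
  define f where "f = (\<lambda>t. norm (indicat_real {x<..} t *\<^sub>R (of_real (t - x) powr (P - 1) * of_real t powr (- P - Q) :: complex)))"
  have "of_real (LINT t|lborel. f t) = (LINT t|lborel. (of_real (f t) :: complex))" by simp
  also have "\<dots> = (LINT t:{x<..}|lborel. of_real (t - x) powr (of_real (Re P) - 1) * of_real t powr (- of_real (Re P) - of_real (Re Q)))"
    unfolding set_lebesgue_integral_def
  proof (rule Bochner_Integration.integral_cong)
    show "of_real (f t) = indicat_real {x<..} t *\<^sub>R (of_real (t - x) powr (of_real (Re P) - 1) * of_real t powr (- of_real (Re P) - of_real (Re Q)) :: complex)" for t
    proof (cases "t > x")
      case True
      have "of_real (t - x) powr (of_real (Re P) - 1) = (of_real ((t - x) powr (Re P - 1)) :: complex)"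
        using True powr_of_real[of "t - x" "Re P - 1"] by simp
      moreover have "of_real t powr (- of_real (Re P) - of_real (Re Q)) = (of_real (t powr (- Re P - Re Q)) :: complex)"
        using True x powr_of_real[of t "- Re P - Re Q"] by simp
      ultimately show ?thesis using True x norm_of_real_powr[of "t - x" "P - 1"] norm_of_real_powr[of t "- P - Q"]
        by (simp add: f_def norm_mult)
    qed (simp add: f_def)
  qed simp
  also have "\<dots> = Gamma (of_real (Re P)) * Gamma (of_real (Re Q)) * rGamma (of_real (Re P) + of_real (Re Q)) * of_real x powr (- of_real (Re Q))"
    using assms by (intro Beta_integral_half_line) auto
  also have "\<dots> = of_real (Beta (Re P) (Re Q) * x powr (- Re Q))"
    using x powr_of_real[of x "- Re Q"]
    by (simp add: Beta_def Gamma_complex_of_real rGamma_inverse_Gamma divide_inverse flip: of_real_add)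
  finally show ?thesis unfolding f_def of_real_eq_iff .
qed

section \<open>Pfaff's transformation and a contiguous relation\<close>

text \<open>
  Two continuations agree near 0 and hence on the component of 0 in the intersection of their
  domains, which contains the segment.
\<close>

lemma Gauss_2F1_eqI:
  assumes S: "open S" "closed_segment 0 v \<subseteq> S" "f holomorphic_on S"
    and f: "f has_fps_expansion fps_hypergeo [a, b] [c] 1"
  shows "Gauss_2F1 a b c v = f v"
  unfolding Gauss_2F1_def
proof (rule the_equality)
  show "\<exists>S g. open S \<and> closed_segment 0 v \<subseteq> S \<and> g holomorphic_on S \<and>
        g has_fps_expansion fps_hypergeo [a, b] [c] 1 \<and> g v = f v"
    using S f by blast
next
  fix w
  assume "\<exists>S g. open S \<and> closed_segment 0 v \<subseteq> S \<and> g holomorphic_on S \<and>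
        g has_fps_expansion fps_hypergeo [a, b] [c] 1 \<and> g v = w"
  then obtain T g where T: "open T" "closed_segment 0 v \<subseteq> T" "g holomorphic_on T"
    and g: "g has_fps_expansion fps_hypergeo [a, b] [c] 1" and gw: "g v = w" by blast
  define K where "K = connected_component_set (S \<inter> T) 0"
  have K: "open K" "connected K" "K \<subseteq> S" "K \<subseteq> T"
    unfolding K_def using S(1) T(1) connected_component_subset[of "S \<inter> T" 0]
    by (auto intro: open_connected_component)
  have seg: "closed_segment 0 v \<subseteq> K"
    unfolding K_def using S(2) T(2) by (intro connected_component_maximal) auto
  have ev: "eventually (\<lambda>z. f z = g z \<and> z \<in> K) (nhds 0)"
  proof (intro eventually_conj)
    have "eventually (\<lambda>z. eval_fps (fps_hypergeo [a, b] [c] 1) z = f z) (nhds 0)"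
      "eventually (\<lambda>z. eval_fps (fps_hypergeo [a, b] [c] 1) z = g z) (nhds 0)"
      using f g by (auto simp: has_fps_expansion_def)
    then show "eventually (\<lambda>z. f z = g z) (nhds 0)" by eventually_elim simp
    show "eventually (\<lambda>z. z \<in> K) (nhds 0)" using K(1) seg by (intro eventually_nhds_in_open) auto
  qed
  then obtain N where N: "open N" "0 \<in> N" "\<And>z. z \<in> N \<Longrightarrow> f z = g z \<and> z \<in> K"
    by (auto simp: eventually_nhds)
  have "f v = g v"
    by (rule analytic_continuation_open[of N K])
       (use N K seg S(3) T(3) in \<open>auto intro: holomorphic_on_subset\<close>)
  then show "w = f v" using gw by simp
qed

text \<open>
  The ratio test also covers terminating series, where the terms vanish eventually.
\<close>

lemma summable_hypergeo:
  fixes a b c u :: complex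
  assumes u: "norm u < 1" and c: "Re c > 0"
  shows "summable (\<lambda>n. pochhammer a n * pochhammer b n / (pochhammer c n * fact n) * u ^ n)"
proof -
  define t where "t = (\<lambda>n. pochhammer a n * pochhammer b n / (pochhammer c n * fact n) * u ^ n)"
  define r where "r = (\<lambda>n. (a + of_nat n) / (c + of_nat n) * ((b + of_nat n) / (1 + of_nat n)) * u)"
  have lim: "(\<lambda>n. (p + of_nat n) / (q + of_nat n)) \<longlonglongrightarrow> (1 :: complex)" if "Re q > 0" for p q :: complex
  proof -
    have "q + of_nat n \<noteq> 0" for n using that by (auto simp: complex_eq_iff)
    then have "(p + of_nat n) / (q + of_nat n) = 1 + (p - q) / (q + of_nat n)" for n
      by (simp add: field_simps)
    moreover have "(\<lambda>n. 1 + (p - q) / (q + of_nat n)) \<longlonglongrightarrow> 1 + 0"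
      by (intro tendsto_intros tendsto_divide_0[OF tendsto_const]
            tendsto_add_filterlim_at_infinity[OF tendsto_const] tendsto_of_nat)
    ultimately show ?thesis by simp
  qed
  have "(\<lambda>n. norm (r n)) \<longlonglongrightarrow> norm (1 * 1 * u)"
    unfolding r_def using c by (intro tendsto_intros lim) auto
  then have "eventually (\<lambda>n. norm (r n) < (1 + norm u) / 2) sequentially"
    using u by (intro order_tendstoD) auto
  then obtain N where N: "\<And>n. n \<ge> N \<Longrightarrow> norm (r n) < (1 + norm u) / 2"
    by (auto simp: eventually_at_top_linorder)
  have "summable t"
  proof (rule summable_ratio_test)
    show "(1 + norm u) / 2 < 1" using u by simp
    fix n assume "N \<le> n"
    have "t (Suc n) = r n * t n"
      by (simp add: t_def r_def pochhammer_Suc mult_ac)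
    then have "norm (t (Suc n)) = norm (r n) * norm (t n)" by (simp add: norm_mult)
    also have "\<dots> \<le> (1 + norm u) / 2 * norm (t n)"
      using N[OF \<open>N \<le> n\<close>] by (intro mult_right_mono) auto
    finally show "norm (t (Suc n)) \<le> (1 + norm u) / 2 * norm (t n)" .
  qed
  then show ?thesis by (simp add: t_def)
qed

lemma fps_conv_radius_hypergeo_ge:
  fixes a b c :: complex
  assumes c: "Re c > 0"
  shows "fps_conv_radius (fps_hypergeo [a, b] [c] 1) \<ge> 1"
  unfolding fps_conv_radius_def
proof (rule conv_radius_geI_ex)
  fix r :: real assume r: "0 < r" "ereal r < 1"
  show "\<exists>z. norm z = r \<and> summable (\<lambda>n. fps_nth (fps_hypergeo [a, b] [c] 1) n * z ^ n)"
    using summable_hypergeo[of "of_real r" c a b] c r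
    by (intro exI[of _ "of_real r :: complex"]) (simp add: one_ereal_def)
qed

lemma fps_mult_compose_nth:
  fixes G F W :: "'a :: comm_ring_1 fps"
  assumes W: "fps_nth W 0 = 0"
  shows "fps_nth (G * fps_compose F W) n = (\<Sum>i=0..n. fps_nth F i * fps_nth (G * W ^ i) n)"
proof -
  have "fps_nth (G * fps_compose F W) n = (\<Sum>j=0..n. fps_nth G j * (\<Sum>i=0..n-j. fps_nth F i * fps_nth (W ^ i) (n - j)))"
    by (simp add: fps_mult_nth fps_compose_nth)
  also have "\<dots> = (\<Sum>j=0..n. \<Sum>i=0..n. fps_nth G j * (fps_nth F i * fps_nth (W ^ i) (n - j)))"
  proof (intro sum.cong refl)
    fix j
    have "(\<Sum>i=0..n-j. fps_nth F i * fps_nth (W ^ i) (n - j)) = (\<Sum>i=0..n. fps_nth F i * fps_nth (W ^ i) (n - j))"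
      using W by (intro sum.mono_neutral_left) (auto simp: startsby_zero_power_prefix)
    then show "fps_nth G j * (\<Sum>i=0..n-j. fps_nth F i * fps_nth (W ^ i) (n - j)) =
       (\<Sum>i=0..n. fps_nth G j * (fps_nth F i * fps_nth (W ^ i) (n - j)))"
      by (simp add: sum_distrib_left)
  qed
  also have "\<dots> = (\<Sum>i=0..n. \<Sum>j=0..n. fps_nth F i * (fps_nth G j * fps_nth (W ^ i) (n - j)))"
    by (subst sum.swap) (simp add: mult_ac)
  also have "\<dots> = (\<Sum>i=0..n. fps_nth F i * fps_nth (G * W ^ i) n)"
    by (simp add: fps_mult_nth sum_distrib_left)
  finally show ?thesis .
qed

definition fps_one_minus_X_powr :: "complex \<Rightarrow> complex fps" where
  "fps_one_minus_X_powr a = fps_compose (fps_binomial a) (- fps_X)"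

lemma fps_one_minus_X_powr_nth:
  "fps_nth (fps_one_minus_X_powr (- a)) n = pochhammer a n / fact n"
proof -
  have "fps_one_minus_X_powr (- a) = fps_compose (fps_binomial (- a)) (fps_const (- 1) * fps_X)"
    by (simp add: fps_one_minus_X_powr_def flip: fps_const_neg)
  also have "fps_nth \<dots> n = (- 1) ^ n * ((- a) gchoose n)"
    by (subst fps_compose_linear) simp
  also have "\<dots> = ((- 1) ^ n * (- 1) ^ n) * (pochhammer a n / fact n)"
    by (simp add: gbinomial_pochhammer)
  also have "(- 1) ^ n * (- 1) ^ n = (1 :: complex)"
    by (simp flip: power_mult_distrib)
  finally show ?thesis by simp
qed

lemma fps_one_minus_X_powr_add:
  "fps_one_minus_X_powr (a + b) = fps_one_minus_X_powr a * fps_one_minus_X_powr b"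
  by (simp add: fps_one_minus_X_powr_def fps_binomial_add_mult fps_compose_mult_distrib)

lemma inverse_one_minus_X: "inverse (1 - fps_X) = fps_one_minus_X_powr (- 1)"
  by (rule fps_ext) (simp add: fps_inverse_one_minus_fps_X fps_one_minus_X_powr_nth pochhammer_fact [symmetric])

lemma fps_one_minus_X_powr_mult_power:
  "fps_one_minus_X_powr (- a) * (fps_one_minus_X_powr (- 1)) ^ i = fps_one_minus_X_powr (- (a + of_nat i))"
proof (induction i)
  case (Suc i)
  have "fps_one_minus_X_powr (- a) * (fps_one_minus_X_powr (- 1)) ^ Suc i =
     (fps_one_minus_X_powr (- a) * (fps_one_minus_X_powr (- 1)) ^ i) * fps_one_minus_X_powr (- 1)"
    by (simp add: mult_ac)
  also have "\<dots> = fps_one_minus_X_powr (- (a + of_nat i) + - 1)"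
    by (simp only: Suc fps_one_minus_X_powr_add)
  also have "- (a + of_nat i) + - 1 = - (a + of_nat (Suc i))" by simp
  finally show ?case .
qed simp

text \<open>
  Pfaff's transformation \<open>F(a, b; c; v) = (1 - v)^(-a) F(a, c - b; c; v/(v - 1))\<close> as an identity of
  formal power series. The coefficient of \<open>v^n\<close> on the right is a terminating hypergeometric sum,
  evaluated by Vandermonde's identity.
\<close>

lemma fps_hypergeo_Pfaff:
  fixes a b c :: complex
  assumes c: "Re c > 0"
  shows "fps_one_minus_X_powr (- a) * fps_compose (fps_hypergeo [a, c - b] [c] 1) (- (fps_X * inverse (1 - fps_X))) =
    fps_hypergeo [a, b] [c] 1"
proof (rule fps_ext)
  fix n
  define W :: "complex fps" where "W = - (fps_X * inverse (1 - fps_X))"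
  have W0: "fps_nth W 0 = 0" by (simp add: W_def)
  have pc: "pochhammer c k \<noteq> 0" for k
    using c by (auto simp: pochhammer_eq_0_iff dest!: arg_cong[of _ _ Re])
  \<comment> \<open>Up to sign, the i-th power of W times (1 - X) to the power -a is the i-th power of X times (1 - X) to the power -a - i.\<close>
  have GW: "fps_nth (fps_one_minus_X_powr (- a) * W ^ i) n =
      (- 1) ^ i * (pochhammer (a + of_nat i) (n - i) / fact (n - i))" if "i \<le> n" for i
  proof -
    have "fps_one_minus_X_powr (- a) * W ^ i = fps_const ((- 1) ^ i) * (fps_X ^ i * fps_one_minus_X_powr (- (a + of_nat i)))"
    proof -
      have "W = fps_const (- 1) * (fps_X * fps_one_minus_X_powr (- 1))"
        by (simp add: W_def inverse_one_minus_X flip: fps_const_neg)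
      then have "W ^ i = fps_const ((- 1) ^ i) * (fps_X ^ i * fps_one_minus_X_powr (- 1) ^ i)"
        by (simp add: power_mult_distrib fps_const_power)
      then have "fps_one_minus_X_powr (- a) * W ^ i = fps_const ((- 1) ^ i) * (fps_X ^ i * (fps_one_minus_X_powr (- a) * fps_one_minus_X_powr (- 1) ^ i))"
        by (simp add: mult_ac)
      then show ?thesis by (simp only: fps_one_minus_X_powr_mult_power)
    qed
    then show ?thesis
      using that by (simp add: fps_X_power_mult_nth fps_one_minus_X_powr_nth del: minus_add_distrib)
  qed
  have "fps_nth (fps_one_minus_X_powr (- a) * fps_compose (fps_hypergeo [a, c - b] [c] 1) W) n =
     (\<Sum>i=0..n. fps_nth (fps_hypergeo [a, c - b] [c] 1) i * fps_nth (fps_one_minus_X_powr (- a) * W ^ i) n)"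
    by (rule fps_mult_compose_nth[OF W0])
  also have "\<dots> = (\<Sum>i=0..n. pochhammer a n / fact n * (pochhammer (c - b) i * pochhammer (- of_nat n) i / (of_nat (fact i) * pochhammer c i)))"
  proof (rule sum.cong[OF refl])
    fix i assume "i \<in> {0..n}"
    then have i: "i \<le> n" by simp
    have 1: "pochhammer a i * pochhammer (a + of_nat i) (n - i) = pochhammer a n"
      using pochhammer_product[OF i, of a] by simp
    have "(- 1) ^ i * pochhammer (- of_nat n) i / fact i = (fact n / (fact i * fact (n - i)) :: complex)"
      using binomial_fact[OF i, where 'a = complex] gbinomial_pochhammer[of "of_nat n :: complex" i]
      by (simp add: binomial_gbinomial)
    then have "(- 1) ^ i * ((- 1) ^ i * pochhammer (- of_nat n) i / fact i) = (- 1) ^ i * (fact n / (fact i * fact (n - i)) :: complex)"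
      by simp
    also have "(- 1) ^ i * ((- 1) ^ i * pochhammer (- of_nat n) i / fact i) = (((- 1) ^ i * (- 1) ^ i) * pochhammer (- of_nat n) i / fact i :: complex)"
      by simp
    also have "(- 1) ^ i * (- 1) ^ i = (1 :: complex)" by (simp flip: power_mult_distrib)
    finally have 2: "pochhammer (- of_nat n) i = (- 1) ^ i * (fact n / fact (n - i) :: complex)"
      by (simp add: field_simps)
    show "fps_nth (fps_hypergeo [a, c - b] [c] 1) i * fps_nth (fps_one_minus_X_powr (- a) * W ^ i) n =
      pochhammer a n / fact n * (pochhammer (c - b) i * pochhammer (- of_nat n) i / (of_nat (fact i) * pochhammer c i))"
      unfolding GW[OF i] 2 1 [symmetric] using pc[of i] by (simp add: field_simps)
  qed
  also have "\<dots> = pochhammer a n / fact n * (pochhammer b n / pochhammer c n)"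
  proof -
    have "\<forall>i\<in>{0..<n}. c \<noteq> - of_nat i" using c by (auto dest!: arg_cong[of _ _ Re])
    from Vandermonde_pochhammer[OF this, of "c - b"] show ?thesis
      by (simp only: sum_distrib_left [symmetric]) simp
  qed
  also have "\<dots> = fps_nth (fps_hypergeo [a, b] [c] 1) n" by simp
  finally show "fps_nth (fps_one_minus_X_powr (- a) * fps_compose (fps_hypergeo [a, c - b] [c] 1) (- (fps_X * inverse (1 - fps_X)))) n =
    fps_nth (fps_hypergeo [a, b] [c] 1) n" unfolding W_def .
qed

definition Pfaff_2F1 :: "complex \<Rightarrow> complex \<Rightarrow> complex \<Rightarrow> complex \<Rightarrow> complex" where
  "Pfaff_2F1 a b c v = (1 - v) powr (- a) * eval_fps (fps_hypergeo [a, c - b] [c] 1) (v / (v - 1))"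

text \<open>
  The half-plane \<open>Re v < 1/2\<close> consists of the points that are closer to 0 than to 1.
\<close>

lemma norm_Moebius_less_1:
  assumes "Re v < 1 / 2"
  shows "norm (v / (v - 1)) < 1"
proof -
  have "(norm v)\<^sup>2 < (norm (v - 1))\<^sup>2"
    using assms unfolding cmod_power2 by (simp add: power2_eq_square algebra_simps)
  then have "norm v < norm (v - 1)" by (rule power2_less_imp_less) simp
  then show ?thesis by (simp add: norm_divide divide_less_eq_1)
qed

lemma Pfaff_2F1_holomorphic:
  assumes "Re c > 0"
  shows "Pfaff_2F1 a b c holomorphic_on {v. Re v < 1 / 2}"
proof -
  have "(\<lambda>v. v / (v - 1)) holomorphic_on {v. Re v < 1 / 2}"
    by (intro holomorphic_intros) auto
  moreover have "(\<lambda>v. v / (v - 1)) ` {v. Re v < 1 / 2} \<subseteq> eball 0 (fps_conv_radius (fps_hypergeo [a, c - b] [c] 1))"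
  proof
    fix w assume "w \<in> (\<lambda>v. v / (v - 1)) ` {v. Re v < 1 / 2}"
    then have "norm w < 1" using norm_Moebius_less_1 by auto
    then have "ereal (norm w) < 1" by (simp add: one_ereal_def)
    also have "\<dots> \<le> fps_conv_radius (fps_hypergeo [a, c - b] [c] 1)" by (rule fps_conv_radius_hypergeo_ge) fact
    finally show "w \<in> eball 0 (fps_conv_radius (fps_hypergeo [a, c - b] [c] 1))" by (simp add: in_eball_iff)
  qed
  ultimately have "(eval_fps (fps_hypergeo [a, c - b] [c] 1) \<circ> (\<lambda>v. v / (v - 1))) holomorphic_on {v. Re v < 1 / 2}"
    by (intro holomorphic_on_compose_gen[of _ _ _ "eball 0 (fps_conv_radius (fps_hypergeo [a, c - b] [c] 1))"]
          holomorphic_on_eval_fps) auto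
  moreover have "(\<lambda>v. (1 - v) powr (- a)) holomorphic_on {v. Re v < 1 / 2}"
    by (intro holomorphic_intros) (auto simp: complex_nonpos_Reals_iff)
  ultimately have "(\<lambda>v. (1 - v) powr (- a) * (eval_fps (fps_hypergeo [a, c - b] [c] 1) \<circ> (\<lambda>v. v / (v - 1))) v) holomorphic_on {v. Re v < 1 / 2}"
    by (intro holomorphic_on_mult)
  then show ?thesis by (simp add: Pfaff_2F1_def [abs_def] o_def)
qed

lemma Pfaff_2F1_has_fps_expansion:
  assumes c: "Re c > 0"
  shows "Pfaff_2F1 a b c has_fps_expansion fps_hypergeo [a, b] [c] 1"
proof -
  define F where "F = fps_hypergeo [a, c - b] [c] (1 :: complex)"
  have F: "eval_fps F has_fps_expansion F"
    unfolding F_def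
    by (intro eval_fps_has_fps_expansion less_le_trans[OF _ fps_conv_radius_hypergeo_ge[OF c]]) simp
  have W: "(\<lambda>v :: complex. - (v * inverse (1 - v))) has_fps_expansion - (fps_X * inverse (1 - fps_X))"
    by (intro fps_expansion_intros) auto
  have 1: "(eval_fps F \<circ> (\<lambda>v. - (v * inverse (1 - v)))) has_fps_expansion fps_compose F (- (fps_X * inverse (1 - fps_X)))"
    by (intro has_fps_expansion_compose F W) simp
  have 2: "((\<lambda>x. (1 + x) powr (- a)) \<circ> (\<lambda>v. - v)) has_fps_expansion fps_one_minus_X_powr (- a)"
    unfolding fps_one_minus_X_powr_def
    by (intro has_fps_expansion_compose has_fps_expansion_binomial_complex fps_expansion_intros) simp
  have "(\<lambda>v. ((\<lambda>x. (1 + x) powr (- a)) \<circ> (\<lambda>v. - v)) v * (eval_fps F \<circ> (\<lambda>v. - (v * inverse (1 - v)))) v)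
     has_fps_expansion fps_one_minus_X_powr (- a) * fps_compose F (- (fps_X * inverse (1 - fps_X)))"
    by (intro has_fps_expansion_mult 1 2)
  moreover have "- (v * inverse (1 - v)) = v / (v - 1)" for v :: complex
    by (metis divide_inverse minus_diff_eq minus_divide_right)
  ultimately show ?thesis
    unfolding F_def fps_hypergeo_Pfaff[OF c] by (simp add: Pfaff_2F1_def [abs_def])
qed

lemma closed_segment_0_subset_half_plane:
  assumes "Re v < 1 / 2"
  shows "closed_segment 0 v \<subseteq> {v. Re v < 1 / 2}"
  using assms by (intro closed_segment_subset convex_halfspace_Re_lt) auto

text \<open>
  The right-hand side is holomorphic on the half-plane \<open>Re v < 1/2\<close>, which contains the segment from
  0 to \<open>v\<close>; so it is the continuation that defines the Gauss function, also beyond the unit disc.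
\<close>

theorem Gauss_2F1_Pfaff:
  assumes "Re c > 0" "Re v < 1 / 2"
  shows "Gauss_2F1 a b c v = (1 - v) powr (- a) *
     (\<Sum>n. pochhammer a n * pochhammer (c - b) n / (pochhammer c n * fact n) * (v / (v - 1)) ^ n)"
proof -
  have "Gauss_2F1 a b c v = Pfaff_2F1 a b c v"
    using assms
    by (intro Gauss_2F1_eqI[OF open_halfspace_Re_lt closed_segment_0_subset_half_plane]
          Pfaff_2F1_holomorphic Pfaff_2F1_has_fps_expansion)
  then show ?thesis by (simp add: Pfaff_2F1_def eval_fps_def)
qed

text \<open>
  An identity between the coefficients at 0, which the uniqueness of the continuation transports
  to \<open>v\<close>.
\<close>

theorem Gauss_2F1_contiguous:
  assumes c: "Re c > 0" and v: "Re v < 1 / 2"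
  shows "Gauss_2F1 a b c v = Gauss_2F1 (a + 1) b c v - b / c * v * Gauss_2F1 (a + 1) (b + 1) (c + 1) v"
proof -
  have G: "Gauss_2F1 a b c v = Pfaff_2F1 a b c v" if "Re c > 0" for a b c
    using that v
    by (intro Gauss_2F1_eqI[OF open_halfspace_Re_lt closed_segment_0_subset_half_plane]
          Pfaff_2F1_holomorphic Pfaff_2F1_has_fps_expansion)
  define f where "f = (\<lambda>v. Pfaff_2F1 (a + 1) b c v - b / c * v * Pfaff_2F1 (a + 1) (b + 1) (c + 1) v)"
  have "Gauss_2F1 a b c v = f v"
  proof (rule Gauss_2F1_eqI[OF _ closed_segment_0_subset_half_plane[OF v]])
    show "open {v. Re v < 1 / 2}" by (rule open_halfspace_Re_lt)
    show "f holomorphic_on {v. Re v < 1 / 2}"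
      unfolding f_def using c by (intro holomorphic_intros Pfaff_2F1_holomorphic) auto
    have "f has_fps_expansion (fps_hypergeo [a + 1, b] [c] 1 - fps_const (b / c) * fps_X * fps_hypergeo [a + 1, b + 1] [c + 1] 1)"
      unfolding f_def using c by (intro fps_expansion_intros Pfaff_2F1_has_fps_expansion) auto
    also have "fps_hypergeo [a + 1, b] [c] 1 - fps_const (b / c) * fps_X * fps_hypergeo [a + 1, b + 1] [c + 1] 1 =
       fps_hypergeo [a, b] [c] 1"
    proof (rule fps_ext)
      fix n
      show "fps_nth (fps_hypergeo [a + 1, b] [c] 1 - fps_const (b / c) * fps_X * fps_hypergeo [a + 1, b + 1] [c + 1] 1) n =
         fps_nth (fps_hypergeo [a, b] [c] 1) n"
      proof (cases n)
        case (Suc m)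
        have pc: "pochhammer (c + 1) k \<noteq> 0" "c \<noteq> 0" for k
          using c by (auto simp: pochhammer_eq_0_iff dest!: arg_cong[of _ _ Re])
        have f: "fact (Suc m) = (1 + of_nat m) * (fact m :: complex)" "1 + of_nat m \<noteq> (0 :: complex)"
          using of_nat_neq_0[of m, where 'a = complex] by simp_all
        have "fps_nth (fps_hypergeo [a + 1, b] [c] 1) n - b / c * fps_nth (fps_hypergeo [a + 1, b + 1] [c + 1] 1) m =
          pochhammer (a + 1) m * (a + 1 + of_nat m) * (b * pochhammer (b + 1) m) / (c * pochhammer (c + 1) m * fact (Suc m)) -
          b / c * (pochhammer (a + 1) m * pochhammer (b + 1) m / (pochhammer (c + 1) m * fact m))"
          by (simp add: Suc pochhammer_rec[of b] pochhammer_rec[of c] pochhammer_Suc[of "a + 1"] del: fact_Suc)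
        also have "\<dots> = a * pochhammer (a + 1) m * (b * pochhammer (b + 1) m) / (c * pochhammer (c + 1) m * fact (Suc m))"
          unfolding f(1) using pc f(2) by (simp add: divide_simps) (simp add: algebra_simps)
        also have "\<dots> = fps_nth (fps_hypergeo [a, b] [c] 1) n"
          by (simp add: Suc pochhammer_rec del: fact_Suc)
        finally show ?thesis by (simp add: Suc mult.assoc)
      qed simp
    qed
    finally show "f has_fps_expansion fps_hypergeo [a, b] [c] 1" .
  qed
  then show ?thesis using c by (simp add: f_def G)
qed

section \<open>The Gauss function against powers\<close>

text \<open>
  The sum of the norms has a finite integral by monotone convergence, so the series converges
  absolutely almost everywhere.
\<close>

lemma sums_integral_of_summable_norms:
  fixes f :: "nat \<Rightarrow> 'a \<Rightarrow> complex"
  assumes f: "\<And>i. integrable M (f i)" and s: "summable (\<lambda>i. \<integral>x. norm (f i x) \<partial>M)"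
  shows "AE x in M. summable (\<lambda>i. norm (f i x))"
    and "integrable M (\<lambda>x. \<Sum>i. f i x)"
    and "(\<lambda>i. integral\<^sup>L M (f i)) sums (\<integral>x. (\<Sum>i. f i x) \<partial>M)"
    and "(\<integral>x. norm (\<Sum>i. f i x) \<partial>M) \<le> (\<Sum>i. \<integral>x. norm (f i x) \<partial>M)"
proof -
  have [measurable]: "f i \<in> borel_measurable M" for i using f by auto
  show ae: "AE x in M. summable (\<lambda>i. norm (f i x))"
  proof -
    have "(\<integral>\<^sup>+ x. (\<Sum>i. ennreal (norm (f i x))) \<partial>M) = (\<Sum>i. \<integral>\<^sup>+ x. ennreal (norm (f i x)) \<partial>M)"
      by (intro nn_integral_suminf) auto
    also have "\<dots> = (\<Sum>i. ennreal (\<integral>x. norm (f i x) \<partial>M))"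
      using f by (intro arg_cong[where f = suminf] ext nn_integral_eq_integral integrable_norm) auto
    also have "\<dots> \<noteq> \<infinity>"
      using s by (simp add: ennreal_suminf_neq_top)
    finally have "AE x in M. (\<Sum>i. ennreal (norm (f i x))) \<noteq> \<infinity>"
      by (intro nn_integral_noteq_infinite) auto
    then show ?thesis
      by eventually_elim (auto intro!: summable_suminf_not_top)
  qed
  show int: "integrable M (\<lambda>x. \<Sum>i. f i x)" by (rule integrable_suminf[OF f ae s])
  show "(\<lambda>i. integral\<^sup>L M (f i)) sums (\<integral>x. (\<Sum>i. f i x) \<partial>M)" by (rule sums_integral[OF f ae s])
  have ae': "AE x in M. summable (\<lambda>i. norm (norm (f i x)))" using ae by simp
  have s': "summable (\<lambda>i. \<integral>x. norm (norm (f i x)) \<partial>M)" using s by simp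
  have "(\<integral>x. norm (\<Sum>i. f i x) \<partial>M) \<le> (\<integral>x. (\<Sum>i. norm (f i x)) \<partial>M)"
  proof (rule integral_mono_AE)
    show "integrable M (\<lambda>x. \<Sum>i. norm (f i x))"
      by (rule integrable_suminf[OF integrable_norm[OF f] ae' s'])
    show "AE x in M. norm (\<Sum>i. f i x) \<le> (\<Sum>i. norm (f i x))"
      using ae by eventually_elim (rule summable_norm)
  qed (use int in auto)
  also have "\<dots> = (\<Sum>i. \<integral>x. norm (f i x) \<partial>M)"
    by (rule integral_suminf[OF integrable_norm[OF f] ae' s'])
  finally show "(\<integral>x. norm (\<Sum>i. f i x) \<partial>M) \<le> (\<Sum>i. \<integral>x. norm (f i x) \<partial>M)" .
qed

lemma Beta_shift_le:
  fixes g s :: real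
  assumes g: "g > 0" and s: "s > 0"
  obtains C where "C > 0" "\<And>n. Beta (g + real n) s \<le> C * real (n + 1) powr (- s)"
proof -
  obtain C where C: "C > 0" "\<And>k l. norm (pochhammer (complex_of_real g + of_nat k) l / pochhammer (of_real (g + s) + of_nat k) l) \<le>
       C * (real (k + l + 1) / real (k + 1)) powr Re (of_real g - of_real (g + s))"
    using norm_pochhammer_ratio_le[of "of_real (g + s)" "of_real g"] g s by auto
  show thesis
  proof (rule that)
    show "Beta g s * C > 0" using C(1) g s by (simp add: Beta_def)
    fix n
    have np: "g \<notin> \<int>\<^sub>\<le>\<^sub>0" "g + s \<notin> \<int>\<^sub>\<le>\<^sub>0" using g s by (auto elim!: nonpos_Ints_cases)
    have pos: "pochhammer g n > 0" "pochhammer (g + s) n > 0" using g s by (auto intro: pochhammer_pos)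
    have "pochhammer g n / pochhammer (g + s) n = norm (pochhammer (complex_of_real g) n / pochhammer (of_real (g + s)) n)"
      using pos unfolding pochhammer_of_real norm_divide norm_of_real by simp
    also have "\<dots> \<le> C * real (n + 1) powr (- s)" using C(2)[of 0 n] by simp
    finally have 1: "pochhammer g n / pochhammer (g + s) n \<le> C * real (n + 1) powr (- s)" .
    have G: "Gamma (g + real n) = Gamma g * pochhammer g n" "Gamma (g + s + real n) = Gamma (g + s) * pochhammer (g + s) n"
      using np by (simp_all add: pochhammer_Gamma Gamma_eq_zero_iff)
    have "Beta (g + real n) s = Beta g s * (pochhammer g n / pochhammer (g + s) n)"
      using G by (simp add: Beta_def add_ac)
    also have "\<dots> \<le> Beta g s * (C * real (n + 1) powr (- s))"
      using 1 g s by (intro mult_left_mono) (auto simp: Beta_def)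
    finally show "Beta (g + real n) s \<le> Beta g s * C * real (n + 1) powr (- s)" by simp
  qed
qed

abbreviation Pfaff_coeff :: "complex \<Rightarrow> complex \<Rightarrow> complex \<Rightarrow> nat \<Rightarrow> complex" where
  "Pfaff_coeff A B c n \<equiv> pochhammer A n * pochhammer (c - B) n / (pochhammer c n * fact n)"

text \<open>
  The weight of the \<open>l\<close>-th term of Pfaff's series, with its beta integral, for denominator parameter
  \<open>g + k\<close>. The estimate is uniform in \<open>k\<close>, as the later sum over \<open>k\<close> requires.
\<close>

lemma Pfaff_coefficient_Beta_le:
  fixes A B g :: complex
  assumes g: "Re g > 0" and s: "s > 0"
  obtains C where "C > 0"
    "\<And>k l. norm (Pfaff_coeff A B (g + of_nat k) l) *
       Beta (Re g + real (k + l)) s \<le>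
       C * (real (l + 1) powr (Re A - 1) * real (k + 1) powr Re B * real (k + l + 1) powr (- Re B - s))"
proof -
  obtain C1 where C1: "C1 > 0" "\<And>n. norm (pochhammer A n / fact n) \<le> C1 * real (n + 1) powr (Re A - 1)"
    using norm_pochhammer_fact_le by blast
  obtain C2 where C2: "C2 > 0" "\<And>k l. norm (pochhammer (g - B + of_nat k) l / pochhammer (g + of_nat k) l) \<le>
       C2 * (real (k + l + 1) / real (k + 1)) powr Re (g - B - g)"
    using norm_pochhammer_ratio_le[OF g, of "g - B"] by blast
  obtain C3 where C3: "C3 > 0" "\<And>n. Beta (Re g + real n) s \<le> C3 * real (n + 1) powr (- s)"
    using Beta_shift_le[OF g s] by blast
  show thesis
  proof (rule that)
    show "C1 * C2 * C3 > 0" using C1 C2 C3 by simp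
    fix k l
    have B0: "Beta (Re g + real (k + l)) s \<ge> 0"
      using g s by (simp add: Beta_def)
    have "norm (Pfaff_coeff A B (g + of_nat k) l) =
      norm (pochhammer A l / fact l) * norm (pochhammer (g - B + of_nat k) l / pochhammer (g + of_nat k) l)"
      by (simp add: norm_mult norm_divide algebra_simps)
    moreover have "norm (pochhammer (g - B + of_nat k) l / pochhammer (g + of_nat k) l) \<le>
        C2 * (real (k + l + 1) / real (k + 1)) powr (- Re B)"
      using C2(2)[of k l] by simp
    ultimately have "norm (Pfaff_coeff A B (g + of_nat k) l) *
       Beta (Re g + real (k + l)) s \<le>
       ((C1 * real (l + 1) powr (Re A - 1)) * (C2 * (real (k + l + 1) / real (k + 1)) powr (- Re B))) *
       (C3 * real (k + l + 1) powr (- s))"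
      using C1(1) C2(1) B0 by (simp only:) (intro mult_mono C1(2) C3(2) mult_nonneg_nonneg; simp)
    also have "(real (k + l + 1) / real (k + 1)) powr (- Re B) = real (k + l + 1) powr (- Re B) * real (k + 1) powr Re B"
      by (subst powr_divide) (auto simp: powr_minus field_simps)
    also have "((C1 * real (l + 1) powr (Re A - 1)) * (C2 * (real (k + l + 1) powr (- Re B) * real (k + 1) powr Re B))) *
       (C3 * real (k + l + 1) powr (- s)) =
       C1 * C2 * C3 * (real (l + 1) powr (Re A - 1) * real (k + 1) powr Re B * (real (k + l + 1) powr (- Re B) * real (k + l + 1) powr (- s)))"
      by (simp add: mult_ac)
    also have "real (k + l + 1) powr (- Re B) * real (k + l + 1) powr (- s) = real (k + l + 1) powr (- Re B - s)"
      by (simp only: powr_add [symmetric]) simp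
    finally show "norm (Pfaff_coeff A B (g + of_nat k) l) *
       Beta (Re g + real (k + l)) s \<le>
       C1 * C2 * C3 * (real (l + 1) powr (Re A - 1) * real (k + 1) powr Re B * real (k + l + 1) powr (- Re B - s))" .
  qed
qed

text \<open>
  The weight is chosen such that multiplication with \<open>(1 - x/t)^k\<close>, the power in the Appell series,
  amounts to replacing \<open>c\<close> by \<open>c + k\<close> in the exponents, with \<open>l\<close> unchanged.
\<close>

definition Gauss_kernel :: "real \<Rightarrow> complex \<Rightarrow> complex \<Rightarrow> complex \<Rightarrow> complex \<Rightarrow> real \<Rightarrow> complex" where
  "Gauss_kernel x A B c l t = of_real (t - x) powr (c - 1) * of_real t powr (- c - l) *
     Gauss_2F1 A B c (of_real (1 - t / x))"

definition Pfaff_term :: "real \<Rightarrow> complex \<Rightarrow> complex \<Rightarrow> complex \<Rightarrow> complex \<Rightarrow> nat \<Rightarrow> real \<Rightarrow> complex" where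
  "Pfaff_term x A B c l n t = Pfaff_coeff A B c n * of_real x powr A *
     (of_real (t - x) powr (c + of_nat n - 1) * of_real t powr (- (c + of_nat n) - (l + A)))"

text \<open>
  With \<open>v = 1 - t/x\<close> one has \<open>1 - v = t/x\<close> and \<open>v/(v - 1) = (t - x)/t\<close>: all factors in Pfaff's series
  are powers of \<open>t - x\<close>, \<open>t\<close> and \<open>x\<close>.
\<close>

lemma Gauss_kernel_eq_suminf:
  assumes c: "Re c > 0" and x: "x > 0" and t: "t > x"
  shows "Gauss_kernel x A B c l t = (\<Sum>n. Pfaff_term x A B c l n t)"
proof -
  define v :: complex where "v = of_real (1 - t / x)"
  have t0: "t > 0" using x t by simp
  have v: "Re v < 1 / 2" using x t by (simp add: v_def field_simps)
  have m: "v / (v - 1) = of_real ((t - x) / t)"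
  proof -
    have "v / (v - 1) = of_real ((1 - t / x) / (1 - t / x - 1))" by (simp add: v_def)
    also have "(1 - t / x) / (1 - t / x - 1) = (t - x) / t" using x t by (simp add: field_simps)
    finally show ?thesis .
  qed
  have u: "norm (v / (v - 1)) < 1" by (rule norm_Moebius_less_1[OF v])
  have v1: "1 - v = of_real (t / x)" by (simp add: v_def)
  have p: "(1 - v) powr (- A) = of_real t powr (- A) * of_real x powr A"
    unfolding v1 using t0 x by (simp add: powr_def Ln_of_real ln_div exp_add [symmetric] algebra_simps del: of_real_divide)
  define C where "C = of_real (t - x) powr (c - 1) * of_real t powr (- c - l) * (of_real t powr (- A) * of_real x powr A)"
  have s: "summable (\<lambda>n. Pfaff_coeff A B c n * (v / (v - 1)) ^ n)"
    by (rule summable_hypergeo[OF u c])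
  have "Gauss_kernel x A B c l t = C * (\<Sum>n. Pfaff_coeff A B c n * (v / (v - 1)) ^ n)"
    unfolding Gauss_kernel_def v_def [symmetric] Gauss_2F1_Pfaff[OF c v] p C_def by (simp only: mult.assoc)
  also have "\<dots> = (\<Sum>n. C * (Pfaff_coeff A B c n * (v / (v - 1)) ^ n))"
    using s by (rule suminf_mult [symmetric])
  also have "\<dots> = (\<Sum>n. Pfaff_term x A B c l n t)"
  proof (intro arg_cong[where f = suminf] ext)
    fix n
    have "C * (v / (v - 1)) ^ n = of_real x powr A *
       ((of_real (t - x) powr (c - 1) * of_real (t - x) ^ n) * (of_real t powr (- c - l) * of_real t powr (- A) / of_real t ^ n))"
      by (simp add: C_def m power_divide)
    also have "of_real (t - x) powr (c - 1) * of_real (t - x) ^ n = (of_real (t - x) powr (c + of_nat n - 1) :: complex)"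
    proof -
      have "of_real (t - x) ^ n = (of_real (t - x) powr of_nat n :: complex)" using t by (subst powr_nat) auto
      then show ?thesis by (simp only: powr_add [symmetric]) (simp add: algebra_simps)
    qed
    also have "of_real t powr (- c - l) * of_real t powr (- A) / of_real t ^ n = (of_real t powr (- (c + of_nat n) - (l + A)) :: complex)"
    proof -
      have "inverse (of_real t ^ n) = (of_real t powr (- of_nat n) :: complex)"
        using t0 by (subst powr_minus) (simp add: powr_nat)
      moreover have "- c - l + - A + - of_nat n = - (c + of_nat n) - (l + A)" by simp
      ultimately show ?thesis unfolding divide_inverse
        by (simp only: powr_add [symmetric])
    qed
    finally have e: "C * (v / (v - 1)) ^ n = of_real x powr A *
      (of_real (t - x) powr (c + of_nat n - 1) * of_real t powr (- (c + of_nat n) - (l + A)))" .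
    define K where "K = Pfaff_coeff A B c n"
    have "C * (K * (v / (v - 1)) ^ n) = K * (C * (v / (v - 1)) ^ n)"
      by (rule mult.left_commute)
    then show "C * (Pfaff_coeff A B c n * (v / (v - 1)) ^ n) = Pfaff_term x A B c l n t"
      unfolding e Pfaff_term_def K_def by (simp only: mult.assoc)
  qed
  finally show ?thesis .
qed

lemma Pfaff_term_integral:
  assumes c: "Re c > 0" and lA: "Re (l + A) > 0" and x: "x > 0"
  shows "set_integrable lborel {x<..} (Pfaff_term x A B c l n)"
    and "(LINT t:{x<..}|lborel. Pfaff_term x A B c l n t) =
       Gamma c * Gamma (l + A) * of_real x powr (- l) *
       (Gauss_term A (c - B) (c + (l + A)) n)" (is "?J = ?V")
    and "(LINT t|lborel. norm (indicat_real {x<..} t *\<^sub>R Pfaff_term x A B c l n t)) =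
       norm (Pfaff_coeff A B c n) *
       Beta (Re c + real n) (Re (l + A)) * x powr (- Re l)" (is "?N = ?W")
proof -
  define q where "q = Pfaff_coeff A B c n * of_real x powr A"
  have P: "Re (c + of_nat n) > 0" using c by simp
  have T: "Pfaff_term x A B c l n = (\<lambda>t. q * (of_real (t - x) powr (c + of_nat n - 1) * of_real t powr (- (c + of_nat n) - (l + A))))"
    by (simp add: fun_eq_iff Pfaff_term_def q_def)
  show "set_integrable lborel {x<..} (Pfaff_term x A B c l n)"
    unfolding T by (intro set_integrable_mult_right Beta_integral_half_line(1) P lA x)
  have np: "c \<notin> \<int>\<^sub>\<le>\<^sub>0" by (rule Re_pos_not_nonpos_Int[OF c])
  have "(LINT t:{x<..}|lborel. Pfaff_term x A B c l n t) =
      q * (Gamma (c + of_nat n) * Gamma (l + A) * rGamma (c + of_nat n + (l + A)) * of_real x powr (- (l + A)))"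
    unfolding T by (simp only: set_integral_mult_right Beta_integral_half_line(2)[OF P lA x])
  also have "\<dots> = (Gamma (c + of_nat n) / pochhammer c n) * Gamma (l + A) * (of_real x powr A * of_real x powr (- (l + A))) *
       (Gauss_term A (c - B) (c + (l + A)) n)"
    by (simp add: q_def mult_ac add_ac)
  also have "Gamma (c + of_nat n) / pochhammer c n = Gamma c"
    using np Re_pos_not_nonpos_Int[OF P] by (simp add: pochhammer_Gamma Gamma_eq_zero_iff)
  also have "of_real x powr A * of_real x powr (- (l + A)) = (of_real x powr (- l) :: complex)"
    by (simp only: powr_add [symmetric]) simp
  finally show "?J = ?V" .
  have "(LINT t|lborel. norm (indicat_real {x<..} t *\<^sub>R Pfaff_term x A B c l n t)) =
      norm q * (LINT t|lborel. norm (indicat_real {x<..} t *\<^sub>R (of_real (t - x) powr (c + of_nat n - 1) * of_real t powr (- (c + of_nat n) - (l + A)) :: complex)))"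
    unfolding T by (simp add: norm_mult mult_ac flip: integral_mult_right_zero)
  also have "\<dots> = norm q * (Beta (Re c + real n) (Re (l + A)) * x powr (- Re (l + A)))"
    using Beta_integral_half_line_norm[OF P lA x] by simp
  also have "norm q = norm (Pfaff_coeff A B c n) * x powr Re A"
    unfolding q_def norm_mult[of _ "of_real x powr A"] norm_of_real_powr[OF x] ..
  also have "norm (Pfaff_coeff A B c n) * x powr Re A * (Beta (Re c + real n) (Re (l + A)) * x powr (- Re (l + A))) =
     norm (Pfaff_coeff A B c n) * Beta (Re c + real n) (Re (l + A)) * (x powr Re A * x powr (- Re (l + A)))"
    by (simp only: mult_ac)
  also have "x powr Re A * x powr (- Re (l + A)) = x powr (- Re l)"
    by (simp only: powr_add [symmetric]) simp
  finally show "?N = ?W" .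
qed

text \<open>
  The norms are of order at most \<open>n^(-1 - Re (l + B))\<close>.
\<close>

lemma summable_Pfaff_term_norms:
  assumes c: "Re c > 0" and lA: "Re (l + A) > 0" and lB: "Re (l + B) > 0" and x: "x > 0"
  shows "summable (\<lambda>n. LINT t|lborel. norm (indicat_real {x<..} t *\<^sub>R Pfaff_term x A B c l n t))"
proof -
  obtain C where C: "C > 0"
    "\<And>k n. norm (Pfaff_coeff A B (c + of_nat k) n) *
       Beta (Re c + real (k + n)) (Re (l + A)) \<le>
       C * (real (n + 1) powr (Re A - 1) * real (k + 1) powr Re B * real (k + n + 1) powr (- Re B - Re (l + A)))"
    using Pfaff_coefficient_Beta_le[OF c lA] by blast
  show ?thesis unfolding Pfaff_term_integral(3)[OF c lA x]
  proof (rule summable_comparison_test')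
    show "summable (\<lambda>n. C * real (0 + n + 1) powr (- 1 - Re (l + B)) * x powr (- Re l))"
      by (intro summable_mult summable_mult2 powr_tail_sum_le(1) lB)
    fix n :: nat
    have "norm (norm (Pfaff_coeff A B c n) * Beta (Re c + real n) (Re (l + A)) * x powr (- Re l)) =
      norm (Pfaff_coeff A B c n) * Beta (Re c + real n) (Re (l + A)) * x powr (- Re l)"
      using c lA by (simp add: Beta_def abs_mult norm_mult)
    also have "\<dots> \<le> C * (real (n + 1) powr (Re A - 1) * real (n + 1) powr (- Re B - Re (l + A))) * x powr (- Re l)"
      using C(2)[of n 0] by (intro mult_right_mono) auto
    also have "real (n + 1) powr (Re A - 1) * real (n + 1) powr (- Re B - Re (l + A)) = real (0 + n + 1) powr (- 1 - Re (l + B))"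
      by (simp only: powr_add [symmetric]) (simp add: algebra_simps)
    finally show "norm (norm (Pfaff_coeff A B c n) * Beta (Re c + real n) (Re (l + A)) * x powr (- Re l))
      \<le> C * real (0 + n + 1) powr (- 1 - Re (l + B)) * x powr (- Re l)" .
  qed
qed

text \<open>
  Term-wise integration of Pfaff's series; the resulting sum is a case of Gauss's theorem.
\<close>

lemma Gauss_kernel_integral:
  assumes c: "Re c > 0" and lA: "Re (l + A) > 0" and lB: "Re (l + B) > 0" and x: "x > 0"
  shows "set_integrable lborel {x<..} (Gauss_kernel x A B c l)" (is ?int)
    and "(LINT t:{x<..}|lborel. Gauss_kernel x A B c l t) =
       Gamma c * Gamma (l + A) * Gamma (l + B) * rGamma (c + l) * rGamma (l + A + B) * of_real x powr (- l)" (is "?J = ?V")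
    and "(LINT t|lborel. norm (indicat_real {x<..} t *\<^sub>R Gauss_kernel x A B c l t)) \<le>
       (\<Sum>n. LINT t|lborel. norm (indicat_real {x<..} t *\<^sub>R Pfaff_term x A B c l n t))" (is "?N \<le> ?W")
proof -
  define f where "f = (\<lambda>n t. indicat_real {x<..} t *\<^sub>R Pfaff_term x A B c l n t)"
  have fi: "integrable lborel (f n)" for n
    using Pfaff_term_integral(1)[OF c lA x, of B n] by (simp add: f_def set_integrable_def)
  have s: "summable (\<lambda>n. LINT t|lborel. norm (f n t))"
    using summable_Pfaff_term_norms[OF assms] by (simp add: f_def)
  have sf: "indicat_real {x<..} t *\<^sub>R Gauss_kernel x A B c l t = (\<Sum>n. f n t)" for t
    using Gauss_kernel_eq_suminf[OF c x, of t A B l] by (cases "t > x") (auto simp: f_def)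
  show ?int
    unfolding set_integrable_def sf by (rule sums_integral_of_summable_norms[OF fi s])
  show "?N \<le> ?W"
    unfolding sf using sums_integral_of_summable_norms(4)[OF fi s] by (simp add: f_def)
  define G where "G = Gamma c * Gamma (l + A) * of_real x powr (- l)"
  define u where "u = (\<lambda>n. Gauss_term A (c - B) (c + (l + A)) n)"
  have z: "Re (c + (l + A) - A - (c - B)) > 0" using lB by simp
  have "u sums (Gamma (c + (l + A) - A - (c - B)) * rGamma (c + (l + A) - A) * rGamma (c + (l + A) - (c - B)))"
    using summable_sums[OF summable_norm_cancel[OF summable_Gauss_term[OF z]]] Gauss_sum_regularised[OF z]
    by (simp add: u_def)
  then have "u sums (Gamma (l + B) * rGamma (c + l) * rGamma (l + A + B))"
    by (simp add: algebra_simps)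
  then have "(\<lambda>n. G * u n) sums (G * (Gamma (l + B) * rGamma (c + l) * rGamma (l + A + B)))"
    by (rule sums_mult)
  moreover have "integral\<^sup>L lborel (f n) = G * u n" for n
    using Pfaff_term_integral(2)[OF c lA x, of B n] by (simp only: f_def G_def u_def set_lebesgue_integral_def)
  then have "(\<lambda>n. G * u n) sums (LINT t|lborel. (\<Sum>n. f n t))"
    using sums_integral_of_summable_norms(3)[OF fi s] by simp
  ultimately have "(LINT t|lborel. (\<Sum>n. f n t)) = G * (Gamma (l + B) * rGamma (c + l) * rGamma (l + A + B))"
    by (rule sums_unique2 [symmetric])
  then show "?J = ?V"
    unfolding set_lebesgue_integral_def sf by (simp add: G_def mult_ac)
qed

definition Gauss_kernel_norm :: "real \<Rightarrow> complex \<Rightarrow> complex \<Rightarrow> complex \<Rightarrow> complex \<Rightarrow> real" where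
  "Gauss_kernel_norm x A B c l = (LINT t|lborel. norm (indicat_real {x<..} t *\<^sub>R Gauss_kernel x A B c l t))"

text \<open>
  For \<open>Re A \<ge> 1\<close> the factor \<open>(n + 1)^(Re A - 1)\<close> is at most \<open>(k + n + 1)^(Re A - 1)\<close>, and the sum over
  \<open>n\<close> becomes a tail of a zeta series that starts at \<open>k\<close>.
\<close>

lemma Gauss_kernel_norm_le_base:
  assumes g: "Re g > 0" and A: "Re A \<ge> 1" and lA: "Re (l + A) > 0" and lB: "Re (l + B) > 0" and x: "x > 0"
  shows "\<exists>C>0. \<forall>k. Gauss_kernel_norm x A B (g + of_nat k) l \<le> C * real (k + 1) powr (- Re l)"
proof -
  obtain C where C: "C > 0"
    "\<And>k n. norm (Pfaff_coeff A B (g + of_nat k) n) *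
       Beta (Re g + real (k + n)) (Re (l + A)) \<le>
       C * (real (n + 1) powr (Re A - 1) * real (k + 1) powr Re B * real (k + n + 1) powr (- Re B - Re (l + A)))"
    using Pfaff_coefficient_Beta_le[OF g lA] by blast
  define d where "d = Re (l + B)"
  have d: "d > 0" using lB by (simp add: d_def)
  show ?thesis
  proof (intro exI[of _ "x powr (- Re l) * C * (1 + 1 / d)"] conjI allI)
    show "x powr (- Re l) * C * (1 + 1 / d) > 0" using C(1) x d by (simp add: add_pos_pos)
    fix k
    have c: "Re (g + of_nat k) > 0" using g by simp
    define T where "T = (\<lambda>n. LINT t|lborel. norm (indicat_real {x<..} t *\<^sub>R Pfaff_term x A B (g + of_nat k) l n t))"
    define K where "K = x powr (- Re l) * C * real (k + 1) powr Re B"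
    have K: "K \<ge> 0" using C(1) by (simp add: K_def)
    have Tn: "T n \<le> K * real (k + n + 1) powr (- 1 - d)" for n
    proof -
      have "T n = norm (Pfaff_coeff A B (g + of_nat k) n) *
         Beta (Re g + real (k + n)) (Re (l + A)) * x powr (- Re l)"
        unfolding T_def Pfaff_term_integral(3)[OF c lA x] by (simp add: add_ac)
      also have "\<dots> \<le> C * (real (n + 1) powr (Re A - 1) * real (k + 1) powr Re B * real (k + n + 1) powr (- Re B - Re (l + A))) * x powr (- Re l)"
        using C(2)[of n k] by (intro mult_right_mono) auto
      also have "\<dots> \<le> C * (real (k + n + 1) powr (Re A - 1) * real (k + 1) powr Re B * real (k + n + 1) powr (- Re B - Re (l + A))) * x powr (- Re l)"
        using C(1) A by (intro mult_right_mono mult_left_mono powr_mono2) auto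
      also have "\<dots> = K * (real (k + n + 1) powr (Re A - 1) * real (k + n + 1) powr (- Re B - Re (l + A)))"
        by (simp add: K_def mult_ac)
      also have "real (k + n + 1) powr (Re A - 1) * real (k + n + 1) powr (- Re B - Re (l + A)) = real (k + n + 1) powr (- 1 - d)"
        by (simp only: powr_add [symmetric]) (simp add: d_def algebra_simps)
      finally show ?thesis .
    qed
    have "Gauss_kernel_norm x A B (g + of_nat k) l \<le> suminf T"
      unfolding Gauss_kernel_norm_def T_def by (rule Gauss_kernel_integral(3)[OF c lA lB x])
    also have "\<dots> \<le> (\<Sum>n. K * real (k + n + 1) powr (- 1 - d))"
      using summable_Pfaff_term_norms[OF c lA lB x] powr_tail_sum_le(1)[OF d, of k]
      by (intro suminf_le Tn summable_mult) (simp_all add: T_def)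
    also have "\<dots> = K * (\<Sum>n. real (k + n + 1) powr (- 1 - d))"
      by (intro suminf_mult powr_tail_sum_le(1) d)
    also have "\<dots> \<le> K * ((1 + 1 / d) * real (k + 1) powr (- d))"
      by (intro mult_left_mono powr_tail_sum_le(2) d K)
    also have "\<dots> = x powr (- Re l) * C * (1 + 1 / d) * (real (k + 1) powr Re B * real (k + 1) powr (- d))"
      by (simp only: K_def mult_ac)
    also have "real (k + 1) powr Re B * real (k + 1) powr (- d) = real (k + 1) powr (- Re l)"
      by (simp only: powr_add [symmetric]) (simp add: d_def)
    finally show "Gauss_kernel_norm x A B (g + of_nat k) l \<le> x powr (- Re l) * C * (1 + 1 / d) * real (k + 1) powr (- Re l)" .
  qed
qed

text \<open>
  The argument \<open>1 - t/x\<close> in the second term supplies the factor \<open>t - x\<close> that raises \<open>c\<close> by one.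
\<close>

lemma Gauss_kernel_contiguous:
  assumes c: "Re c > 0" and x: "x > 0" and t: "t > x"
  shows "Gauss_kernel x A B c l t = Gauss_kernel x (A + 1) B c l t +
     B / (c * of_real x) * Gauss_kernel x (A + 1) (B + 1) (c + 1) (l - 1) t"
proof -
  define v :: complex where "v = of_real (1 - t / x)"
  define q where "q = of_real (t - x) powr (c - 1) * of_real t powr (- c - l)"
  have v: "Re v < 1 / 2" using x t by (simp add: v_def field_simps)
  have c0: "c \<noteq> 0" using c by auto
  have "of_real (t - x) powr (c + 1 - 1) = of_real (t - x) * (of_real (t - x) powr (c - 1) :: complex)"
    using t powr_add[of "of_real (t - x) :: complex" 1 "c - 1"] by simp
  then have 1: "Gauss_kernel x (A + 1) (B + 1) (c + 1) (l - 1) t = of_real (t - x) * (q * Gauss_2F1 (A + 1) (B + 1) (c + 1) v)"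
    by (simp add: Gauss_kernel_def q_def v_def)
  have "Gauss_kernel x A B c l t = q * (Gauss_2F1 (A + 1) B c v - B / c * v * Gauss_2F1 (A + 1) (B + 1) (c + 1) v)"
    unfolding Gauss_kernel_def v_def [symmetric] q_def [symmetric] by (subst Gauss_2F1_contiguous[OF c v]) simp
  also have "\<dots> = q * Gauss_2F1 (A + 1) B c v +
      B / (c * of_real x) * (- (of_real x * v) * (q * Gauss_2F1 (A + 1) (B + 1) (c + 1) v))"
    using x c0 by (simp add: field_simps)
  also have "- (of_real x * v) = of_real (t - x)"
    using x by (simp add: v_def field_simps)
  finally show ?thesis unfolding 1 by (simp only: Gauss_kernel_def q_def v_def)
qed

lemma Gauss_kernel_norm_contiguous_le:
  assumes c: "Re c > 0" and lA: "Re (l + A) > 0" and lB: "Re (l + B) > 0" and x: "x > 0"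
  shows "Gauss_kernel_norm x A B c l \<le> Gauss_kernel_norm x (A + 1) B c l +
    norm (B / (c * of_real x)) * Gauss_kernel_norm x (A + 1) (B + 1) (c + 1) (l - 1)"
proof -
  define f1 where "f1 = (\<lambda>t. indicat_real {x<..} t *\<^sub>R Gauss_kernel x (A + 1) B c l t)"
  define f2 where "f2 = (\<lambda>t. indicat_real {x<..} t *\<^sub>R Gauss_kernel x (A + 1) (B + 1) (c + 1) (l - 1) t)"
  have i1: "integrable lborel f1" and i2: "integrable lborel f2"
    using Gauss_kernel_integral(1)[of c l "A + 1" B x] Gauss_kernel_integral(1)[of "c + 1" "l - 1" "A + 1" "B + 1" x] assms
    by (simp_all add: f1_def f2_def set_integrable_def)
  have "Gauss_kernel_norm x A B c l \<le> (LINT t|lborel. norm (f1 t) + norm (B / (c * of_real x)) * norm (f2 t))"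
    unfolding Gauss_kernel_norm_def
  proof (rule integral_mono)
    show "integrable lborel (\<lambda>t. norm (indicat_real {x<..} t *\<^sub>R Gauss_kernel x A B c l t))"
      using Gauss_kernel_integral(1)[OF assms] unfolding set_integrable_def by (rule integrable_norm)
    show "integrable lborel (\<lambda>t. norm (f1 t) + norm (B / (c * of_real x)) * norm (f2 t))"
      using i1 i2 by (intro Bochner_Integration.integrable_add integrable_mult_right integrable_norm)
    fix t
    show "norm (indicat_real {x<..} t *\<^sub>R Gauss_kernel x A B c l t) \<le> norm (f1 t) + norm (B / (c * of_real x)) * norm (f2 t)"
    proof (cases "t > x")
      case True
      then have "indicat_real {x<..} t *\<^sub>R Gauss_kernel x A B c l t = f1 t + B / (c * of_real x) * f2 t"
        using Gauss_kernel_contiguous[OF c x True, of A B l] by (simp add: f1_def f2_def)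
      then show ?thesis
        by (simp only: norm_mult [symmetric] norm_triangle_ineq)
    qed (simp add: f1_def f2_def)
  qed
  also have "\<dots> = (LINT t|lborel. norm (f1 t)) + norm (B / (c * of_real x)) * (LINT t|lborel. norm (f2 t))"
    using i1 i2 by (subst Bochner_Integration.integral_add) (auto intro: integrable_norm)
  finally show ?thesis unfolding Gauss_kernel_norm_def f1_def f2_def .
qed

lemma norm_add_of_nat_ge:
  assumes "Re g > 0"
  shows "norm (g + of_nat k) \<ge> min 1 (Re g) * real (k + 1)"
proof -
  have "min 1 (Re g) * real (k + 1) = min 1 (Re g) * real k + min 1 (Re g)" by (simp add: algebra_simps)
  also have "\<dots> \<le> 1 * real k + Re g" by (intro add_mono mult_right_mono) auto
  also have "\<dots> = Re (g + of_nat k)" by simp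
  also have "\<dots> \<le> norm (g + of_nat k)" by (rule complex_Re_le_cmod)
  finally show ?thesis .
qed

text \<open>
  Induction on the number of steps that raise \<open>Re A\<close> to at least 1. In the second term of the
  contiguous relation \<open>l\<close> drops by one, which costs a factor \<open>k + 1\<close>; the coefficient \<open>B / (g + k)\<close>
  gains it back. The conditions on \<open>l + A\<close> and \<open>l + B\<close> remain true.
\<close>

lemma Gauss_kernel_norm_le:
  assumes "Re g > 0" and "Re (l + A) > 0" and "Re (l + B) > 0" and x: "x > 0"
  shows "\<exists>C>0. \<forall>k. Gauss_kernel_norm x A B (g + of_nat k) l \<le> C * real (k + 1) powr (- Re l)"
proof -
  have ind: "\<exists>C>0. \<forall>k. Gauss_kernel_norm x A B (g + of_nat k) l \<le> C * real (k + 1) powr (- Re l)"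
    if "Re g > 0" "Re (l + A) > 0" "Re (l + B) > 0" "Re A + real N \<ge> 1" for N g A B l
    using that
  proof (induction N arbitrary: g A B l)
    case 0
    then show ?case using x by (intro Gauss_kernel_norm_le_base) auto
  next
    case (Suc N)
    obtain C1 where C1: "C1 > 0" "\<forall>k. Gauss_kernel_norm x (A + 1) B (g + of_nat k) l \<le> C1 * real (k + 1) powr (- Re l)"
      using Suc.IH[of g l "A + 1" B] Suc.prems by auto
    obtain C2 where C2: "C2 > 0" "\<forall>k. Gauss_kernel_norm x (A + 1) (B + 1) (g + 1 + of_nat k) (l - 1) \<le> C2 * real (k + 1) powr (- Re (l - 1))"
      using Suc.IH[of "g + 1" "l - 1" "A + 1" "B + 1"] Suc.prems by auto
    define m where "m = min 1 (Re g)"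
    have m: "m > 0" using Suc.prems by (simp add: m_def)
    define D where "D = norm B / (m * x)"
    have D: "D \<ge> 0" using m x by (simp add: D_def)
    show ?case
    proof (intro exI[of _ "C1 + D * C2"] conjI allI)
      show "C1 + D * C2 > 0" using C1(1) C2(1) D by (simp add: add_pos_nonneg)
      fix k
      have gk: "Re (g + of_nat k) > 0" using Suc.prems by simp
      have ng: "norm (g + of_nat k) \<ge> m * real (k + 1)"
        unfolding m_def by (rule norm_add_of_nat_ge) (use Suc.prems in auto)
      have mk: "m * real (k + 1) > 0" using m by simp
      have "norm (B / ((g + of_nat k) * of_real x)) = norm B / (norm (g + of_nat k) * x)"
        using x by (simp add: norm_mult norm_divide)
      also have "\<dots> \<le> norm B / (m * real (k + 1) * x)"
        using less_le_trans[OF mk ng] m x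
        by (intro divide_left_mono mult_right_mono mult_pos_pos ng) auto
      also have "\<dots> = D * real (k + 1) powr (- 1)"
        by (simp add: D_def powr_minus field_simps)
      finally have nB: "norm (B / ((g + of_nat k) * of_real x)) \<le> D * real (k + 1) powr (- 1)" .
      have n0: "Gauss_kernel_norm x (A + 1) (B + 1) (g + 1 + of_nat k) (l - 1) \<ge> 0"
        by (simp add: Gauss_kernel_norm_def)
      have "Gauss_kernel_norm x A B (g + of_nat k) l \<le> Gauss_kernel_norm x (A + 1) B (g + of_nat k) l +
        norm (B / ((g + of_nat k) * of_real x)) * Gauss_kernel_norm x (A + 1) (B + 1) (g + of_nat k + 1) (l - 1)"
        by (rule Gauss_kernel_norm_contiguous_le) (use gk Suc.prems x in auto)
      also have "g + of_nat k + 1 = g + 1 + of_nat k" by simp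
      also have "Gauss_kernel_norm x (A + 1) B (g + of_nat k) l +
          norm (B / ((g + of_nat k) * of_real x)) * Gauss_kernel_norm x (A + 1) (B + 1) (g + 1 + of_nat k) (l - 1)
        \<le> C1 * real (k + 1) powr (- Re l) + (D * real (k + 1) powr (- 1)) * (C2 * real (k + 1) powr (- Re (l - 1)))"
        using C1(2) C2(2) nB n0 D by (intro add_mono mult_mono) auto
      also have "\<dots> = C1 * real (k + 1) powr (- Re l) + D * C2 * (real (k + 1) powr (- 1) * real (k + 1) powr (- Re (l - 1)))"
        by (simp only: mult_ac)
      also have "real (k + 1) powr (- 1) * real (k + 1) powr (- Re (l - 1)) = real (k + 1) powr (- Re l)"
        by (simp only: powr_add [symmetric]) simp
      finally show "Gauss_kernel_norm x A B (g + of_nat k) l \<le> (C1 + D * C2) * real (k + 1) powr (- Re l)"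
        by (simp add: algebra_simps)
    qed
  qed
  obtain N where "real N \<ge> 1 - Re A" using real_arch_simple by blast
  then show ?thesis using assms by (intro ind[of g l A B N]) auto
qed

section \<open>The fractional integral of a power\<close>

text \<open>
  The Appell function is a sum over \<open>k\<close> of Gauss functions, and with \<open>l = \<alpha> + \<rho> - \<gamma>\<close> the \<open>k\<close>-th summand
  of the integrand is \<open>Gauss_kernel\<close> with \<open>c = \<gamma> + k\<close>. The norms of the summands are of order
  at most \<open>k^(-1 - Re (\<rho> - \<beta>))\<close>: this is where \<open>Re \<rho> > Re \<beta>\<close> enters, while the other two bounds on \<open>\<rho>\<close> make
  the single summands integrable. The value is summed by Gauss's theorem with parameters
  \<open>\<alpha>, \<beta>; \<alpha> + \<rho>\<close>.
\<close>

theorem MSM_right_power: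
  fixes \<alpha> \<alpha>' \<beta> \<beta>' \<gamma> \<rho> :: complex and x :: real
  assumes \<gamma>: "Re \<gamma> > 0" and x: "x > 0"
    and \<rho>: "Re \<rho> > Re \<beta>" "Re \<rho> > Re (- \<alpha> - \<alpha>' + \<gamma>)" "Re \<rho> > Re (- \<alpha> - \<beta>' + \<gamma>)"
  shows "set_integrable lborel {x<..} (MSM_right_integrand \<alpha> \<alpha>' \<beta> \<beta>' \<gamma> (\<lambda>t. of_real t powr (- \<rho>)) x)" (is ?int)
    and "(LINT t:{x<..}|lborel. MSM_right_integrand \<alpha> \<alpha>' \<beta> \<beta>' \<gamma> (\<lambda>t. of_real t powr (- \<rho>)) x t) =
      Gamma \<gamma> * (Gamma (\<rho> - \<beta>) * Gamma (\<alpha> + \<alpha>' - \<gamma> + \<rho>) * Gamma (\<alpha> + \<beta>' - \<gamma> + \<rho>)) *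
      (rGamma \<rho> * rGamma (\<alpha> - \<beta> + \<rho>) * rGamma (\<alpha> + \<alpha>' + \<beta>' - \<gamma> + \<rho>)) *
      of_real x powr (\<gamma> - \<alpha> - \<rho>)" (is "?J = ?V")
proof -
  define l where "l = \<alpha> + \<rho> - \<gamma>"
  have lA: "Re (l + \<alpha>') > 0" and lB: "Re (l + \<beta>') > 0" using \<rho> by (auto simp: l_def)
  have c: "Re (\<gamma> + of_nat k) > 0" for k using \<gamma> by simp
  define d where "d = (\<lambda>k. pochhammer \<alpha> k * pochhammer \<beta> k / (pochhammer \<gamma> k * fact k))"
  define f where "f = (\<lambda>k t. d k * (indicat_real {x<..} t *\<^sub>R Gauss_kernel x \<alpha>' \<beta>' (\<gamma> + of_nat k) l t))"
  have fi: "integrable lborel (f k)" for k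
    unfolding f_def using Gauss_kernel_integral(1)[OF c lA lB x] unfolding set_integrable_def
    by (rule integrable_mult_right)
  have s: "summable (\<lambda>k. LINT t|lborel. norm (f k t))"
  proof -
    obtain C where C: "C > 0" "\<forall>k. Gauss_kernel_norm x \<alpha>' \<beta>' (\<gamma> + of_nat k) l \<le> C * real (k + 1) powr (- Re l)"
      using Gauss_kernel_norm_le[OF \<gamma> lA lB x] by blast
    obtain C1 where C1: "C1 > 0" "\<And>k j. norm (pochhammer (\<alpha> + of_nat k) j / pochhammer (\<gamma> + of_nat k) j) \<le>
       C1 * (real (k + j + 1) / real (k + 1)) powr Re (\<alpha> - \<gamma>)"
      using norm_pochhammer_ratio_le[OF \<gamma>] by blast
    obtain C2 where C2: "C2 > 0" "\<And>k. norm (pochhammer \<beta> k / fact k) \<le> C2 * real (k + 1) powr (Re \<beta> - 1)"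
      using norm_pochhammer_fact_le by blast
    have z: "Re (\<rho> - \<beta>) > 0" using \<rho> by simp
    show ?thesis
    proof (rule summable_comparison_test')
      show "summable (\<lambda>k. C1 * C2 * C * real (0 + k + 1) powr (- 1 - Re (\<rho> - \<beta>)))"
        by (intro summable_mult powr_tail_sum_le(1) z)
      fix k :: nat
      have 1: "norm (d k) \<le> (C1 * real (k + 1) powr (Re \<alpha> - Re \<gamma>)) * (C2 * real (k + 1) powr (Re \<beta> - 1))"
      proof -
        have "norm (d k) = norm (pochhammer \<alpha> k / pochhammer \<gamma> k) * norm (pochhammer \<beta> k / fact k)"
          by (simp add: d_def norm_mult norm_divide)
        also have "norm (pochhammer \<alpha> k / pochhammer \<gamma> k) \<le> C1 * real (k + 1) powr (Re \<alpha> - Re \<gamma>)"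
          using C1(2)[of 0 k] by simp
        then have "norm (pochhammer \<alpha> k / pochhammer \<gamma> k) * norm (pochhammer \<beta> k / fact k) \<le>
           (C1 * real (k + 1) powr (Re \<alpha> - Re \<gamma>)) * (C2 * real (k + 1) powr (Re \<beta> - 1))"
          using C1(1) by (intro mult_mono C2(2)) auto
        finally show ?thesis .
      qed
      have "norm (LINT t|lborel. norm (f k t)) = norm (d k) * Gauss_kernel_norm x \<alpha>' \<beta>' (\<gamma> + of_nat k) l"
        unfolding f_def norm_mult by (simp add: Gauss_kernel_norm_def abs_mult)
      also have "\<dots> \<le> ((C1 * real (k + 1) powr (Re \<alpha> - Re \<gamma>)) * (C2 * real (k + 1) powr (Re \<beta> - 1))) * (C * real (k + 1) powr (- Re l))"
        using 1 C1(1) C2(1) C(2) by (intro mult_mono) (auto simp: Gauss_kernel_norm_def)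
      also have "\<dots> = C1 * C2 * C * (real (k + 1) powr (Re \<alpha> - Re \<gamma>) * real (k + 1) powr (Re \<beta> - 1) * real (k + 1) powr (- Re l))"
        by (simp only: mult_ac)
      also have "real (k + 1) powr (Re \<alpha> - Re \<gamma>) * real (k + 1) powr (Re \<beta> - 1) * real (k + 1) powr (- Re l) = real (0 + k + 1) powr (- 1 - Re (\<rho> - \<beta>))"
        by (simp only: powr_add [symmetric]) (simp add: l_def algebra_simps)
      finally show "norm (LINT t|lborel. norm (f k t)) \<le> C1 * C2 * C * real (0 + k + 1) powr (- 1 - Re (\<rho> - \<beta>))" .
    qed
  qed
  define g where "g = (\<lambda>t. indicat_real {x<..} t *\<^sub>R MSM_right_integrand \<alpha> \<alpha>' \<beta> \<beta>' \<gamma> (\<lambda>t. of_real t powr (- \<rho>)) x t)"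
  define w :: "real \<Rightarrow> complex"
    where "w = (\<lambda>t. of_real (t - x) powr (\<gamma> - 1) * of_real t powr (- \<alpha>) * of_real t powr (- \<rho>))"
  define e where "e = (\<lambda>k t. pochhammer \<alpha> k * pochhammer \<beta> k / pochhammer \<gamma> k *
      (of_real (1 - x / t) ^ k / fact k) * Gauss_2F1 \<alpha>' \<beta>' (\<gamma> + of_nat k) (of_real (1 - t / x)))"
  have w0: "w t \<noteq> 0" if "t > x" for t using that x by (simp add: w_def)
  have fe: "f k t = indicat_real {x<..} t *\<^sub>R (w t * e k t)" for k t
  proof (cases "t > x")
    case True
    have t0: "t > 0" using True x by simp
    have "of_real (1 - x / t) ^ k = (of_real (t - x) ^ k * of_real t powr (- of_nat k) :: complex)"
    proof -
      have "of_real (1 - x / t) = (of_real (t - x) / of_real t :: complex)" using t0 by (simp add: field_simps)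
      moreover have "of_real t powr (- of_nat k) = inverse (of_real t ^ k :: complex)"
        using t0 by (subst powr_minus) (simp add: powr_nat)
      ultimately show ?thesis by (simp only: power_divide) (simp only: divide_inverse)
    qed
    also have "of_real (t - x) ^ k = (of_real (t - x) powr of_nat k :: complex)"
      using True by (subst powr_nat) auto
    finally have u: "of_real (1 - x / t) ^ k = (of_real (t - x) powr of_nat k * of_real t powr (- of_nat k) :: complex)" .
    have "w t * of_real (1 - x / t) ^ k = (of_real (t - x) powr (\<gamma> - 1) * of_real (t - x) powr of_nat k) *
      (of_real t powr (- \<alpha>) * of_real t powr (- \<rho>) * of_real t powr (- of_nat k))"
      unfolding w_def u by (simp only: mult_ac)
    also have "of_real (t - x) powr (\<gamma> - 1) * of_real (t - x) powr of_nat k = (of_real (t - x) powr (\<gamma> + of_nat k - 1) :: complex)"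
      by (simp only: powr_add [symmetric]) (simp add: algebra_simps)
    also have "of_real t powr (- \<alpha>) * of_real t powr (- \<rho>) * of_real t powr (- of_nat k) = (of_real t powr (- (\<gamma> + of_nat k) - l) :: complex)"
    proof -
      have "- \<alpha> + - \<rho> + - of_nat k = - (\<gamma> + of_nat k) - l" by (simp add: l_def)
      then show ?thesis by (simp only: powr_add [symmetric])
    qed
    finally have wu: "w t * of_real (1 - x / t) ^ k =
      of_real (t - x) powr (\<gamma> + of_nat k - 1) * of_real t powr (- (\<gamma> + of_nat k) - l)" .
    have "w t * e k t = d k * ((w t * of_real (1 - x / t) ^ k) * Gauss_2F1 \<alpha>' \<beta>' (\<gamma> + of_nat k) (of_real (1 - t / x)))"
      by (simp add: e_def d_def del: of_real_diff of_real_divide)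
    then show ?thesis using True unfolding wu by (simp add: f_def Gauss_kernel_def)
  qed (simp add: f_def)
  have g_eq: "g t = indicat_real {x<..} t *\<^sub>R (w t * (\<Sum>k. e k t))" for t
    by (simp add: g_def MSM_right_integrand_def Appell_F3_def w_def e_def mult_ac del: of_real_diff of_real_divide)
  have g_sum: "g t = (\<Sum>k. f k t)" if "summable (\<lambda>k. norm (f k t))" for t
  proof (cases "t > x")
    case True
    then have fe': "f k t = w t * e k t" for k by (simp add: fe)
    have "summable (\<lambda>k. w t * e k t)"
      using summable_norm_cancel[OF that] by (simp add: fe')
    then have "summable (\<lambda>k. e k t)" using w0[OF True] by (simp only: summable_cmult_iff simp_thms)
    then show ?thesis using True by (simp only: g_eq fe' suminf_mult) simp
  qed (simp add: g_eq fe)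
  \<comment> \<open>The series is known to agree with g almost everywhere only, and therefore measurability of g needs its own argument. The weight w may vanish outside {x<..}, but there both sides are 0.\<close>
  have gm: "g \<in> borel_measurable lborel"
  proof -
    have wm [measurable]: "w \<in> borel_measurable lborel" unfolding w_def by measurable
    have fm [measurable]: "f k \<in> borel_measurable lborel" for k using fi by auto
    have "g t = w t * (\<Sum>k. f k t * inverse (w t))" for t
    proof (cases "t > x")
      case True
      then show ?thesis using w0[OF True] by (simp add: g_eq fe field_simps)
    qed (simp add: g_eq fe)
    then have "g = (\<lambda>t. w t * (\<Sum>k. f k t * inverse (w t)))" by (rule ext)
    moreover have "(\<lambda>t. w t * (\<Sum>k. f k t * inverse (w t))) \<in> borel_measurable lborel"
      by measurable
    ultimately show ?thesis by simp
  qed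
  have ae: "AE t in lborel. g t = (\<Sum>k. f k t)"
    using sums_integral_of_summable_norms(1)[OF fi s] by eventually_elim (rule g_sum)
  have "integrable lborel g"
    by (rule integrable_cong_AE_imp[OF sums_integral_of_summable_norms(2)[OF fi s] gm])
       (use ae in eventually_elim, simp)
  then show ?int
    unfolding g_def set_integrable_def .
  define G where "G = Gamma \<gamma> * Gamma (l + \<alpha>') * Gamma (l + \<beta>') * rGamma (l + \<alpha>' + \<beta>') * of_real x powr (- l)"
  define u where "u = (\<lambda>k. Gauss_term \<alpha> \<beta> (\<alpha> + \<rho>) k)"
  have z: "Re (\<alpha> + \<rho> - \<alpha> - \<beta>) > 0" using \<rho> by simp
  have "u sums (Gamma (\<alpha> + \<rho> - \<alpha> - \<beta>) * rGamma (\<alpha> + \<rho> - \<alpha>) * rGamma (\<alpha> + \<rho> - \<beta>))"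
    using summable_sums[OF summable_norm_cancel[OF summable_Gauss_term[OF z]]] Gauss_sum_regularised[OF z]
    by (simp add: u_def)
  then have "(\<lambda>k. G * u k) sums (G * (Gamma (\<alpha> + \<rho> - \<alpha> - \<beta>) * rGamma (\<alpha> + \<rho> - \<alpha>) * rGamma (\<alpha> + \<rho> - \<beta>)))"
    by (rule sums_mult)
  moreover have "integral\<^sup>L lborel (f k) = G * u k" for k
  proof -
    have np: "\<gamma> \<notin> \<int>\<^sub>\<le>\<^sub>0" "\<gamma> + of_nat k \<notin> \<int>\<^sub>\<le>\<^sub>0" using \<gamma> c[of k] by (auto dest!: Re_pos_not_nonpos_Int simp del: plus_complex.simps)
    have "integral\<^sup>L lborel (f k) = d k * (LINT t:{x<..}|lborel. Gauss_kernel x \<alpha>' \<beta>' (\<gamma> + of_nat k) l t)"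
      by (simp only: f_def set_lebesgue_integral_def integral_mult_right_zero)
    also have "\<dots> = d k * (Gamma (\<gamma> + of_nat k) * Gamma (l + \<alpha>') * Gamma (l + \<beta>') * rGamma (\<gamma> + of_nat k + l) * rGamma (l + \<alpha>' + \<beta>') * of_real x powr (- l))"
      by (simp only: Gauss_kernel_integral(2)[OF c lA lB x])
    also have "\<gamma> + of_nat k + l = \<alpha> + \<rho> + of_nat k" by (simp add: l_def)
    also have "Gamma (\<gamma> + of_nat k) = pochhammer \<gamma> k * Gamma \<gamma>"
      using np by (simp add: pochhammer_Gamma Gamma_eq_zero_iff)
    also have "d k * (pochhammer \<gamma> k * Gamma \<gamma> * Gamma (l + \<alpha>') * Gamma (l + \<beta>') * rGamma (\<alpha> + \<rho> + of_nat k) * rGamma (l + \<alpha>' + \<beta>') * of_real x powr (- l)) = G * u k"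
    proof -
      have "pochhammer \<gamma> k \<noteq> 0" using np by (simp add: pochhammer_Gamma Gamma_eq_zero_iff)
      then have "d k * pochhammer \<gamma> k = pochhammer \<alpha> k * pochhammer \<beta> k / fact k" by (simp add: d_def)
      then have "G * u k = Gamma \<gamma> * Gamma (l + \<alpha>') * Gamma (l + \<beta>') * rGamma (l + \<alpha>' + \<beta>') * of_real x powr (- l) * ((d k * pochhammer \<gamma> k) * rGamma (\<alpha> + \<rho> + of_nat k))"
        by (simp only: G_def u_def)
      then show ?thesis by (simp only: mult_ac)
    qed
    finally show ?thesis .
  qed
  then have "(\<lambda>k. G * u k) sums (LINT t|lborel. (\<Sum>k. f k t))"
    using sums_integral_of_summable_norms(3)[OF fi s] by simp
  ultimately have val: "(LINT t|lborel. (\<Sum>k. f k t)) = G * (Gamma (\<alpha> + \<rho> - \<alpha> - \<beta>) * rGamma (\<alpha> + \<rho> - \<alpha>) * rGamma (\<alpha> + \<rho> - \<beta>))"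
    by (rule sums_unique2 [symmetric])
  have "integral\<^sup>L lborel g = (LINT t|lborel. (\<Sum>k. f k t))"
    using gm sums_integral_of_summable_norms(2)[OF fi s] ae by (intro integral_cong_AE) auto
  also note val
  also have "G * (Gamma (\<alpha> + \<rho> - \<alpha> - \<beta>) * rGamma (\<alpha> + \<rho> - \<alpha>) * rGamma (\<alpha> + \<rho> - \<beta>)) =
     ?V"
  proof -
    have "l + \<alpha>' = \<alpha> + \<alpha>' - \<gamma> + \<rho>" "l + \<beta>' = \<alpha> + \<beta>' - \<gamma> + \<rho>" "l + \<alpha>' + \<beta>' = \<alpha> + \<alpha>' + \<beta>' - \<gamma> + \<rho>"
      "- l = \<gamma> - \<alpha> - \<rho>" "\<alpha> + \<rho> - \<alpha> - \<beta> = \<rho> - \<beta>" "\<alpha> + \<rho> - \<alpha> = \<rho>" "\<alpha> + \<rho> - \<beta> = \<alpha> - \<beta> + \<rho>"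
      by (simp_all add: l_def)
    then show ?thesis unfolding G_def by (simp only: mult_ac)
  qed
  finally show "?J = ?V"
    unfolding g_def set_lebesgue_integral_def .
qed

section \<open>The gamma function on vertical lines\<close>

lemma nonpos_Ints_imp_Re_Im: "z \<in> \<int>\<^sub>\<le>\<^sub>0 \<Longrightarrow> Re z \<le> 0 \<and> Im z = 0" for z :: complex
  by (auto elim!: nonpos_Ints_cases)

text \<open>
  Weighted arithmetic-geometric mean of the squares: \<open>(1 - s) \<bar>z\<bar>^2 + s \<bar>z + 1\<bar>^2\<close> exceeds
  \<open>\<bar>z + s\<bar>^2\<close> by the variance \<open>s (1 - s) \<le> 1/4\<close> only.
\<close>

lemma norm_interpolation_le:
  fixes z :: complex and s :: real
  assumes s: "0 \<le> s" "s \<le> 1" and "z \<noteq> 0" "z + 1 \<noteq> 0"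
  shows "norm z powr (1 - s) * norm (z + 1) powr s \<le> sqrt ((norm (z + of_real s))\<^sup>2 + 1 / 4)"
proof -
  have "(norm z powr (1 - s) * norm (z + 1) powr s)\<^sup>2 =
      ((norm z)\<^sup>2) powr (1 - s) * ((norm (z + 1))\<^sup>2) powr s"
    by (simp add: power_mult_distrib power2_eq_square powr_mult)
  also have "\<dots> \<le> (1 - s) * (norm z)\<^sup>2 + s * (norm (z + 1))\<^sup>2"
    using assms by (intro Youngs_inequality_0) auto
  also have "\<dots> = (norm (z + of_real s))\<^sup>2 + s * (1 - s)"
    unfolding cmod_power2 by (simp add: power2_eq_square algebra_simps)
  also have "s * (1 - s) \<le> 1 / 4"
    using sum_squares_ge_zero[of "s - 1 / 2" 0] by (simp add: algebra_simps)
  finally show ?thesis by (intro real_le_rsqrt) auto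
qed

text \<open>
  The excess 1/4 in the previous lemma is a relative error of order \<open>m^(-2)\<close> in the \<open>m\<close>-th factor.
  It is bounded by a difference of consecutive reciprocals, so the errors multiply to at most \<open>exp 1\<close>.
\<close>

lemma norm_pochhammer_interpolation_le:
  fixes z :: complex and s :: real
  assumes s: "0 \<le> s" "s \<le> 1" and z: "Re z \<ge> 1 / 2"
  shows "norm (pochhammer z m) powr (1 - s) * norm (pochhammer (z + 1) m) powr s \<le>
    norm (pochhammer (z + of_real s) m) * exp (1 - 1 / (real m + 1))"
proof (induction m)
  case 0
  then show ?case by simp
next
  case (Suc m)
  define N where "N = norm (z + of_nat m + of_real s)"
  define e where "e = 1 / (real m + 1) - 1 / (real m + 2)"
  have N: "N \<ge> real m + 1 / 2"
  proof -
    have "real m + 1 / 2 \<le> Re (z + of_nat m + of_real s)" using z s by simp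
    also have "\<dots> \<le> N" unfolding N_def by (rule complex_Re_le_cmod)
    finally show ?thesis .
  qed
  have nz: "z + of_nat m \<noteq> 0" "z + of_nat m + 1 \<noteq> 0"
    using z by (auto simp: complex_eq_iff)
  have e: "e = 1 / ((real m + 1) * (real m + 2))" by (simp add: e_def divide_simps)
  have "1 / 4 \<le> 2 * e * (real m + 1 / 2)\<^sup>2"
    unfolding e by (simp add: divide_simps power2_eq_square) (simp add: algebra_simps)
  also have "\<dots> \<le> 2 * e * N\<^sup>2"
    using N e by (intro mult_left_mono power_mono) auto
  finally have "N\<^sup>2 + 1 / 4 \<le> N\<^sup>2 * (1 + 2 * e)" by (simp add: algebra_simps)
  also have "\<dots> \<le> N\<^sup>2 * exp (2 * e)" by (intro mult_left_mono exp_ge_add_one_self) auto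
  also have "\<dots> = (N * exp e)\<^sup>2" by (simp add: power_mult_distrib exp_double)
  finally have "sqrt (N\<^sup>2 + 1 / 4) \<le> N * exp e"
    using N by (intro real_le_lsqrt) auto
  then have step: "norm (z + of_nat m) powr (1 - s) * norm (z + of_nat m + 1) powr s \<le> N * exp e"
    using norm_interpolation_le[OF s nz] unfolding N_def by linarith
  have "norm (pochhammer z (Suc m)) powr (1 - s) * norm (pochhammer (z + 1) (Suc m)) powr s =
    (norm (pochhammer z m) powr (1 - s) * norm (pochhammer (z + 1) m) powr s) *
    (norm (z + of_nat m) powr (1 - s) * norm (z + of_nat m + 1) powr s)"
    by (simp add: pochhammer_Suc norm_mult powr_mult add_ac mult_ac)
  also have "\<dots> \<le> (norm (pochhammer (z + of_real s) m) * exp (1 - 1 / (real m + 1))) * (N * exp e)"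
    by (intro mult_mono Suc.IH step) auto
  also have "\<dots> = norm (pochhammer (z + of_real s) (Suc m)) * (exp (1 - 1 / (real m + 1)) * exp e)"
    by (simp add: pochhammer_Suc norm_mult N_def add_ac mult_ac)
  also have "exp (1 - 1 / (real m + 1)) * exp e = exp (1 - 1 / (real (Suc m) + 1))"
    by (simp add: exp_add [symmetric] e_def add_ac)
  finally show ?case .
qed

text \<open>
  In Gauss's product the factorial and the power of \<open>n\<close> interpolate exactly between \<open>z\<close> and \<open>z + 1\<close>,
  so the previous estimate passes to the limit; the functional equation removes the value at \<open>z + 1\<close>.
  That the constant does not depend on \<open>Im z\<close> is the point.
\<close>

lemma norm_Gamma_interpolation_le:
  fixes z :: complex and s :: real
  assumes s: "0 \<le> s" "s \<le> 1" and z: "Re z \<ge> 1 / 2"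
  shows "norm (Gamma (z + of_real s)) \<le> exp 1 * (norm (Gamma z) * norm z powr s)"
proof -
  have np: "z \<notin> \<int>\<^sub>\<le>\<^sub>0" "z + 1 \<notin> \<int>\<^sub>\<le>\<^sub>0" "z + of_real s \<notin> \<int>\<^sub>\<le>\<^sub>0"
    using z s by (auto dest!: nonpos_Ints_imp_Re_Im)
  have "norm (rGamma z) powr (1 - s) * norm (rGamma (z + 1)) powr s \<le> exp 1 * norm (rGamma (z + of_real s))"
  proof (rule tendsto_le)
    show "((\<lambda>n. norm (rGamma_series z n) powr (1 - s) * norm (rGamma_series (z + 1) n) powr s) \<longlongrightarrow>
        norm (rGamma z) powr (1 - s) * norm (rGamma (z + 1)) powr s) sequentially"
      using np by (intro tendsto_intros tendsto_powr) (auto simp: rGamma_eq_zero_iff)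
    show "((\<lambda>n. exp 1 * norm (rGamma_series (z + of_real s) n)) \<longlongrightarrow> exp 1 * norm (rGamma (z + of_real s))) sequentially"
      by (intro tendsto_intros)
    show "eventually (\<lambda>n. norm (rGamma_series z n) powr (1 - s) * norm (rGamma_series (z + 1) n) powr s
        \<le> exp 1 * norm (rGamma_series (z + of_real s) n)) sequentially"
    proof (intro always_eventually allI)
      fix n
      define D where "D = (\<lambda>x. fact n * exp (x * ln (real n)))"
      have D: "D x > 0" for x by (simp add: D_def)
      have nr: "norm (rGamma_series w n) = norm (pochhammer w (n + 1)) / D (Re w)" for w :: complex
        by (simp add: rGamma_series_def norm_mult norm_divide D_def)
      have Dx: "D x powr (1 - s) * D (x + 1) powr s = D (x + s)" for x
      proof -
        have "D y = exp (ln (fact n) + y * ln (real n))" for y by (simp add: D_def exp_add)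
        then show ?thesis by (simp add: powr_def exp_add [symmetric] algebra_simps)
      qed
      have "norm (rGamma_series z n) powr (1 - s) * norm (rGamma_series (z + 1) n) powr s =
        (norm (pochhammer z (n + 1)) powr (1 - s) * norm (pochhammer (z + 1) (n + 1)) powr s) / D (Re z + s)"
        unfolding nr Dx [symmetric] using D by (simp add: powr_divide less_imp_le)
      also have "\<dots> \<le> (norm (pochhammer (z + of_real s) (n + 1)) * exp (1 - 1 / (real (n + 1) + 1))) / D (Re z + s)"
        using D[of "Re z + s"] by (intro divide_right_mono norm_pochhammer_interpolation_le assms) auto
      also have "\<dots> = norm (rGamma_series (z + of_real s) n) * exp (1 - 1 / (real (n + 1) + 1))"
        by (simp add: nr)
      also have "\<dots> \<le> norm (rGamma_series (z + of_real s) n) * exp 1"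
        by (intro mult_left_mono) auto
      finally show "norm (rGamma_series z n) powr (1 - s) * norm (rGamma_series (z + 1) n) powr s
        \<le> exp 1 * norm (rGamma_series (z + of_real s) n)" by (simp add: mult.commute)
    qed
  qed simp
  moreover have "norm (rGamma z) = norm z * norm (rGamma (z + 1))"
    by (metis norm_mult rGamma_plus1)
  ultimately have *: "norm (rGamma z) powr (1 - s) * (norm (rGamma z) / norm z) powr s \<le> exp 1 * norm (rGamma (z + of_real s))"
    using np by (auto simp: field_simps)
  have "norm (rGamma z) powr (1 - s) * (norm (rGamma z) / norm z) powr s = norm (rGamma z) / norm z powr s"
    by (simp add: powr_divide powr_add [symmetric])
  with * have **: "norm (rGamma z) / norm z powr s \<le> exp 1 * norm (rGamma (z + of_real s))" by simp
  have "norm (rGamma z) > 0" "norm (rGamma (z + of_real s)) > 0" "norm z > 0"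
    using np by (auto simp: rGamma_eq_zero_iff)
  then show ?thesis
    using ** by (simp add: Gamma_def norm_divide field_simps)
qed

lemma norm_Gamma_plus1:
  fixes z :: complex
  assumes "Im z \<noteq> 0"
  shows "norm (Gamma (z + 1)) = norm z * norm (Gamma z)"
  using assms by (subst Gamma_plus1) (auto dest: nonpos_Ints_imp_Re_Im simp: norm_mult)

text \<open>
  Here \<open>1 - z\<close> is the complex conjugate of \<open>z\<close>, and the reflection formula gives
  \<open>\<bar>\<Gamma>(z)\<bar>^2 = \<pi> / cosh (\<pi> t)\<close>.
\<close>

lemma norm_Gamma_half_le: "norm (Gamma (Complex (1 / 2) t)) \<le> sqrt (2 * pi) * exp (- (pi * abs t / 2))"
proof -
  define z where "z = Complex (1 / 2) t"
  have "1 - z = cnj z" by (simp add: z_def complex_eq_iff)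
  then have "Gamma z * cnj (Gamma z) = of_real pi / sin (of_real pi * z)"
    using Gamma_reflection_complex[of z] by (simp add: cnj_Gamma)
  moreover have "sin (of_real pi * z) = of_real (cosh (pi * t))"
    by (simp add: z_def complex_eq_iff Re_sin Im_sin cosh_def sinh_def)
  ultimately have "of_real ((norm (Gamma z))\<^sup>2) = (of_real (pi / cosh (pi * t)) :: complex)"
    by (simp add: complex_norm_square [symmetric] del: of_real_power)
  then have "(norm (Gamma z))\<^sup>2 = pi / cosh (pi * t)"
    by (simp only: of_real_eq_iff)
  also have "cosh (pi * t) \<ge> exp (pi * abs t) / 2"
    by (cases "t \<ge> 0") (auto simp: cosh_def)
  then have "pi / cosh (pi * t) \<le> pi / (exp (pi * abs t) / 2)"
    by (intro divide_left_mono) auto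
  also have "\<dots> = (sqrt (2 * pi) * exp (- (pi * abs t / 2)))\<^sup>2"
    by (simp add: power_mult_distrib exp_double [symmetric] exp_minus field_simps)
  finally show ?thesis unfolding z_def [symmetric]
    by (rule power2_le_imp_le) auto
qed

lemma norm_Gamma_le_away_from_axis:
  "\<exists>C>0. \<forall>t. (abs t) \<ge> 1 \<longrightarrow>
     norm (Gamma (Complex r t)) \<le> C * abs t powr (r - 1 / 2) * exp (- (pi * abs t / 2))"
proof -
  define B where "B = (\<lambda>r. \<exists>C>0. \<forall>t. (abs t) \<ge> 1 \<longrightarrow>
     norm (Gamma (Complex r t)) \<le> C * abs t powr (r - 1 / 2) * exp (- (pi * abs t / 2)))"
  have strip: "B (1 / 2 + s)" if s: "0 \<le> s" "s \<le> 1" for s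
    unfolding B_def
  proof (intro exI[of _ "exp 1 * sqrt (2 * pi) * 2"] conjI allI impI)
    fix t :: real assume t: "abs t \<ge> 1"
    have "norm (Complex (1 / 2) t) \<le> 1 / 2 + abs t" using cmod_le[of "Complex (1/2) t"] by simp
    also have "\<dots> \<le> 2 * abs t" using t by simp
    finally have "norm (Complex (1 / 2) t) powr s \<le> (2 * abs t) powr s" using s by (intro powr_mono2) auto
    also have "\<dots> = 2 powr s * abs t powr s" by (simp add: powr_mult)
    also have "\<dots> \<le> 2 powr 1 * abs t powr s" using s by (intro mult_right_mono powr_mono) auto
    finally have 1: "norm (Complex (1 / 2) t) powr s \<le> 2 * abs t powr s" by simp
    have "Complex (1 / 2 + s) t = Complex (1 / 2) t + of_real s" by (simp add: complex_eq_iff)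
    then have "norm (Gamma (Complex (1 / 2 + s) t)) \<le>
       exp 1 * (norm (Gamma (Complex (1 / 2) t)) * norm (Complex (1 / 2) t) powr s)"
      using norm_Gamma_interpolation_le[OF s, of "Complex (1 / 2) t"] by simp
    also have "\<dots> \<le> exp 1 * ((sqrt (2 * pi) * exp (- (pi * abs t / 2))) * (2 * abs t powr s))"
      by (intro mult_left_mono mult_mono norm_Gamma_half_le 1) auto
    finally show "norm (Gamma (Complex (1 / 2 + s) t)) \<le>
       exp 1 * sqrt (2 * pi) * 2 * abs t powr (1 / 2 + s - 1 / 2) * exp (- (pi * abs t / 2))"
      by (simp add: mult_ac)
  qed simp
  have up: "B (r + 1)" if Br: "B r" for r
  proof -
    obtain C where C: "C > 0" "\<And>t. (abs t) \<ge> 1 \<Longrightarrow>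
        norm (Gamma (Complex r t)) \<le> C * abs t powr (r - 1 / 2) * exp (- (pi * abs t / 2))"
      using Br unfolding B_def by blast
    show ?thesis unfolding B_def
    proof (intro exI[of _ "((abs r) + 1) * C"] conjI allI impI)
      show "((abs r) + 1) * C > 0" using C by (simp add: add_nonneg_pos)
      fix t :: real assume t: "abs t \<ge> 1"
      have nz: "Complex r t \<noteq> 0" using t by (auto simp: complex_eq_iff)
      have "norm (Complex r t) \<le> (abs r) + abs t" using cmod_le[of "Complex r t"] by simp
      also have "\<dots> \<le> ((abs r) + 1) * abs t" using t mult_left_mono[of 1 "abs t" "abs r"] by (simp add: algebra_simps)
      finally have 1: "norm (Complex r t) \<le> ((abs r) + 1) * abs t" .
      have "Complex (r + 1) t = Complex r t + 1" by (simp add: complex_eq_iff)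
      then have "norm (Gamma (Complex (r + 1) t)) = norm (Complex r t) * norm (Gamma (Complex r t))"
        using t norm_Gamma_plus1[of "Complex r t"] by auto
      also have "\<dots> \<le> (((abs r) + 1) * abs t) * (C * abs t powr (r - 1 / 2) * exp (- (pi * abs t / 2)))"
        by (intro mult_mono 1 C t) auto
      also have "\<dots> = ((abs r) + 1) * C * ((abs t) powr 1 * abs t powr (r - 1 / 2)) * exp (- (pi * abs t / 2))"
        by (simp add: mult_ac)
      also have "abs t powr 1 * abs t powr (r - 1 / 2) = (abs t) powr (r + 1 - 1 / 2)"
        by (simp only: powr_add [symmetric]) (simp add: algebra_simps)
      finally show "norm (Gamma (Complex (r + 1) t)) \<le>
         ((abs r) + 1) * C * abs t powr (r + 1 - 1 / 2) * exp (- (pi * abs t / 2))" .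
    qed
  qed
  have down: "B r" if Br: "B (r + 1)" for r
  proof -
    obtain C where C: "C > 0" "\<And>t. (abs t) \<ge> 1 \<Longrightarrow>
        norm (Gamma (Complex (r + 1) t)) \<le> C * abs t powr (r + 1 - 1 / 2) * exp (- (pi * abs t / 2))"
      using Br unfolding B_def by blast
    show ?thesis unfolding B_def
    proof (intro exI[of _ C] conjI allI impI)
      fix t :: real assume t: "abs t \<ge> 1"
      have "abs t \<le> norm (Complex r t)" using abs_Im_le_cmod[of "Complex r t"] by simp
      then have "abs t * norm (Gamma (Complex r t)) \<le> norm (Complex r t) * norm (Gamma (Complex r t))"
        by (intro mult_right_mono) auto
      also have "Complex (r + 1) t = Complex r t + 1" by (simp add: complex_eq_iff)
      then have "norm (Complex r t) * norm (Gamma (Complex r t)) = norm (Gamma (Complex (r + 1) t))"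
        using t norm_Gamma_plus1[of "Complex r t"] by auto
      also have "\<dots> \<le> C * abs t powr (1 + (r - 1 / 2)) * exp (- (pi * abs t / 2))"
        using C(2)[OF t] by (simp add: algebra_simps)
      also have "\<dots> = (abs t) * (C * abs t powr (r - 1 / 2) * exp (- (pi * abs t / 2)))"
        by (subst powr_add) (simp add: mult_ac)
      finally show "norm (Gamma (Complex r t)) \<le> C * abs t powr (r - 1 / 2) * exp (- (pi * abs t / 2))"
        using t by (subst (asm) mult_le_cancel_left_pos) auto
    qed (fact C)
  qed
  define k where "k = \<lfloor>r - 1 / 2\<rfloor>"
  define s where "s = r - 1 / 2 - of_int k"
  have s: "0 \<le> s" "s \<le> 1" unfolding s_def k_def by linarith+
  have ups: "B (1 / 2 + s + of_nat n)" for n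
  proof (induction n)
    case 0
    show ?case using strip[OF s] by simp
  next
    case (Suc n)
    have "1 / 2 + s + of_nat (Suc n) = (1 / 2 + s + of_nat n) + 1" by simp
    then show ?case by (simp only: up[OF Suc])
  qed
  have downs: "B (1 / 2 + s - of_nat n)" for n
  proof (induction n)
    case 0
    show ?case using strip[OF s] by simp
  next
    case (Suc n)
    have "1 / 2 + s - of_nat n = (1 / 2 + s - of_nat (Suc n)) + 1" by simp
    with Suc have "B ((1 / 2 + s - of_nat (Suc n)) + 1)" by (simp only:)
    then show ?case by (rule down)
  qed
  have "B r"
  proof (cases "k \<ge> 0")
    case True
    then have "1 / 2 + s + of_nat (nat k) = r" by (simp add: s_def)
    then show ?thesis using ups[of "nat k"] by (simp only:)
  next
    case False
    then have "1 / 2 + s - of_nat (nat (- k)) = r" by (simp add: s_def)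
    then show ?thesis using downs[of "nat (- k)"] by (simp only:)
  qed
  then show ?thesis unfolding B_def .
qed

text \<open>
  By the reflection formula a lower bound for \<open>\<Gamma>(z)\<close> amounts to an upper bound for \<open>\<Gamma>(1 - z)\<close>.
\<close>

lemma norm_rGamma_le_away_from_axis:
  "\<exists>C>0. \<forall>t. (abs t) \<ge> 1 \<longrightarrow>
     norm (rGamma (Complex r t)) \<le> C * abs t powr (1 / 2 - r) * exp (pi * abs t / 2)"
proof -
  obtain C where C: "C > 0" "\<forall>t. (abs t) \<ge> 1 \<longrightarrow>
      norm (Gamma (Complex (1 - r) t)) \<le> C * abs t powr (1 - r - 1 / 2) * exp (- (pi * abs t / 2))"
    using norm_Gamma_le_away_from_axis[of "1 - r"] by blast
  show ?thesis
  proof (intro exI[of _ "C / pi"] conjI allI impI)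
    show "C / pi > 0" using C by simp
    fix t :: real assume t: "abs t \<ge> 1"
    define z where "z = Complex r t"
    have z1: "1 - z = Complex (1 - r) (- t)" by (simp add: z_def complex_eq_iff)
    have np: "1 - z \<notin> \<int>\<^sub>\<le>\<^sub>0" using t by (auto simp: z1 dest!: nonpos_Ints_imp_Re_Im)
    have "rGamma z = sin (of_real pi * z) / of_real pi * Gamma (1 - z)"
      using rGamma_reflection_complex[of z] np
      by (auto simp: Gamma_def rGamma_eq_zero_iff field_simps)
    then have "norm (rGamma z) = norm (sin (of_real pi * z)) / pi * norm (Gamma (1 - z))"
      by (simp add: norm_mult norm_divide)
    also have "\<dots> \<le> exp (pi * abs t) / pi * (C * abs t powr (1 - r - 1 / 2) * exp (- (pi * abs t / 2)))"
    proof (intro mult_mono divide_right_mono)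
      show "norm (sin (of_real pi * z)) \<le> exp (pi * abs t)"
        using cmod_sin_le_exp[of 1 "of_real pi * z"] by (simp add: z_def abs_mult)
      show "norm (Gamma (1 - z)) \<le> C * abs t powr (1 - r - 1 / 2) * exp (- (pi * abs t / 2))"
        using C(2)[rule_format, of "- t"] t by (simp add: z1)
    qed auto
    also have "\<dots> = C / pi * abs t powr (1 / 2 - r) * (exp (pi * abs t) * exp (- (pi * abs t / 2)))"
      by simp
    also have "exp (pi * abs t) * exp (- (pi * abs t / 2)) = exp (pi * abs t / 2)"
      by (simp add: exp_add [symmetric])
    finally show "norm (rGamma (Complex r t)) \<le> C / pi * abs t powr (1 / 2 - r) * exp (pi * abs t / 2)"
      by (simp add: z_def)
  qed
qed

lemma powr_le_of_comparable:
  fixes T X :: real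
  assumes "c1 > 0" "X > 0" "c1 * X \<le> T" "T \<le> c2 * X"
  shows "T powr e \<le> max (c1 powr e) (c2 powr e) * X powr e"
proof -
  have T: "0 < c1 * X" "0 < T" using assms by (auto intro: less_le_trans[OF mult_pos_pos])
  have c2: "c2 > 0" using assms T by (meson less_le_trans zero_less_mult_pos2)
  show ?thesis
  proof (cases "e \<ge> 0")
    case True
    then have "T powr e \<le> (c2 * X) powr e" using assms T by (intro powr_mono2) auto
    also have "\<dots> = c2 powr e * X powr e" using assms c2 by (simp add: powr_mult)
    also have "\<dots> \<le> max (c1 powr e) (c2 powr e) * X powr e" by (intro mult_right_mono) auto
    finally show ?thesis .
  next
    case False
    then have "T powr e \<le> (c1 * X) powr e" using assms T by (intro powr_mono2') auto
    also have "\<dots> = c1 powr e * X powr e" using assms by (simp add: powr_mult)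
    also have "\<dots> \<le> max (c1 powr e) (c2 powr e) * X powr e" by (intro mult_right_mono) auto
    finally show ?thesis .
  qed
qed

lemma bound_from_tail_bound:
  fixes h g :: "real \<Rightarrow> real"
  assumes "continuous_on UNIV h" "continuous_on UNIV g" and g: "\<And>y. g y > 0"
    and tail: "\<And>y. (abs y) \<ge> R \<Longrightarrow> h y \<le> C * g y"
  shows "\<exists>C>0. \<forall>y. h y \<le> C * g y"
proof -
  have "continuous_on {-R..R} (\<lambda>y. h y / g y)"
    using assms(1,2) g by (intro continuous_on_divide continuous_on_subset[OF assms(1)] continuous_on_subset[OF assms(2)])
      (auto simp: less_imp_neq [symmetric])
  then have "bounded ((\<lambda>y. h y / g y) ` {-R..R})"
    by (intro compact_imp_bounded compact_continuous_image) auto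
  then obtain B where B: "\<forall>y\<in>{-R..R}. norm (h y / g y) \<le> B"
    unfolding bounded_iff by auto
  show ?thesis
  proof (intro exI[of _ "max 1 (max B C)"] conjI allI)
    fix y
    show "h y \<le> max 1 (max B C) * g y"
    proof (cases "abs y \<ge> R")
      case True
      have "C * g y \<le> max 1 (max B C) * g y" using g[of y] by (intro mult_right_mono) auto
      with tail[OF True] show ?thesis by linarith
    next
      case False
      then have "y \<in> {-R..R}" by auto
      with B have "norm (h y / g y) \<le> B" by blast
      then have "h y / g y \<le> B" unfolding real_norm_def by (rule abs_le_D1)
      then have "h y \<le> B * g y" using g[of y] by (simp add: field_simps)
      also have "\<dots> \<le> max 1 (max B C) * g y" using g[of y] by (intro mult_right_mono) auto
      finally show ?thesis .
    qed
  qed simp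
qed

abbreviation vertical_line :: "complex \<Rightarrow> real \<Rightarrow> real \<Rightarrow> complex" where
  "vertical_line c d y \<equiv> c + of_real d * (\<i> * of_real y)"

text \<open>
  The point \<open>c + i d y\<close> has imaginary part \<open>Im c + d y\<close>; replacing it by \<open>d y\<close> changes the bounds by
  constant factors, and the bounded part of the line is harmless by continuity.
\<close>

lemma norm_le_along_imaginary_axis:
  fixes F :: "complex \<Rightarrow> complex" and c :: complex and d :: real
  assumes d: "d \<noteq> 0" and "C > 0"
    and F: "\<And>t. (abs t) \<ge> 1 \<Longrightarrow> norm (F (Complex (Re c) t)) \<le> C * abs t powr e * exp (b * abs t)"
    and cont: "continuous_on UNIV (\<lambda>y. F (vertical_line c d y))"
  shows "\<exists>C>0. \<forall>y. norm (F (vertical_line c d y)) \<le>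
            C * ((1 + abs y) powr e * exp (b * abs d * abs y))"
proof (rule bound_from_tail_bound)
  show "continuous_on UNIV (\<lambda>y. norm (F (vertical_line c d y)))"
    by (intro continuous_intros cont)
  show "continuous_on UNIV (\<lambda>y. (1 + abs y) powr e * exp (b * abs d * abs y))"
    by (intro continuous_intros) (auto simp: add_nonneg_eq_0_iff)
  show "(1 + abs y) powr e * exp (b * abs d * abs y) > 0" for y :: real
    by (simp add: add_pos_nonneg less_imp_neq [symmetric])
  define K where "K = max (((abs d) / 2) powr e) (((abs (Im c)) + abs d) powr e)"
  fix y :: real
  assume "abs y \<ge> (2 * (abs (Im c)) + 2 + abs d) / (abs d)"
  then have y: "abs d * abs y \<ge> 2 * (abs (Im c)) + 2 + abs d"
    using d by (simp add: field_simps)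
  define t where "t = Im c + d * y"
  have t1: "abs t \<ge> (abs d) * abs y - (abs (Im c))" and t2: "abs t \<le> (abs d) * abs y + (abs (Im c))"
    unfolding t_def abs_mult [symmetric] by linarith+
  have "abs t \<ge> 1" using t1 y by linarith
  have w: "vertical_line c d y = Complex (Re c) t"
    by (simp add: t_def complex_eq_iff)
  have "abs d / 2 * (1 + abs y) \<le> (abs t)"
    using t1 y by (simp add: algebra_simps)
  moreover have "abs t \<le> ((abs (Im c)) + abs d) * (1 + abs y)"
  proof -
    have "((abs (Im c)) + abs d) * (1 + abs y) = (abs d) * abs y + (abs (Im c)) + ((abs d) + (abs (Im c)) * abs y)"
      by (simp add: algebra_simps)
    moreover have "abs d + (abs (Im c)) * abs y \<ge> 0" by simp
    ultimately show ?thesis using t2 by linarith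
  qed
  ultimately have 1: "abs t powr e \<le> K * (1 + abs y) powr e"
    using d unfolding K_def by (intro powr_le_of_comparable) auto
  have "b * ((abs t) - abs d * abs y) \<le> (abs b) * \<bar>(abs t) - abs d * abs y\<bar>"
    by (metis abs_ge_self abs_mult)
  also have "\<bar>(abs t) - abs d * abs y\<bar> \<le> (abs (Im c))" using t1 t2 by linarith
  then have "abs b * \<bar>(abs t) - abs d * abs y\<bar> \<le> (abs b) * (abs (Im c))" by (intro mult_left_mono) auto
  finally have "exp (b * abs t) \<le> exp (b * abs d * abs y + abs b * (abs (Im c)))"
    by (simp add: algebra_simps)
  then have 2: "exp (b * abs t) \<le> exp (b * abs d * abs y) * exp ((abs b) * (abs (Im c)))"
    by (simp add: exp_add)
  have "norm (F (vertical_line c d y)) \<le> C * abs t powr e * exp (b * abs t)"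
    unfolding w by (rule F) fact
  also have "\<dots> \<le> C * (K * (1 + abs y) powr e) * (exp (b * abs d * abs y) * exp ((abs b) * (abs (Im c))))"
    using \<open>C > 0\<close> by (intro mult_mono 1 2) (auto simp: K_def le_max_iff_disj)
  finally show "norm (F (vertical_line c d y)) \<le>
      (C * K * exp ((abs b) * (abs (Im c)))) * ((1 + abs y) powr e * exp (b * abs d * abs y))"
    by (simp add: mult_ac)
qed

lemma norm_Gamma_le_along_imaginary_axis:
  fixes c :: complex and d :: real
  assumes "d \<noteq> 0" and np: "\<And>y. vertical_line c d y \<notin> \<int>\<^sub>\<le>\<^sub>0"
  shows "\<exists>C>0. \<forall>y. norm (Gamma (vertical_line c d y)) \<le>
            C * ((1 + abs y) powr (Re c - 1 / 2) * exp (- (pi / 2) * abs d * abs y))"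
proof -
  obtain C where C: "C > 0" "\<forall>t. (abs t) \<ge> 1 \<longrightarrow>
      norm (Gamma (Complex (Re c) t)) \<le> C * abs t powr (Re c - 1 / 2) * exp (- (pi * abs t / 2))"
    using norm_Gamma_le_away_from_axis[of "Re c"] by blast
  show ?thesis
    using C np
    by (intro norm_le_along_imaginary_axis[OF assms(1) C(1)]
          continuous_on_compose2[OF continuous_on_Gamma[of "- \<int>\<^sub>\<le>\<^sub>0"]] continuous_intros) auto
qed

lemma norm_rGamma_le_along_imaginary_axis:
  fixes c :: complex and d :: real
  assumes "d \<noteq> 0"
  shows "\<exists>C>0. \<forall>y. norm (rGamma (vertical_line c d y)) \<le>
            C * ((1 + abs y) powr (1 / 2 - Re c) * exp (pi / 2 * abs d * abs y))"
proof -
  obtain C where C: "C > 0" "\<forall>t. (abs t) \<ge> 1 \<longrightarrow>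
      norm (rGamma (Complex (Re c) t)) \<le> C * abs t powr (1 / 2 - Re c) * exp (pi * abs t / 2)"
    using norm_rGamma_le_away_from_axis[of "Re c"] by blast
  show ?thesis
    using C
    by (intro norm_le_along_imaginary_axis[OF assms(1) C(1)]
          continuous_on_compose2[OF continuous_on_rGamma[of UNIV]] continuous_intros) auto
qed

section \<open>The integrand of the I-function\<close>

lemma Gamma_power_branch_at_pole:
  "is_Gamma_power_branch \<kappa> w P \<Longrightarrow> Re s = 0 \<Longrightarrow> w s \<in> \<int>\<^sub>\<le>\<^sub>0 \<Longrightarrow> P s = 0"
  by (simp add: is_Gamma_power_branch_def)

lemma Gamma_power_branch_regular:
  "is_Gamma_power_branch \<kappa> w P \<Longrightarrow> Re s = 0 \<Longrightarrow> w s \<notin> \<int>\<^sub>\<le>\<^sub>0 \<Longrightarrow>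
     \<exists>l. exp l = Gamma (w s) \<and> P s = exp (of_real \<kappa> * l)"
  by (simp add: is_Gamma_power_branch_def)

text \<open>
  All branches of the power have the same modulus, because \<open>\<kappa>\<close> is real. At a pole both sides are 0.
\<close>

lemma norm_Gamma_branch:
  assumes br: "Gamma_branch_choice br" and "\<kappa> > 0" "d \<noteq> 0" and s: "Re s = 0"
  shows "norm (br \<kappa> c d s) = norm (Gamma (c + of_real d * s)) powr \<kappa>"
proof -
  have b: "is_Gamma_power_branch \<kappa> (\<lambda>s. c + of_real d * s) (br \<kappa> c d)"
    using assms unfolding Gamma_branch_choice_def by blast
  show ?thesis
  proof (cases "c + of_real d * s \<in> \<int>\<^sub>\<le>\<^sub>0")
    case True
    then have "br \<kappa> c d s = 0" by (rule Gamma_power_branch_at_pole[OF b s])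
    then show ?thesis using True by (simp add: Gamma_eq_zero_iff)
  next
    case False
    then obtain l where l: "exp l = Gamma (c + of_real d * s)" "br \<kappa> c d s = exp (of_real \<kappa> * l)"
      using Gamma_power_branch_regular[OF b s] by blast
    show ?thesis unfolding l(2) l(1) [symmetric] by (simp add: powr_def)
  qed
qed

lemma Gamma_branch_1:
  assumes br: "Gamma_branch_choice br" and "d \<noteq> 0" and s: "Re s = 0"
  shows "br 1 c d s = Gamma (c + of_real d * s)"
proof -
  have b: "is_Gamma_power_branch 1 (\<lambda>s. c + of_real d * s) (br 1 c d)"
    using assms unfolding Gamma_branch_choice_def by (auto simp del: of_real_1)
  show ?thesis
  proof (cases "c + of_real d * s \<in> \<int>\<^sub>\<le>\<^sub>0")
    case True
    then have "br 1 c d s = 0" by (rule Gamma_power_branch_at_pole[OF b s])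
    then show ?thesis using True by (simp add: Gamma_eq_zero_iff)
  next
    case False
    then obtain l where "exp l = Gamma (c + of_real d * s)" "br 1 c d s = exp (of_real 1 * l)"
      using Gamma_power_branch_regular[OF b s] by blast
    then show ?thesis by simp
  qed
qed

lemma Gamma_branch_measurable:
  assumes br: "Gamma_branch_choice br" and "\<kappa> > 0" and d: "d \<noteq> 0"
  shows "(\<lambda>y. br \<kappa> c d (\<i> * of_real y)) \<in> borel_measurable borel"
proof -
  have b: "is_Gamma_power_branch \<kappa> (\<lambda>s. c + of_real d * s) (br \<kappa> c d)"
    using assms unfolding Gamma_branch_choice_def by blast
  define S where "S = {y. vertical_line c d y \<notin> \<int>\<^sub>\<le>\<^sub>0}"
  \<comment> \<open>The line meets the real axis at most once, so at most one point of it is a pole.\<close>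
  have "- S \<subseteq> {- Im c / d}"
  proof
    fix y assume "y \<in> - S"
    then have "Im (vertical_line c d y) = 0"
      using nonpos_Ints_imp_Re_Im[of "vertical_line c d y"] by (simp add: S_def)
    then show "y \<in> {- Im c / d}" using d by (simp add: field_simps)
  qed
  then have "closed (- S)" by (metis finite.emptyI finite.insertI finite_imp_closed finite_subset)
  then have "open S" unfolding closed_def by simp
  then have S: "S \<in> sets borel" by simp
  have cb: "continuous_on {s. Re s = 0 \<and> c + of_real d * s \<notin> \<int>\<^sub>\<le>\<^sub>0} (br \<kappa> c d)"
    using b unfolding is_Gamma_power_branch_def by blast
  have "continuous_on S (\<lambda>y. br \<kappa> c d (\<i> * of_real y))"
    by (rule continuous_on_compose2[OF cb, where f = "\<lambda>y. \<i> * of_real y"])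
       (auto simp: S_def intro!: continuous_intros)
  then have "(\<lambda>y. indicator S y *\<^sub>R br \<kappa> c d (\<i> * of_real y)) \<in> borel_measurable borel"
    by (intro borel_measurable_continuous_on_indicator S)
  moreover have "indicator S y *\<^sub>R br \<kappa> c d (\<i> * of_real y) = br \<kappa> c d (\<i> * of_real y)" for y
    using Gamma_power_branch_at_pole[OF b, of "\<i> * of_real y"] by (simp add: S_def indicator_def)
  ultimately show ?thesis by simp
qed

text \<open>
  The exponents \<open>e\<close> and \<open>b\<close> are explicit because they add up in products, while only the
  existence of the constant matters.
\<close>

definition axis_growth :: "(real \<Rightarrow> complex) \<Rightarrow> real \<Rightarrow> real \<Rightarrow> bool" where
  "axis_growth h e b \<longleftrightarrow> h \<in> borel_measurable borel \<and>
     (\<exists>C>0. \<forall>y. norm (h y) \<le> C * ((1 + abs y) powr e * exp (b * abs y)))"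

lemma axis_growth_const_1: "axis_growth (\<lambda>_. 1) 0 0"
  unfolding axis_growth_def
  by (intro conjI exI[of _ 1] allI) (simp_all add: add_nonneg_eq_0_iff)

lemma axis_growth_mult:
  assumes "axis_growth h1 e1 b1" "axis_growth h2 e2 b2"
  shows "axis_growth (\<lambda>y. h1 y * h2 y) (e1 + e2) (b1 + b2)"
proof -
  obtain C1 where C1: "C1 > 0" "\<forall>y. norm (h1 y) \<le> C1 * ((1 + abs y) powr e1 * exp (b1 * abs y))"
    using assms(1) unfolding axis_growth_def by blast
  obtain C2 where C2: "C2 > 0" "\<forall>y. norm (h2 y) \<le> C2 * ((1 + abs y) powr e2 * exp (b2 * abs y))"
    using assms(2) unfolding axis_growth_def by blast
  have m [measurable]: "h1 \<in> borel_measurable borel" "h2 \<in> borel_measurable borel"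
    using assms unfolding axis_growth_def by auto
  show ?thesis unfolding axis_growth_def
  proof (intro conjI exI[of _ "C1 * C2"] allI)
    fix y
    have "norm (h1 y * h2 y) \<le> (C1 * ((1 + abs y) powr e1 * exp (b1 * abs y))) * (C2 * ((1 + abs y) powr e2 * exp (b2 * abs y)))"
      unfolding norm_mult using C1 C2 by (intro mult_mono) auto
    also have "\<dots> = C1 * C2 * ((1 + abs y) powr (e1 + e2) * exp ((b1 + b2) * abs y))"
      by (simp add: powr_add exp_add ring_distribs mult_ac)
    finally show "norm (h1 y * h2 y) \<le> C1 * C2 * ((1 + abs y) powr (e1 + e2) * exp ((b1 + b2) * abs y))" .
  qed (use C1 C2 in auto)
qed

lemma axis_growth_prod_list:
  assumes "\<And>p. p \<in> set ps \<Longrightarrow> axis_growth (f p) (e p) (b p)"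
  shows "axis_growth (\<lambda>y. \<Prod>p\<leftarrow>ps. f p y) (\<Sum>p\<leftarrow>ps. e p) (\<Sum>p\<leftarrow>ps. b p)"
  using assms by (induction ps) (auto intro!: axis_growth_mult axis_growth_const_1)

lemma axis_growth_powr:
  fixes h g :: "real \<Rightarrow> complex"
  assumes h: "h \<in> borel_measurable borel" and \<kappa>: "\<kappa> \<ge> 0"
    and hn: "\<And>y. norm (h y) = norm (g y) powr \<kappa>"
    and g: "\<exists>C>0. \<forall>y. norm (g y) \<le> C * ((1 + abs y) powr e * exp (b * abs y))"
  shows "axis_growth h (\<kappa> * e) (\<kappa> * b)"
proof -
  obtain C where C: "C > 0" "\<forall>y. norm (g y) \<le> C * ((1 + abs y) powr e * exp (b * abs y))"
    using g by blast
  show ?thesis unfolding axis_growth_def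
  proof (intro conjI exI[of _ "C powr \<kappa>"] allI h)
    fix y :: real
    have "norm (h y) \<le> (C * ((1 + abs y) powr e * exp (b * abs y))) powr \<kappa>"
      unfolding hn using C \<kappa> by (intro powr_mono2) auto
    also have "\<dots> = C powr \<kappa> * (((1 + abs y) powr e) powr \<kappa> * exp (b * abs y) powr \<kappa>)"
      using C by (simp add: powr_mult)
    also have "((1 + abs y) powr e) powr \<kappa> = (1 + abs y) powr (\<kappa> * e)" by (simp add: powr_powr mult.commute)
    also have "exp (b * abs y) powr \<kappa> = exp (\<kappa> * b * abs y)" by (simp add: powr_def mult_ac)
    finally show "norm (h y) \<le> C powr \<kappa> * ((1 + abs y) powr (\<kappa> * e) * exp (\<kappa> * b * abs y))" .
  qed (use C in simp)
qed

lemma axis_growth_Gamma_branch: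
  assumes br: "Gamma_branch_choice br" and "\<kappa> > 0" "d \<noteq> 0"
    and np: "\<And>s. Re s = 0 \<Longrightarrow> c + of_real d * s \<notin> \<int>\<^sub>\<le>\<^sub>0"
  shows "axis_growth (\<lambda>y. br \<kappa> c d (\<i> * of_real y)) (\<kappa> * (Re c - 1 / 2)) (\<kappa> * (- (pi / 2) * abs d))"
proof (rule axis_growth_powr)
  show "norm (br \<kappa> c d (\<i> * of_real y)) = norm (Gamma (vertical_line c d y)) powr \<kappa>" for y
    using assms by (intro norm_Gamma_branch) auto
  show "\<exists>C>0. \<forall>y. norm (Gamma (vertical_line c d y)) \<le>
      C * ((1 + abs y) powr (Re c - 1 / 2) * exp (- (pi / 2) * abs d * abs y))"
    using assms(3) np by (intro norm_Gamma_le_along_imaginary_axis) auto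
qed (use assms Gamma_branch_measurable in auto)

lemma axis_growth_inverse_Gamma_branch:
  assumes br: "Gamma_branch_choice br" and "\<kappa> > 0" "d \<noteq> 0"
  shows "axis_growth (\<lambda>y. inverse (br \<kappa> c d (\<i> * of_real y))) (\<kappa> * (1 / 2 - Re c)) (\<kappa> * (pi / 2 * abs d))"
proof (rule axis_growth_powr)
  show "norm (inverse (br \<kappa> c d (\<i> * of_real y))) = norm (rGamma (vertical_line c d y)) powr \<kappa>" for y
  proof -
    have "norm (br \<kappa> c d (\<i> * of_real y)) = norm (Gamma (vertical_line c d y)) powr \<kappa>"
      using assms by (intro norm_Gamma_branch) auto
    then show ?thesis
      by (simp add: norm_inverse rGamma_inverse_Gamma powr_def ln_inverse exp_minus)
  qed
  show "\<exists>C>0. \<forall>y. norm (rGamma (vertical_line c d y)) \<le>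
      C * ((1 + abs y) powr (1 / 2 - Re c) * exp (pi / 2 * abs d * abs y))"
    using assms(3) by (rule norm_rGamma_le_along_imaginary_axis)
  show "(\<lambda>y. inverse (br \<kappa> c d (\<i> * of_real y))) \<in> borel_measurable borel"
    using Gamma_branch_measurable[OF assms, of c] by measurable
qed (use assms in auto)

lemma inverse_prod_list: "inverse (\<Prod>p\<leftarrow>ps. f p) = (\<Prod>p\<leftarrow>ps. inverse (f p :: 'a :: field))"
  by (induction ps) auto

text \<open>
  The exponents of the factors add up to \<open>\<Omega>\<close> and \<open>- \<pi> \<Delta> / 2\<close>.
\<close>

lemma axis_growth_chi:
  assumes br: "Gamma_branch_choice br" and par: "I_parameters m n us ls" and sep: "I_contour_separates m n us ls"
  shows "axis_growth (\<lambda>y. I_chi br m n us ls (\<i> * of_real y)) (I_Omega us ls) (- (pi / 2) * I_Delta m n us ls)"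
proof -
  have pos_u: "A > 0 \<and> \<kappa> > 0" if "(a, A, \<kappa>) \<in> set us" for a A \<kappa>
    using par that unfolding I_parameters_def by auto
  have pos_l: "B > 0 \<and> \<kappa> > 0" if "(b, B, \<kappa>) \<in> set ls" for b B \<kappa>
    using par that unfolding I_parameters_def by auto
  have num: "axis_growth (\<lambda>y. \<Prod>(a, A, \<kappa>)\<leftarrow>ps. br \<kappa> (c a) (d A) (\<i> * of_real y))
      (\<Sum>(a, A, \<kappa>)\<leftarrow>ps. \<kappa> * (Re (c a) - 1 / 2)) (\<Sum>(a, A, \<kappa>)\<leftarrow>ps. \<kappa> * (- (pi / 2) * (abs (d A))))"
    if ps: "\<forall>(a, A, \<kappa>)\<in>set ps. \<kappa> > 0 \<and> d A \<noteq> 0 \<and> (\<forall>s. Re s = 0 \<longrightarrow> c a + of_real (d A) * s \<notin> \<int>\<^sub>\<le>\<^sub>0)"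
    for ps :: "triple list" and c d
  proof -
    have "axis_growth (\<lambda>y. case p of (a, A, \<kappa>) \<Rightarrow> br \<kappa> (c a) (d A) (\<i> * of_real y))
        (case p of (a, A, \<kappa>) \<Rightarrow> \<kappa> * (Re (c a) - 1 / 2)) (case p of (a, A, \<kappa>) \<Rightarrow> \<kappa> * (- (pi / 2) * (abs (d A))))"
      if "p \<in> set ps" for p
    proof -
      obtain a A \<kappa> where p: "p = (a, A, \<kappa>)" by (cases p)
      with that ps have "\<kappa> > 0" "d A \<noteq> 0" "\<And>s. Re s = 0 \<Longrightarrow> c a + of_real (d A) * s \<notin> \<int>\<^sub>\<le>\<^sub>0" by auto
      from axis_growth_Gamma_branch[OF br this] show ?thesis unfolding p prod.case .
    qed
    then show ?thesis by (rule axis_growth_prod_list)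
  qed
  have den: "axis_growth (\<lambda>y. inverse (\<Prod>(a, A, \<kappa>)\<leftarrow>ps. br \<kappa> (c a) (d A) (\<i> * of_real y)))
      (\<Sum>(a, A, \<kappa>)\<leftarrow>ps. \<kappa> * (1 / 2 - Re (c a))) (\<Sum>(a, A, \<kappa>)\<leftarrow>ps. \<kappa> * (pi / 2 * (abs (d A))))"
    if ps: "\<forall>(a, A, \<kappa>)\<in>set ps. \<kappa> > 0 \<and> d A \<noteq> 0" for ps :: "triple list" and c d
  proof -
    have "axis_growth (\<lambda>y. inverse (case p of (a, A, \<kappa>) \<Rightarrow> br \<kappa> (c a) (d A) (\<i> * of_real y)))
        (case p of (a, A, \<kappa>) \<Rightarrow> \<kappa> * (1 / 2 - Re (c a))) (case p of (a, A, \<kappa>) \<Rightarrow> \<kappa> * (pi / 2 * (abs (d A))))"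
      if "p \<in> set ps" for p
    proof -
      obtain a A \<kappa> where p: "p = (a, A, \<kappa>)" by (cases p)
      with that ps have "\<kappa> > 0" "d A \<noteq> 0" by auto
      from axis_growth_inverse_Gamma_branch[OF br this] show ?thesis unfolding p prod.case .
    qed
    then show ?thesis unfolding inverse_prod_list by (rule axis_growth_prod_list)
  qed
  have lower: "\<forall>(b, B, \<kappa>)\<in>set (take m ls). \<kappa> > 0 \<and> B \<noteq> 0 \<and> (\<forall>s. Re s = 0 \<longrightarrow> b + of_real B * s \<notin> \<int>\<^sub>\<le>\<^sub>0)"
    using sep pos_l unfolding I_contour_separates_def by (fastforce dest: in_set_takeD)
  have upper: "\<forall>(a, A, \<kappa>)\<in>set (take n us). \<kappa> > 0 \<and> - A \<noteq> 0 \<and> (\<forall>s. Re s = 0 \<longrightarrow> 1 - a + of_real (- A) * s \<notin> \<int>\<^sub>\<le>\<^sub>0)"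
    using sep pos_u unfolding I_contour_separates_def by (fastforce dest: in_set_takeD)
  have lower': "\<forall>(b, B, \<kappa>)\<in>set (drop m ls). \<kappa> > 0 \<and> - B \<noteq> 0"
    using pos_l by (fastforce dest: in_set_dropD)
  have upper': "\<forall>(a, A, \<kappa>)\<in>set (drop n us). \<kappa> > 0 \<and> A \<noteq> 0"
    using pos_u by (fastforce dest: in_set_dropD)
  have split: "(\<Sum>p\<leftarrow>ps. h p) = (\<Sum>p\<leftarrow>take k ps. h p) + (\<Sum>p\<leftarrow>drop k ps. h p)" for k and ps :: "triple list" and h :: "triple \<Rightarrow> real"
    by (metis append_take_drop_id map_append sum_list_append)
  have flip: "(\<Sum>(a, A, \<kappa>)\<leftarrow>ps. \<kappa> * (Re (1 - a) - 1 / 2)) = (\<Sum>(a, A, \<kappa>)\<leftarrow>ps. (1 / 2 - Re a) * \<kappa>)"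
    "(\<Sum>(a, A, \<kappa>)\<leftarrow>ps. \<kappa> * (1 / 2 - Re a)) = (\<Sum>(a, A, \<kappa>)\<leftarrow>ps. (1 / 2 - Re a) * \<kappa>)"
    "(\<Sum>(a, A, \<kappa>)\<leftarrow>ps. \<kappa> * (Re a - 1 / 2)) = - (\<Sum>(a, A, \<kappa>)\<leftarrow>ps. (1 / 2 - Re a) * \<kappa>)"
    "(\<Sum>(a, A, \<kappa>)\<leftarrow>ps. \<kappa> * (1 / 2 - Re (1 - a))) = - (\<Sum>(a, A, \<kappa>)\<leftarrow>ps. (1 / 2 - Re a) * \<kappa>)" for ps :: "triple list"
    by (induction ps) (auto simp: algebra_simps)
  have Omega: "(\<Sum>(b, B, \<beta>)\<leftarrow>take m ls. \<beta> * (Re b - 1 / 2)) + (\<Sum>(a, A, \<alpha>)\<leftarrow>take n us. \<alpha> * (Re (1 - a) - 1 / 2)) +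
      ((\<Sum>(b, B, \<beta>)\<leftarrow>drop m ls. \<beta> * (1 / 2 - Re (1 - b))) + (\<Sum>(a, A, \<alpha>)\<leftarrow>drop n us. \<alpha> * (1 / 2 - Re a))) = I_Omega us ls"
    unfolding I_Omega_def flip
    using split[of "\<lambda>(a, A, \<kappa>). (1 / 2 - Re a) * \<kappa>" us n] split[of "\<lambda>(a, A, \<kappa>). (1 / 2 - Re a) * \<kappa>" ls m] by simp
  have sc: "(\<Sum>(a, A, \<kappa>)\<leftarrow>ps. \<kappa> * (- (pi / 2) * \<bar>A\<bar>)) = - (pi / 2) * (\<Sum>(a, A, \<kappa>)\<leftarrow>ps. \<kappa> * A)"
      "(\<Sum>(a, A, \<kappa>)\<leftarrow>ps. \<kappa> * (pi / 2 * \<bar>A\<bar>)) = pi / 2 * (\<Sum>(a, A, \<kappa>)\<leftarrow>ps. \<kappa> * A)"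
    if "\<forall>(a, A, \<kappa>)\<in>set ps. A > 0" for ps :: "triple list"
    using that by (induction ps) (force simp: algebra_simps)+
  have Delta: "(\<Sum>(b, B, \<beta>)\<leftarrow>take m ls. \<beta> * (- (pi / 2) * \<bar>B\<bar>)) + (\<Sum>(a, A, \<alpha>)\<leftarrow>take n us. \<alpha> * (- (pi / 2) * \<bar>- A\<bar>)) +
      ((\<Sum>(b, B, \<beta>)\<leftarrow>drop m ls. \<beta> * (pi / 2 * \<bar>- B\<bar>)) + (\<Sum>(a, A, \<alpha>)\<leftarrow>drop n us. \<alpha> * (pi / 2 * \<bar>A\<bar>))) =
      - (pi / 2) * I_Delta m n us ls"
  proof -
    have "\<forall>(b, B, \<kappa>)\<in>set (take m ls). B > 0" using pos_l by (auto dest: in_set_takeD)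
    note s1 = sc(1)[OF this]
    have "\<forall>(a, A, \<kappa>)\<in>set (take n us). A > 0" using pos_u by (auto dest: in_set_takeD)
    note s2 = sc(1)[OF this]
    have "\<forall>(b, B, \<kappa>)\<in>set (drop m ls). B > 0" using pos_l by (auto dest: in_set_dropD)
    note s3 = sc(2)[OF this]
    have "\<forall>(a, A, \<kappa>)\<in>set (drop n us). A > 0" using pos_u by (auto dest: in_set_dropD)
    note s4 = sc(2)[OF this]
    show ?thesis
      unfolding abs_minus_cancel s1 s2 s3 s4 by (simp add: I_Delta_def algebra_simps)
  qed
  have "I_chi br m n us ls s = ((\<Prod>(b, B, \<beta>)\<leftarrow>take m ls. br \<beta> b B s) * (\<Prod>(a, A, \<alpha>)\<leftarrow>take n us. br \<alpha> (1 - a) (- A) s)) *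
     (inverse (\<Prod>(b, B, \<beta>)\<leftarrow>drop m ls. br \<beta> (1 - b) (- B) s) * inverse (\<Prod>(a, A, \<alpha>)\<leftarrow>drop n us. br \<alpha> a A s))" for s
    by (simp only: I_chi_def divide_inverse inverse_mult_distrib)
  then show ?thesis
    using axis_growth_mult[OF axis_growth_mult[OF num[OF lower] num[OF upper]]
      axis_growth_mult[OF den[OF lower', of "\<lambda>b. 1 - b"] den[OF upper', of "\<lambda>a. a"]]]
    unfolding Omega Delta by (simp only:)
qed

lemma powr_le_exp:
  fixes k d :: real
  assumes d: "d > 0"
  shows "\<exists>C>0. \<forall>w\<ge>1. w powr k \<le> C * exp (d * w)"
proof -
  define e where "e = d / ((abs k) + 1)"
  have e: "e > 0" using d by (simp add: e_def add_nonneg_pos)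
  show ?thesis
  proof (intro exI[of _ "exp (- abs k * (1 + ln e))"] conjI allI impI)
    fix w :: real assume w: "w \<ge> 1"
    have 1: "k * ln w \<le> (abs k) * ln w" using w by (intro mult_right_mono) auto
    have "ln w = ln (e * w) - ln e" using e w by (simp add: ln_mult)
    moreover have "ln (e * w) \<le> e * w - 1" using e w by (intro ln_le_minus_one) auto
    ultimately have "abs k * ln w \<le> (abs k) * (e * w - 1 - ln e)" by (intro mult_left_mono) auto
    also have "\<dots> = ((abs k) * e) * w + - abs k * (1 + ln e)" by (simp add: algebra_simps)
    finally have 2: "abs k * ln w \<le> ((abs k) * e) * w + - abs k * (1 + ln e)" .
    have "abs k * e \<le> d" using d unfolding e_def by (simp add: field_simps)
    then have "((abs k) * e) * w \<le> d * w" using w by (intro mult_right_mono) auto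
    with 1 2 have "k * ln w \<le> d * w + - abs k * (1 + ln e)" by linarith
    then have "exp (k * ln w) \<le> exp (d * w + - abs k * (1 + ln e))" by simp
    then show "w powr k \<le> exp (- abs k * (1 + ln e)) * exp (d * w)"
      using w by (simp add: powr_def exp_add [symmetric] add.commute)
  qed simp
qed

lemma integrable_one_plus_abs_powr:
  fixes p :: real
  assumes p: "p < - 1"
  shows "integrable lborel (\<lambda>y :: real. (1 + abs y) powr p)"
proof -
  define k where "k = (\<lambda>w :: real. indicat_real {1..} w *\<^sub>R (w powr p))"
  have "(\<lambda>w :: real. w powr p) absolutely_integrable_on {1..}"
    using has_integral_powr_to_inf[OF p, of 1] by (intro nonnegative_absolutely_integrable_1) (auto simp: has_integral_iff)
  then have "integrable lebesgue k" unfolding k_def set_integrable_def .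
  moreover have "k \<in> borel_measurable borel" unfolding k_def by measurable
  ultimately have k: "integrable lborel k" using integrable_completion[of k lborel] by simp
  have "integrable lborel (\<lambda>y. k (1 + 1 * y) + k (1 + (-1) * y))"
    by (intro Bochner_Integration.integrable_add lborel_integrable_real_affine k) auto
  then show ?thesis
  proof (rule Bochner_Integration.integrable_bound)
    show "(\<lambda>y :: real. (1 + abs y) powr p) \<in> borel_measurable lborel" by measurable
    show "AE y in lborel. norm ((1 + abs y) powr p) \<le> norm (k (1 + 1 * y) + k (1 + (-1) * y))"
    proof (rule AE_I2)
      fix y :: real
      show "norm ((1 + abs y) powr p) \<le> norm (k (1 + 1 * y) + k (1 + (-1) * y))"
        by (cases "y \<ge> 0") (auto simp: k_def indicator_def)
    qed
  qed
qed

text \<open>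
  If \<open>b < 0\<close>, the exponential absorbs any power, so that both cases reduce to a power below \<open>-1\<close>.
\<close>

lemma axis_growth_integrable:
  assumes h: "axis_growth h e b" and b: "b < 0 \<or> b = 0 \<and> e < - 1"
  shows "integrable lborel h"
proof -
  obtain C where C: "C > 0" "\<forall>y. norm (h y) \<le> C * ((1 + abs y) powr e * exp (b * abs y))"
    using h unfolding axis_growth_def by blast
  have hm: "h \<in> borel_measurable borel" using h unfolding axis_growth_def by blast
  have "\<exists>D p. p < - 1 \<and> (\<forall>y. norm (h y) \<le> D * (1 + abs y) powr p)"
  proof (cases "b = 0")
    case True
    then show ?thesis using b C by auto
  next
    case False
    then have b0: "- b > 0" using b by auto
    obtain K where K: "K > 0" "\<forall>w\<ge>1. w powr (e + 2) \<le> K * exp (- b * w)"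
      using powr_le_exp[OF b0, of "e + 2"] by blast
    have "norm (h y) \<le> (C * K * exp (- b)) * (1 + abs y) powr (- 2)" for y
    proof -
      have "(1 + abs y) powr e = (1 + abs y) powr (e + 2) * (1 + abs y) powr (- 2)"
        by (simp add: powr_add [symmetric])
      also have "\<dots> \<le> (K * exp (- b * (1 + abs y))) * (1 + abs y) powr (- 2)"
        using K(2) by (intro mult_right_mono) auto
      finally have "norm (h y) \<le> C * (((K * exp (- b * (1 + abs y))) * (1 + abs y) powr (- 2)) * exp (b * abs y))"
        using C by (meson exp_ge_zero mult_left_mono mult_right_mono order_trans less_imp_le)
      also have "\<dots> = C * K * (exp (- b * (1 + abs y)) * exp (b * abs y)) * (1 + abs y) powr (- 2)"
        by (simp only: mult_ac)
      also have "exp (- b * (1 + abs y)) * exp (b * abs y) = exp (- b)"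
        by (simp add: exp_add [symmetric] algebra_simps)
      finally show ?thesis .
    qed
    then show ?thesis by (intro exI[of _ "C * K * exp (- b)"] exI[of _ "- 2"]) auto
  qed
  then obtain D p where p: "p < - 1" and D: "\<And>y. norm (h y) \<le> D * (1 + abs y) powr p" by blast
  show ?thesis
  proof (rule Bochner_Integration.integrable_bound)
    show "integrable lborel (\<lambda>y. D * (1 + abs y) powr p)"
      by (intro integrable_mult_right integrable_one_plus_abs_powr p)
    show "AE y in lborel. norm (h y) \<le> norm (D * (1 + abs y) powr p)"
      using D by (intro AE_I2) (metis norm_ge_zero order_trans real_norm_def abs_ge_self)
  qed (use hm in simp)
qed

text \<open>
  The factor \<open>z^(-s)\<close> with \<open>s = i y\<close> has modulus \<open>exp (\<theta> y)\<close>, and the convergence conditions compare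
  \<open>\<bar>\<theta>\<bar>\<close> with \<open>\<pi> \<Delta> / 2\<close>.
\<close>

theorem I_fun_integrand_integrable:
  assumes br: "Gamma_branch_choice br" and adm: "I_admissible m n us ls \<theta>"
  shows "integrable lborel (\<lambda>y. I_chi br m n us ls (\<i> * of_real y) *
     exp (- (\<i> * of_real y) * (of_real r + \<i> * of_real \<theta>)))"
proof (rule axis_growth_integrable)
  have e: "axis_growth (\<lambda>y. exp (- (\<i> * of_real y) * (of_real r + \<i> * of_real \<theta>))) 0 \<bar>\<theta>\<bar>"
    unfolding axis_growth_def
  proof (intro conjI exI[of _ 1] allI)
    show "(\<lambda>y. exp (- (\<i> * of_real y) * (of_real r + \<i> * of_real \<theta>))) \<in> borel_measurable borel"
      by (intro borel_measurable_continuous_onI continuous_intros)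
    fix y :: real
    have "y * \<theta> \<le> \<bar>\<theta>\<bar> * abs y" by (metis abs_ge_self abs_mult mult.commute)
    then show "norm (exp (- (\<i> * of_real y) * (of_real r + \<i> * of_real \<theta>))) \<le> 1 * ((1 + abs y) powr 0 * exp (\<bar>\<theta>\<bar> * abs y))"
      by (simp add: add_nonneg_eq_0_iff)
  qed simp
  show "axis_growth (\<lambda>y. I_chi br m n us ls (\<i> * of_real y) * exp (- (\<i> * of_real y) * (of_real r + \<i> * of_real \<theta>)))
     (I_Omega us ls + 0) (- (pi / 2) * I_Delta m n us ls + \<bar>\<theta>\<bar>)"
    using adm unfolding I_admissible_def by (intro axis_growth_mult e axis_growth_chi br) auto
  show "- (pi / 2) * I_Delta m n us ls + \<bar>\<theta>\<bar> < 0 \<or> - (pi / 2) * I_Delta m n us ls + \<bar>\<theta>\<bar> = 0 \<and> I_Omega us ls + 0 < - 1"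
    using adm unfolding I_admissible_def I_convergence_def by auto
qed

section \<open>The fractional integral of an I-function\<close>

text \<open>
  With \<open>s = i y\<close>, the integrand of the double integral is \<open>K(t) G(y) t^(\<mu> s)\<close>, where \<open>K\<close> is the kernel for
  \<open>t^(-\<rho>)\<close> and \<open>G(y) = \<chi>(s) a^(-s)\<close>. Integrating over \<open>t\<close> first is \<open>MSM_right_power\<close> at
  \<open>\<rho> - \<mu> s\<close>, whose real part is that of \<open>\<rho>\<close>.
\<close>

theorem theorem3p2:
  fixes \<alpha> \<alpha>' \<beta> \<beta>' \<gamma> \<rho> a :: complex and \<mu> \<theta> x :: real and m n p q :: nat
    and us ls U L :: "triple list" and br :: Gamma_branches and f :: "real \<Rightarrow> complex"
  assumes "length us = p" and "length ls = q" and "m \<le> q" and "n \<le> p"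
    and "Gamma_branch_choice br"
    and "a \<noteq> 0" and "is_Arg a \<theta>"
    and "\<mu> > 0" and "Re \<gamma> > 0"
    and "Re \<rho> > Max {Re \<beta>, Re (- \<alpha> - \<alpha>' + \<gamma>), Re (- \<alpha> - \<beta>' + \<gamma>)}"
    and "U = [(1 + \<beta> - \<rho>, \<mu>, 1), (1 - \<alpha> - \<alpha>' + \<gamma> - \<rho>, \<mu>, 1),
              (1 - \<alpha> - \<beta>' + \<gamma> - \<rho>, \<mu>, 1)] @ us"
    and "L = ls @ [(1 - \<rho>, \<mu>, 1), (1 - \<alpha> + \<beta> - \<rho>, \<mu>, 1),
                   (1 - \<alpha> - \<alpha>' - \<beta>' + \<gamma> - \<rho>, \<mu>, 1)]"
    and "I_admissible m n us ls \<theta>"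
    and "I_admissible m (n + 3) U L \<theta>"
    and "f = (\<lambda>t. of_real t powr (- \<rho>) * I_fun br m n us ls \<theta> (a * of_real (t powr (- \<mu>))))"
    and "x > 0"
  shows "set_integrable lborel {x<..} (MSM_right_integrand \<alpha> \<alpha>' \<beta> \<beta>' \<gamma> f x) \<and>
         MSM_right \<alpha> \<alpha>' \<beta> \<beta>' \<gamma> f x =
           of_real x powr (- \<alpha> - \<alpha>' + \<gamma> - \<rho>) *
           I_fun br m (n + 3) U L \<theta> (a * of_real (x powr (- \<mu>)))"
proof -
  let ?M = "MSM_right_integrand \<alpha> \<alpha>' \<beta> \<beta>' \<gamma>"
  let ?I = "I_fun br m (n + 3) U L \<theta> (a * of_real (x powr (- \<mu>)))"
  note br = assms(5) and a = assms(6) and \<mu> = assms(8) and \<gamma> = assms(9) and U = assms(11) and L = assms(12)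
    and adm = assms(13) and f = assms(15) and x = assms(16)
  have \<rho>: "Re \<rho> > Re \<beta>" "Re \<rho> > Re (- \<alpha> - \<alpha>' + \<gamma>)" "Re \<rho> > Re (- \<alpha> - \<beta>' + \<gamma>)"
    using assms(10) by (simp_all del: plus_complex.simps minus_complex.simps uminus_complex.simps)
  have mls: "m \<le> length ls" using assms by simp
  define chi where "chi = (\<lambda>y. I_chi br m n us ls (\<i> * of_real y))"
  define G where "G = (\<lambda>y. chi y * exp (- (\<i> * of_real y) * (of_real (ln (cmod a)) + \<i> * of_real \<theta>)))"
  define E where "E = (\<lambda>t y. exp (\<i> * of_real (\<mu> * y * ln t)) :: complex)"
  define K where "K = (\<lambda>t. indicat_real {x<..} t *\<^sub>R ?M (\<lambda>t. of_real t powr (- \<rho>)) x t)"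
  define h where "h = (\<lambda>(t, y). K t * (G y * E t y))"
  have Gi: "integrable lborel G"
    unfolding G_def chi_def by (rule I_fun_integrand_integrable[OF br adm])
  have Ki: "integrable lborel K"
    using MSM_right_power(1)[OF \<gamma> x \<rho>] unfolding K_def set_integrable_def .
  have E_norm: "norm (E t y) = 1" for t y by (simp add: E_def)
  have [measurable]: "G \<in> borel_measurable borel" "K \<in> borel_measurable borel"
    using Gi Ki by auto
  have hm: "h \<in> borel_measurable (lborel \<Otimes>\<^sub>M lborel)"
    unfolding h_def E_def by measurable
  have hn: "norm (h (t, y)) = norm (K t) * norm (G y)" for t y
    by (simp add: h_def norm_mult E_norm)
  have hi: "integrable (lborel \<Otimes>\<^sub>M lborel) h"
  proof (rule lborel_pair.Fubini_integrable[OF hm])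
    show "integrable lborel (\<lambda>t. LINT y|lborel. norm (h (t, y)))"
      unfolding hn using Ki by (simp add: integrable_norm)
    have m: "(\<lambda>y. h (t, y)) \<in> borel_measurable lborel" for t
      by (rule measurable_compose_Pair1[OF _ hm]) simp
    show "AE t in lborel. integrable lborel (\<lambda>y. h (t, y))"
    proof (rule AE_I2)
      fix t
      have "integrable lborel (\<lambda>y. norm (K t) * norm (G y))" using Gi by (simp add: integrable_norm)
      then show "integrable lborel (\<lambda>y. h (t, y))"
        by (rule Bochner_Integration.integrable_bound[OF _ m]) (simp add: hn)
    qed
  qed
  \<comment> \<open>E t y is the value of t to the power \<mu> s on the contour.\<close>
  have expand: "exp (- (\<i> * of_real y) * (of_real (ln (cmod (a * of_real (t powr (- \<mu>))))) + \<i> * of_real \<theta>)) =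
     exp (- (\<i> * of_real y) * (of_real (ln (cmod a)) + \<i> * of_real \<theta>)) * E t y" if "t > 0" for t y
  proof -
    have l: "ln (cmod (a * of_real (t powr (- \<mu>)))) = ln (cmod a) - \<mu> * ln t"
      using a that by (simp add: norm_mult ln_mult ln_powr)
    show ?thesis unfolding l by (simp add: E_def exp_add [symmetric] algebra_simps)
  qed
  have I1: "I_fun br m n us ls \<theta> (a * of_real (t powr (- \<mu>))) = 1 / (2 * of_real pi) * (LINT y|lborel. G y * E t y)" if "t > 0" for t
    unfolding I_fun_def expand[OF that] by (simp add: G_def chi_def mult.assoc [symmetric])
  have integrand: "indicat_real {x<..} t *\<^sub>R ?M f x t = 1 / (2 * of_real pi) * (LINT y|lborel. h (t, y))" for t
  proof (cases "t > x")
    case True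
    then have "t > 0" using x by simp
    have "(LINT y|lborel. h (t, y)) = K t * (LINT y|lborel. G y * E t y)" by (simp add: h_def)
    then show ?thesis
      using True by (simp add: f I1[OF \<open>t > 0\<close>] K_def MSM_right_integrand_def)
  qed (simp add: h_def K_def)
  have "integrable lborel (\<lambda>t. LINT y|lborel. h (t, y))"
    using lborel_pair.integrable_fst'[OF hi] by simp
  then have int: "set_integrable lborel {x<..} (?M f x)"
    unfolding set_integrable_def integrand by (rule integrable_mult_right)
  define R where "R = (\<lambda>s. (Gamma (\<rho> - \<beta> - of_real \<mu> * s) * Gamma (\<alpha> + \<alpha>' - \<gamma> + \<rho> - of_real \<mu> * s) * Gamma (\<alpha> + \<beta>' - \<gamma> + \<rho> - of_real \<mu> * s)) *
      (rGamma (\<rho> - of_real \<mu> * s) * rGamma (\<alpha> - \<beta> + \<rho> - of_real \<mu> * s) * rGamma (\<alpha> + \<alpha>' + \<beta>' - \<gamma> + \<rho> - of_real \<mu> * s)))"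
  have inner: "(LINT t|lborel. h (t, y)) = G y * (Gamma \<gamma> * R (\<i> * of_real y) * of_real x powr (\<gamma> - \<alpha> - \<rho>) * E x y)" for y
  proof -
    define s where "s = \<rho> - of_real \<mu> * (\<i> * of_real y)"
    have "indicat_real {x<..} t *\<^sub>R ?M (\<lambda>t. of_real t powr (- s)) x t = K t * E t y" for t
    proof (cases "t > x")
      case True
      then have "t > 0" using x by simp
      then have "of_real t powr (- s) = of_real t powr (- \<rho>) * E t y"
        by (simp add: s_def E_def powr_def Ln_of_real exp_add [symmetric] algebra_simps)
      then show ?thesis by (simp add: K_def MSM_right_integrand_def)
    qed (simp add: K_def)
    then have "(LINT t|lborel. K t * E t y) = (LINT t:{x<..}|lborel. ?M (\<lambda>t. of_real t powr (- s)) x t)"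
      unfolding set_lebesgue_integral_def by simp
    also have "\<dots> = Gamma \<gamma> * (Gamma (s - \<beta>) * Gamma (\<alpha> + \<alpha>' - \<gamma> + s) * Gamma (\<alpha> + \<beta>' - \<gamma> + s)) *
      (rGamma s * rGamma (\<alpha> - \<beta> + s) * rGamma (\<alpha> + \<alpha>' + \<beta>' - \<gamma> + s)) * of_real x powr (\<gamma> - \<alpha> - s)"
      using \<rho> by (intro MSM_right_power(2) \<gamma> x) (simp_all add: s_def)
    also have "of_real x powr (\<gamma> - \<alpha> - s) = of_real x powr (\<gamma> - \<alpha> - \<rho>) * E x y"
      using x by (simp add: s_def E_def powr_def Ln_of_real exp_add [symmetric] algebra_simps)
    also have "Gamma \<gamma> * (Gamma (s - \<beta>) * Gamma (\<alpha> + \<alpha>' - \<gamma> + s) * Gamma (\<alpha> + \<beta>' - \<gamma> + s)) *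
      (rGamma s * rGamma (\<alpha> - \<beta> + s) * rGamma (\<alpha> + \<alpha>' + \<beta>' - \<gamma> + s)) = Gamma \<gamma> * R (\<i> * of_real y)"
      by (simp add: R_def s_def algebra_simps)
    finally have v: "(LINT t|lborel. K t * E t y) = Gamma \<gamma> * R (\<i> * of_real y) * (of_real x powr (\<gamma> - \<alpha> - \<rho>) * E x y)" .
    have "h (t, y) = G y * (K t * E t y)" for t by (simp add: h_def)
    then show ?thesis by (simp add: v mult.assoc)
  qed
  \<comment> \<open>The exponent 1 of the new triples leaves no choice of branch, and at a pole of a denominator factor the branch value 0 gives the reciprocal 0.\<close>
  have chiU: "I_chi br m (n + 3) U L s = I_chi br m n us ls s * R s" if s: "Re s = 0" for s
  proof -
    have g: "br 1 c \<mu> s = Gamma (c + of_real \<mu> * s)" "br 1 c (- \<mu>) s = Gamma (c - of_real \<mu> * s)" for c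
      using Gamma_branch_1[OF br _ s, of \<mu> c] Gamma_branch_1[OF br _ s, of "- \<mu>" c] \<mu> by simp_all
    have t: "take m L = take m ls" "drop m L = drop m ls @ [(1 - \<rho>, \<mu>, 1), (1 - \<alpha> + \<beta> - \<rho>, \<mu>, 1), (1 - \<alpha> - \<alpha>' - \<beta>' + \<gamma> - \<rho>, \<mu>, 1)]"
      "take (n + 3) U = [(1 + \<beta> - \<rho>, \<mu>, 1), (1 - \<alpha> - \<alpha>' + \<gamma> - \<rho>, \<mu>, 1), (1 - \<alpha> - \<beta>' + \<gamma> - \<rho>, \<mu>, 1)] @ take n us"
      "drop (n + 3) U = drop n us"
      using mls by (simp_all add: U L numeral_3_eq_3)
    have R: "R s = (Gamma (1 - (1 + \<beta> - \<rho>) - of_real \<mu> * s) * Gamma (1 - (1 - \<alpha> - \<alpha>' + \<gamma> - \<rho>) - of_real \<mu> * s) * Gamma (1 - (1 - \<alpha> - \<beta>' + \<gamma> - \<rho>) - of_real \<mu> * s)) *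
      (inverse (Gamma (1 - (1 - \<rho>) - of_real \<mu> * s)) * inverse (Gamma (1 - (1 - \<alpha> + \<beta> - \<rho>) - of_real \<mu> * s)) * inverse (Gamma (1 - (1 - \<alpha> - \<alpha>' - \<beta>' + \<gamma> - \<rho>) - of_real \<mu> * s)))"
      unfolding R_def rGamma_inverse_Gamma by (simp add: algebra_simps)
    show ?thesis unfolding I_chi_def t R
      by (simp add: g divide_inverse mult_ac)
  qed
  have "MSM_right \<alpha> \<alpha>' \<beta> \<beta>' \<gamma> f x = of_real x powr (- \<alpha>') / Gamma \<gamma> * (1 / (2 * of_real pi) * (LINT t|lborel. LINT y|lborel. h (t, y)))"
    unfolding MSM_right_def set_lebesgue_integral_def integrand by (simp only: integral_mult_right_zero)
  also have "(LINT t|lborel. LINT y|lborel. h (t, y)) = (LINT y|lborel. LINT t|lborel. h (t, y))"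
    using lborel_pair.Fubini_integral[of "\<lambda>t y. h (t, y)"] hi by simp
  also have "\<dots> = (LINT y|lborel. (Gamma \<gamma> * of_real x powr (\<gamma> - \<alpha> - \<rho>)) * (G y * R (\<i> * of_real y) * E x y))"
    unfolding inner by (simp only: mult_ac)
  also have "\<dots> = (Gamma \<gamma> * of_real x powr (\<gamma> - \<alpha> - \<rho>)) * (LINT y|lborel. G y * R (\<i> * of_real y) * E x y)"
    by (rule integral_mult_right_zero)
  also have "(LINT y|lborel. G y * R (\<i> * of_real y) * E x y) = 2 * of_real pi * ?I"
  proof -
    have "I_chi br m (n + 3) U L (\<i> * of_real y) *
        (exp (- (\<i> * of_real y) * (of_real (ln (cmod a)) + \<i> * of_real \<theta>)) * E x y) * \<i> = \<i> * (G y * R (\<i> * of_real y) * E x y)" for y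
      by (simp add: chiU G_def chi_def mult_ac)
    then show ?thesis
      unfolding I_fun_def expand[OF x] by (simp only: integral_mult_right_zero) simp
  qed
  also have "of_real x powr (- \<alpha>') / Gamma \<gamma> * (1 / (2 * of_real pi) * (Gamma \<gamma> * of_real x powr (\<gamma> - \<alpha> - \<rho>) *
      (2 * of_real pi * ?I))) =
     (of_real x powr (- \<alpha>') * of_real x powr (\<gamma> - \<alpha> - \<rho>)) * ?I"
    using Re_pos_not_nonpos_Int[OF \<gamma>] by (simp add: Gamma_eq_zero_iff)
  also have "of_real x powr (- \<alpha>') * of_real x powr (\<gamma> - \<alpha> - \<rho>) = (of_real x powr (- \<alpha> - \<alpha>' + \<gamma> - \<rho>) :: complex)"
  proof -
    have "- \<alpha>' + (\<gamma> - \<alpha> - \<rho>) = - \<alpha> - \<alpha>' + \<gamma> - \<rho>" by simp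
    then show ?thesis by (simp only: powr_add [symmetric])
  qed
  finally show ?thesis using int by blast
qed

end
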